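(* Fix a positive integer $d$. Let $F$ be a non-singular integral form of degree $d$ such that $\mathrm{o}(F)\geq 3$. Then there exists a constant $M$ such that for all primes $p>M$, $R(F)$ is dense in $\mathbb{Q}_p$.
   Context: A form is a homogeneous polynomial; it is integral if its coefficients lie in $\mathbb{Z}$. For an integral form $F$ in $r$ variables, $R(F)=\{F(\overline{x})/F(\overline{y}) : \overline{x},\overline{y}\in\mathbb{Z}^r,\ F(\overline{y})\neq 0\}$, and density is in the $p$-adic topology. A form $F\in\mathbb{Z}[x_0,\dots,x_n]$ is non-singular if the partial derivatives $\partial F/\partial x_0,\dots,\partial F/\partial x_n$ have no common zero in projective space $\mathbb{P}^n(\overline{\mathbb{Q}})$. The order $\mathrm{o}(F)$ of a form $F$ over a field $K$ (here $K=\mathbb{Q}$) is the smallest integer $m$ such that $F$ is equivalent, via an invertible linear change of variables over $K$, to a form which explicitly involves only $m$ variables. *)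

theory Defs
  imports Complex_Main "HOL-Computational_Algebra.Polynomial"
begin

text \<open>An integral form in the r = n+1 variables x_0..x_n is represented by its
coefficient function c on exponent vectors (nat => nat), with finite support.\<close>

definition is_form :: "nat \<Rightarrow> nat \<Rightarrow> ((nat \<Rightarrow> nat) \<Rightarrow> int) \<Rightarrow> bool" where
  "is_form n d c \<longleftrightarrow> finite {\<alpha>. c \<alpha> \<noteq> 0} \<and>
     (\<forall>\<alpha>. c \<alpha> \<noteq> 0 \<longrightarrow> (\<forall>i>n. \<alpha> i = 0) \<and> (\<Sum>i\<le>n. \<alpha> i) = d)"

definition form_eval :: "((nat \<Rightarrow> nat) \<Rightarrow> int) \<Rightarrow> nat \<Rightarrow> (nat \<Rightarrow> 'a::comm_ring_1) \<Rightarrow> 'a" where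
  "form_eval c n x = (\<Sum>\<alpha>\<in>{\<alpha>. c \<alpha> \<noteq> 0}. of_int (c \<alpha>) * (\<Prod>i\<le>n. x i ^ \<alpha> i))"

definition form_deriv_eval ::
  "((nat \<Rightarrow> nat) \<Rightarrow> int) \<Rightarrow> nat \<Rightarrow> nat \<Rightarrow> (nat \<Rightarrow> 'a::comm_ring_1) \<Rightarrow> 'a" where
  "form_deriv_eval c n j x = (\<Sum>\<alpha>\<in>{\<alpha>. c \<alpha> \<noteq> 0}. of_int (c \<alpha>) * of_nat (\<alpha> j) *
      (\<Prod>i\<le>n. if i = j then x i ^ (\<alpha> i - 1) else x i ^ \<alpha> i))"

text \<open>Non-singular: the partial derivatives have no common nontrivial zero with
coordinates in the algebraic closure of Q (the algebraic complex numbers).\<close>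
definition non_singular :: "nat \<Rightarrow> ((nat \<Rightarrow> nat) \<Rightarrow> int) \<Rightarrow> bool" where
  "non_singular n c \<longleftrightarrow>
     \<not> (\<exists>x :: nat \<Rightarrow> complex. (\<forall>i\<le>n. algebraic (x i)) \<and> (\<exists>i\<le>n. x i \<noteq> 0) \<and>
          (\<forall>j\<le>n. form_deriv_eval c n j x = 0))"

definition invertible_mat :: "nat \<Rightarrow> (nat \<Rightarrow> nat \<Rightarrow> rat) \<Rightarrow> bool" where
  "invertible_mat n A \<longleftrightarrow> (\<exists>B. (\<forall>i\<le>n. \<forall>k\<le>n. (\<Sum>j\<le>n. A i j * B j k) = (if i = k then 1 else 0)) \<and>
                              (\<forall>i\<le>n. \<forall>k\<le>n. (\<Sum>j\<le>n. B i j * A j k) = (if i = k then 1 else 0)))"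

definition mat_apply :: "nat \<Rightarrow> (nat \<Rightarrow> nat \<Rightarrow> rat) \<Rightarrow> (nat \<Rightarrow> rat) \<Rightarrow> nat \<Rightarrow> rat" where
  "mat_apply n A x = (\<lambda>i. \<Sum>j\<le>n. A i j * x j)"

text \<open>The transformed form F(Ax) involves only the variables in S (over the
infinite field Q, as a function of x in Q^(n+1)).\<close>
definition involves_only :: "nat \<Rightarrow> ((nat \<Rightarrow> rat) \<Rightarrow> rat) \<Rightarrow> nat set \<Rightarrow> bool" where
  "involves_only n G S \<longleftrightarrow> (\<forall>x y. (\<forall>i\<in>S. x i = y i) \<longrightarrow> G x = G y)"

definition form_order :: "nat \<Rightarrow> ((nat \<Rightarrow> nat) \<Rightarrow> int) \<Rightarrow> nat" where
  "form_order n c = (LEAST m. \<exists>A S. invertible_mat n A \<and> S \<subseteq> {..n} \<and> card S = m \<and>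
        involves_only n (\<lambda>x. form_eval c n (mat_apply n A x)) S)"

definition ratio_set :: "nat \<Rightarrow> ((nat \<Rightarrow> nat) \<Rightarrow> int) \<Rightarrow> rat set" where
  "ratio_set n c = {of_int (form_eval c n x) / of_int (form_eval c n y) | x y :: nat \<Rightarrow> int.
                     form_eval c n y \<noteq> 0}"

text \<open>A set of rationals is dense in Q_p iff (Q being dense in Q_p) it approximates
every rational q p-adically to any precision: r - q in p^k Z_(p).\<close>
definition padic_dense :: "nat \<Rightarrow> rat set \<Rightarrow> bool" where
  "padic_dense p R \<longleftrightarrow> (\<forall>q::rat. \<forall>k::nat. \<exists>r\<in>R. \<exists>a b :: int.
      b \<noteq> 0 \<and> \<not> int p dvd b \<and> r - q = of_int (int p ^ k * a) / of_int b)"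

end

theory Submission
  imports Defs "Berlekamp_Zassenhaus.Finite_Field" "Jordan_Normal_Form.Char_Poly"
    "HOL-Computational_Algebra.Computational_Algebra" "HOL-Computational_Algebra.Field_as_Ring"
begin

text \<open>
  If a form \<open>F\<close> has a smooth zero modulo \<open>p\<close>, Hensel's lemma shows that \<open>F\<close> represents every element
  of \<open>p\<int>\<^sub>p\<close> up to any precision, so quotients of its values are dense. It remains to find smooth zeros.

  Bertini: some rational plane section of \<open>F\<close> is irreducible over \<open>\<complex>\<close>. Choose a line meeting \<open>F = 0\<close>
  in \<open>d\<close> distinct points, and a plane through it for which as few factors of the restriction of \<open>F\<close> to the
  line as possible extend to factors of the restriction to the plane. By minimality and Hensel lifting, such
  a factor extends along every pencil of planes. Two complementary factors have a common zero (Bezout), and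
  differentiating the factorisation along all pencils makes this zero a singular point of \<open>F\<close>.

  Stepanov: let \<open>f(x, Y)\<close> be the resulting affine equation, monic of degree \<open>d\<close> in \<open>Y\<close>, and let \<open>D\<close> be the
  derivation \<open>f\<^sub>Y d/dx\<close> of the curve. If \<open>f\<close> has no smooth zero modulo \<open>p\<close>, then \<open>w = Y\<^sup>p\<close> is, over almost every
  \<open>x \<in> \<bbbF>\<^sub>p\<close>, a zero of \<open>(f(x, w) - f(x, Y)) / (w - Y)\<close>, which has degree \<open>d - 1\<close> only. Counting
  parameters yields a nonzero combination \<open>\<Phi>\<close> of bounded size of the functions
  \<open>x\<^sup>\<alpha> Y\<^sup>i x\<^sup>p\<^sup>j Y\<^sup>p\<^sup>k\<close> that vanishes to order \<open>M\<close> over all \<open>x \<in> \<bbbF>\<^sub>p\<close>; for large \<open>p\<close> it has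
  more zeros than its degree allows. Hence \<open>\<Phi> = 0\<close> on the curve, which contradicts the fact that the Wronskian
  of the monomials \<open>x\<^sup>\<alpha> Y\<^sup>i\<close> is nonzero in characteristic zero, hence modulo almost all \<open>p\<close>.
\<close>

text \<open>Irreducibility can be lost modulo p, so it is used over the complex numbers only. What
  passes to characteristic p is one identity over Z[x][Y],
  \<open>[:\<Omega>:] = det W * pderiv f * z + f * z'\<close>, with \<open>\<Omega>\<close> a
  nonzero polynomial in x and W the Wronskian matrix. Modulo every large p it says that f is
  squarefree, that the Wronskian can be cancelled modulo f, and that points of the curve with f_Y =
  0 lie over roots of \<open>\<Omega>\<close>.

  The gain from the degree d - 1 in w: vanishing to order M imposes M (d - 1) conditions on
  functions of bounded degree, against J d free functions, while the comparison of zeros and degree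
  needs M = J + d + 1. Both fit as soon as J d > M (d - 1); A then only has to dominate lower terms.

  Non-singularity speaks of nonzero algebraic points. So the singular points produced over the
  complex numbers must be shown to be algebraic and different from the origin; the latter is read
  off from a linear form orthogonal to two given vectors, for which order at least 3 leaves
  room.\<close>

hide_const (open) up_ring.coeff up_ring.monom Coset.order

subsection \<open>Division by a monic polynomial and norms\<close>

text \<open>With leading coefficient 1, long division works over any commutative ring. The remainder
  is bounded through vanishing coefficients, which forces \<open>r = 0\<close> when
  \<open>degree f = 0\<close>; a bound on its degree could not express this.\<close>

lemma monic_division:
  fixes f h :: "'a::comm_ring_1 poly"
  assumes "lead_coeff f = 1"
  obtains q r where "h = f * q + r" "\<And>k. degree f \<le> k \<Longrightarrow> coeff r k = 0"
proof -
  have "\<exists>q r. h = f * q + r \<and> (\<forall>k\<ge>degree f. coeff r k = 0)" if "\<forall>k\<ge>n. coeff h k = 0" for n h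
    using that
  proof (induction n arbitrary: h)
    case 0
    then have "h = f * 0 + 0" by (simp add: poly_eq_iff)
    then show ?case by (metis coeff_0)
  next
    case (Suc n)
    show ?case
    proof (cases "degree f \<le> n")
      case False
      then show ?thesis using Suc.prems by (intro exI[of _ 0] exI[of _ h]) auto
    next
      case True
      let ?m = "monom (coeff h n) (n - degree f)"
      have "coeff (h - f * ?m) k = 0" if "k \<ge> n" for k
      proof (cases "k = n")
        case True
        then show ?thesis using \<open>degree f \<le> n\<close> assms
          by (simp add: coeff_monom_mult mult.commute[of f] )
      next
        case False
        then show ?thesis using \<open>degree f \<le> n\<close> that Suc.prems
          by (simp add: coeff_monom_mult mult.commute[of f] coeff_eq_0)
      qed
      then obtain q r where "h - f * ?m = f * q + r" and r: "\<forall>k\<ge>degree f. coeff r k = 0"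
        using Suc.IH by blast
      then have "h = f * (q + ?m) + r" by (simp add: algebra_simps)
      then show ?thesis using r by blast
    qed
  qed
  from this[of "Suc (degree h)" h] obtain q r where "h = f * q + r" "\<forall>k\<ge>degree f. coeff r k = 0"
    using coeff_eq_0 Suc_le_lessD by metis
  then show ?thesis using that by blast
qed

lemma monic_dvd_small:
  fixes f r :: "'a::idom poly"
  assumes "f dvd r" "f \<noteq> 0" "\<And>k. degree f \<le> k \<Longrightarrow> coeff r k = 0"
  shows "r = 0"
proof (rule ccontr)
  assume "r \<noteq> 0"
  then have "degree f \<le> degree r" using assms(1) dvd_imp_degree_le by blast
  then show False using assms(3) \<open>r \<noteq> 0\<close> by fastforce
qed

text \<open>Multiplication by \<open>h\<close> on the free module R[Y]/(f) with basis 1, Y, ... has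
  a square matrix. If it is singular, a kernel vector is a nonzero class \<open>v\<close> killed by
  \<open>h\<close>; otherwise its determinant, the norm of \<open>h\<close>, is a multiple of
  \<open>h\<close> modulo \<open>f\<close>. This dichotomy takes the place of resultants and yields
  identities that survive reduction modulo p.\<close>

lemma monic_norm:
  fixes f h :: "'a::idom poly"
  assumes f: "lead_coeff f = 1"
  obtains (zero_divisor) v where "v \<noteq> 0" "\<And>k. degree f \<le> k \<Longrightarrow> coeff v k = 0" "f dvd v * h"
    | (norm) \<Omega> z z' where "\<Omega> \<noteq> 0" "[:\<Omega>:] = h * z + f * z'"
proof -
  define d where "d = degree f"
  show thesis
  proof (cases "d = 0")
    case True
    then have "f = 1" using f unfolding d_def by (metis degree_0_id pCons_one)
    then show ?thesis using norm[of 1 0 1] by (simp add: pCons_one)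
  next
    case False
    have "\<exists>q r. h * monom 1 i = f * q + r \<and> (\<forall>k\<ge>d. coeff r k = 0)" for i
      using monic_division[OF f, of "h * monom 1 i"] unfolding d_def by metis
    then obtain q r where qr: "\<And>i. h * monom 1 i = f * q i + r i" "\<And>i k. k \<ge> d \<Longrightarrow> coeff (r i) k = 0"
      by metis
    define A where "A = mat d d (\<lambda>(j, i). coeff (r i) j)"
    have A: "A \<in> carrier_mat d d" unfolding A_def by simp
    have comb: "(\<Sum>i<d. monom (w i) i) * h = f * (\<Sum>i<d. [:w i:] * q i) + (\<Sum>i<d. [:w i:] * r i)" for w
    proof -
      have "monom (w i) i * h = f * ([:w i:] * q i) + [:w i:] * r i" for i
      proof -
        have "monom (w i) i * h = [:w i:] * (h * monom 1 i)"
          by (simp add: smult_monom mult.commute flip: mult_smult_right)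
        then show ?thesis unfolding qr(1) by (simp add: algebra_simps)
      qed
      then show ?thesis by (simp add: sum_distrib_right sum_distrib_left sum.distrib)
    qed
    have coeffA: "coeff (\<Sum>i<d. [:w $ i:] * r i) j = (A *\<^sub>v w) $ j" if "j < d" "w \<in> carrier_vec d" for w j
      using that unfolding A_def
      by (auto simp: coeff_sum scalar_prod_def lessThan_atLeast0 mult.commute intro!: sum.cong)
    show ?thesis
    proof (cases "det A = 0")
      case True
      then obtain w where w: "w \<in> carrier_vec d" "w \<noteq> 0\<^sub>v d" "A *\<^sub>v w = 0\<^sub>v d"
        using det_0_iff_vec_prod_zero[OF A] by blast
      define v where "v = (\<Sum>i<d. monom (w $ i) i)"
      have cv: "coeff v k = (if k < d then w $ k else 0)" for k
        unfolding v_def by (simp add: coeff_sum if_distrib sum.If_cases cong: if_cong)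
      have "v \<noteq> 0"
      proof
        assume "v = 0"
        then have "w $ k = 0" if "k < d" for k using cv[of k] that by simp
        then show False using w by auto
      qed
      moreover have "(\<Sum>i<d. [:w $ i:] * r i) = 0"
      proof (rule poly_eqI)
        fix j show "coeff (\<Sum>i<d. [:w $ i:] * r i) j = coeff 0 j"
          using coeffA[of j w] w qr(2) by (cases "j < d") (auto simp: coeff_sum)
      qed
      then have "f dvd v * h" using comb[of "\<lambda>i. w $ i"] unfolding v_def by simp
      ultimately show ?thesis using zero_divisor[of v] cv unfolding d_def by simp
    next
      case nz: False
      \<comment> \<open>Index 0 belongs to the basis vector 1, so \<open>A\<close> sends this column
        of its adjugate to \<open>det A\<close> times 1.\<close>
      define w where "w = col (adj_mat A) 0"
      have w: "w \<in> carrier_vec d" unfolding w_def using adj_mat(1)[OF A] False by auto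
      have "A *\<^sub>v w = col (A * adj_mat A) 0"
        unfolding w_def using adj_mat(1)[OF A] A False by (intro eq_vecI) auto
      also have "\<dots> = col (det A \<cdot>\<^sub>m 1\<^sub>m d) 0" by (simp add: adj_mat(2)[OF A])
      finally have Aw: "(A *\<^sub>v w) $ j = (if j = 0 then det A else 0)" if "j < d" for j
        using that False by auto
      have "(\<Sum>i<d. [:w $ i:] * r i) = [:det A:]"
      proof (rule poly_eqI)
        fix j show "coeff (\<Sum>i<d. [:w $ i:] * r i) j = coeff [:det A:] j"
          using coeffA[of j w] w Aw qr(2) False
          by (cases "j < d") (auto simp: coeff_sum coeff_pCons split: nat.splits)
      qed
      then have "[:det A:] = h * (\<Sum>i<d. monom (w $ i) i) + f * (- (\<Sum>i<d. [:w $ i:] * q i))"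
        using comb[of "\<lambda>i. w $ i"] by (simp add: algebra_simps)
      then show ?thesis using norm nz by blast
    qed
  qed
qed

text \<open>R[Y]/(f) is free over the domain R, hence torsion-free.\<close>

lemma monic_dvd_const_mult:
  fixes f h :: "'a::idom poly"
  assumes f: "lead_coeff f = 1" and "c \<noteq> 0" "f dvd [:c:] * h"
  shows "f dvd h"
proof -
  obtain q r where qr: "h = f * q + r" "\<And>k. degree f \<le> k \<Longrightarrow> coeff r k = 0"
    using monic_division[OF f] by blast
  have "f dvd [:c:] * r" using assms(3) unfolding qr(1)
    by (metis distrib_left dvd_add_right_iff dvd_triv_left mult.left_commute)
  moreover have "f \<noteq> 0" using f by auto
  ultimately have "[:c:] * r = 0" using qr(2) by (intro monic_dvd_small[of f]) auto
  then have "r = 0" using assms(2) by simp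
  then show ?thesis using qr(1) by simp
qed

subsection \<open>Derivations\<close>

locale derivation =
  fixes D :: "'a::comm_ring_1 \<Rightarrow> 'a"
  assumes add: "D (a + b) = D a + D b"
    and leibniz: "D (a * b) = D a * b + a * D b"
begin

lemma zero [simp]: "D 0 = 0"
  using add[of 0 0] by simp

lemma one [simp]: "D 1 = 0"
  using leibniz[of 1 1] by simp

lemma minus: "D (- a) = - D a"
  using add[of a "- a"] by (simp add: eq_neg_iff_add_eq_0 add.commute)

lemma diff: "D (a - b) = D a - D b"
  using add[of a "- b"] minus[of b] by simp

lemma sum: "D (sum g I) = (\<Sum>i\<in>I. D (g i))"
  by (induction I rule: infinite_finite_induct) (auto simp: add)

lemma power: "D (a ^ n) = of_nat n * a ^ (n - 1) * D a"
proof (induction n)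
  case (Suc n)
  then show ?case by (cases n) (simp_all add: leibniz algebra_simps)
qed simp

lemma iter_add: "(D ^^ m) (a + b) = (D ^^ m) a + (D ^^ m) b"
  by (induction m) (auto simp: add)

lemma iter_diff: "(D ^^ m) (a - b) = (D ^^ m) a - (D ^^ m) b"
  by (induction m) (auto simp: diff)

lemma iter_zero [simp]: "(D ^^ m) 0 = 0"
  by (induction m) auto

lemma iter_sum: "(D ^^ m) (sum g I) = (\<Sum>i\<in>I. (D ^^ m) (g i))"
  by (induction m) (auto simp: sum)

lemma iter_const_mult:
  assumes "D c = 0"
  shows "(D ^^ m) (a * c) = (D ^^ m) a * c"
  by (induction m) (auto simp: leibniz assms)

lemma iter_dvd:
  assumes "D f = 0" "f dvd a"
  shows "f dvd (D ^^ m) a"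
proof -
  obtain b where "a = b * f" using assms(2) by (metis dvdE mult.commute)
  then show ?thesis using iter_const_mult[OF assms(1), of m b] by simp
qed

text \<open>By Leibniz, D^m (b a) is a combination of a, D a, ..., D^m a. The ideal \<open>I\<close>
  need not be stable under \<open>D\<close>, so all these iterates are asked to lie in it.\<close>

lemma iter_mult_ideal:
  assumes "\<And>a b. a \<in> I \<Longrightarrow> b \<in> I \<Longrightarrow> a + b \<in> I" "\<And>a b. a \<in> I \<Longrightarrow> b * a \<in> I"
    and "\<And>i. i \<le> m \<Longrightarrow> (D ^^ i) a \<in> I"
  shows "(D ^^ m) (b * a) \<in> I"
  using assms(3)
proof (induction m arbitrary: a b)
  case 0
  then show ?case using assms(2) by simp
next
  case (Suc m)
  have "(D ^^ i) (D a) \<in> I" if "i \<le> m" for i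
    using Suc.prems[of "Suc i"] that by (simp add: funpow_swap1)
  then have "(D ^^ m) (b * D a) \<in> I" using Suc.IH by blast
  moreover have "(D ^^ m) (D b * a) \<in> I" using Suc by simp
  ultimately show ?case using assms(1) by (simp add: funpow_swap1 leibniz iter_add)
qed

text \<open>Modulo t only the term in which all l derivations hit the power of t survives. This
  reads the leading t-adic coefficient off the l-th derivative.\<close>

lemma iter_power_mult_mod:
  "t dvd (D ^^ l) (t ^ l * a) - of_nat (fact l) * D t ^ l * a"
proof (induction l arbitrary: a)
  case (Suc l)
  define a' where "a' = of_nat (Suc l) * D t * a + t * D a"
  have "D (t ^ Suc l * a) = t ^ l * a'"
    unfolding a'_def leibniz[of "t ^ Suc l"] power[of t "Suc l"] by (simp add: algebra_simps)
  then have "(D ^^ Suc l) (t ^ Suc l * a) = (D ^^ l) (t ^ l * a')"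
    by (simp add: funpow_swap1)
  moreover have "of_nat (fact l) * D t ^ l * a' - of_nat (fact (Suc l)) * D t ^ Suc l * a = t * (of_nat (fact l) * D t ^ l * D a)"
    unfolding a'_def by (simp add: algebra_simps)
  then have "t dvd of_nat (fact l) * D t ^ l * a' - of_nat (fact (Suc l)) * D t ^ Suc l * a" by simp
  ultimately show ?case using dvd_add[OF Suc.IH[of a']] by fastforce
qed simp

end

lemma derivation_map_poly:
  assumes "derivation (D :: 'a::idom \<Rightarrow> 'a)"
  shows "derivation (map_poly D)"
proof -
  interpret derivation D by fact
  have c: "coeff (map_poly D p) k = D (coeff p k)" for p k by (simp add: coeff_map_poly)
  show ?thesis
  proof
    fix a b :: "'a poly"
    show "map_poly D (a + b) = map_poly D a + map_poly D b" by (rule poly_eqI) (simp add: c add)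
    show "map_poly D (a * b) = map_poly D a * b + a * map_poly D b"
      by (rule poly_eqI) (simp add: c coeff_mult sum leibniz sum.distrib)
  qed
qed

text \<open>Throughout, x is the inner and Y the outer variable of \<open>'a poly poly\<close>;
  \<open>pderiv\<close> itself is then the derivative in Y.\<close>

definition xderiv :: "'a::idom poly poly \<Rightarrow> 'a poly poly" where
  "xderiv h = map_poly pderiv h"

lemma coeff_xderiv [simp]: "coeff (xderiv h) k = pderiv (coeff h k)"
  unfolding xderiv_def by (simp add: coeff_map_poly)

interpretation pderiv: derivation "pderiv :: 'a::idom poly \<Rightarrow> _"
  by standard (auto simp: pderiv_add pderiv_mult algebra_simps)

interpretation xderiv: derivation "xderiv :: 'a::idom poly poly \<Rightarrow> _"
  unfolding xderiv_def[abs_def] by (rule derivation_map_poly[OF pderiv.derivation_axioms])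

text \<open>The Hamiltonian vector field of \<open>f\<close>, i.e. the derivation \<open>f\<^sub>Y d/dx\<close> of the curve \<open>f = 0\<close>.\<close>

definition hderiv :: "'a::idom poly poly \<Rightarrow> 'a poly poly \<Rightarrow> 'a poly poly" where
  "hderiv f h = pderiv f * xderiv h - xderiv f * pderiv h"

interpretation hderiv: derivation "hderiv f" for f :: "'a::idom poly poly"
  by standard (auto simp: hderiv_def xderiv.add xderiv.leibniz pderiv.add pderiv.leibniz algebra_simps)

lemma hderiv_self [simp]: "hderiv f f = 0"
  by (simp add: hderiv_def)

subsection \<open>Total degree in two variables\<close>

definition totdeg_le :: "nat \<Rightarrow> 'a::zero poly poly \<Rightarrow> bool" where
  "totdeg_le N h \<longleftrightarrow> (\<forall>k j. N < j + k \<longrightarrow> coeff (coeff h k) j = 0)"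

lemma totdeg_leD: "totdeg_le N h \<Longrightarrow> N < j + k \<Longrightarrow> coeff (coeff h k) j = 0"
  by (auto simp: totdeg_le_def)

lemma totdeg_le_mono: "totdeg_le N h \<Longrightarrow> N \<le> N' \<Longrightarrow> totdeg_le N' h"
  by (auto simp: totdeg_le_def)

lemma totdeg_le_diff:
  fixes g h :: "'a::comm_ring_1 poly poly"
  shows "totdeg_le N g \<Longrightarrow> totdeg_le N h \<Longrightarrow> totdeg_le N (g - h)"
  by (simp add: totdeg_le_def)

lemma totdeg_le_sum: "(\<And>i. i \<in> I \<Longrightarrow> totdeg_le N (g i)) \<Longrightarrow> totdeg_le N (sum g I)"
  by (simp add: totdeg_le_def coeff_sum)

lemma totdeg_le_mult:
  fixes g h :: "'a::comm_semiring_1 poly poly"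
  assumes "totdeg_le M g" "totdeg_le N h"
  shows "totdeg_le (M + N) (g * h)"
  unfolding totdeg_le_def
proof (intro allI impI)
  fix k j assume kj: "M + N < j + k"
  have "coeff (coeff g i) l * coeff (coeff h (k - i)) (j - l) = 0" if "i \<le> k" "l \<le> j" for i l
  proof (cases "M < l + i")
    case False
    then have "N < (j - l) + (k - i)" using kj that by linarith
    then show ?thesis using totdeg_leD[OF assms(2)] by simp
  qed (simp add: totdeg_leD[OF assms(1)])
  then show "coeff (coeff (g * h) k) j = 0" by (simp add: coeff_mult coeff_sum)
qed

lemma totdeg_le_power:
  fixes h :: "'a::comm_semiring_1 poly poly"
  assumes "totdeg_le N h"
  shows "totdeg_le (n * N) (h ^ n)"
proof (induction n)
  case 0
  have "[:[:1::'a:]:] = 1" by (simp add: one_pCons)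
  then show ?case by (auto simp: totdeg_le_def coeff_pCons one_pCons split: nat.splits)
next
  case (Suc n)
  then show ?case using totdeg_le_mult[OF assms] by simp
qed

lemma totdeg_le_monom: "i + j \<le> N \<Longrightarrow> totdeg_le N (monom (monom a j) i)"
  by (auto simp: totdeg_le_def coeff_monom)

lemma totdeg_le_pderiv: "totdeg_le N h \<Longrightarrow> totdeg_le N (pderiv h)"
  by (auto simp: totdeg_le_def coeff_pderiv simp flip: of_nat_Suc simp del: of_nat_Suc
      intro!: mult_eq_0_iff[THEN iffD2]) (simp_all add: of_nat_poly)

lemma totdeg_le_xderiv: "totdeg_le N h \<Longrightarrow> totdeg_le N (xderiv h)"
  by (auto simp: totdeg_le_def coeff_pderiv)

lemma totdeg_le_hderiv: "totdeg_le d f \<Longrightarrow> totdeg_le N h \<Longrightarrow> totdeg_le (d + N) (hderiv f h)"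
  unfolding hderiv_def
  by (intro totdeg_le_diff totdeg_le_mult totdeg_le_xderiv totdeg_le_pderiv)

lemma totdeg_le_hderiv_iter: "totdeg_le d f \<Longrightarrow> totdeg_le N h \<Longrightarrow> totdeg_le (m * d + N) ((hderiv f ^^ m) h)"
  by (induction m) (auto simp: add.assoc intro: totdeg_le_hderiv)

text \<open>As the total degree of the monic \<open>f\<close> equals its degree in Y, every multiple
  of \<open>f\<close> subtracted in the division has total degree at most that of \<open>h\<close>.
  Total degree plays the part of the pole order at infinity on the curve.\<close>

lemma monic_division_totdeg:
  fixes f h :: "'a::idom poly poly"
  assumes f: "lead_coeff f = 1" "totdeg_le (degree f) f" and "totdeg_le N h"
  obtains q r where "h = f * q + r" "\<And>k. degree f \<le> k \<Longrightarrow> coeff r k = 0" "totdeg_le N r"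
proof -
  have "\<exists>q r. h = f * q + r \<and> (\<forall>k\<ge>degree f. coeff r k = 0) \<and> totdeg_le N r"
    if "\<forall>k\<ge>n. coeff h k = 0" "totdeg_le N h" for n h
    using that
  proof (induction n arbitrary: h)
    case 0
    then have "h = f * 0 + 0" by (simp add: poly_eq_iff)
    then show ?case using 0 by (intro exI[of _ 0] exI[of _ h]) auto
  next
    case (Suc n)
    show ?case
    proof (cases "degree f \<le> n \<and> coeff h n \<noteq> 0")
      case False
      then have "\<forall>k\<ge>n. coeff h k = 0 \<or> degree f > n" using Suc.prems(1)
        by (metis le_antisym not_less_eq_eq not_le)
      then show ?thesis
      proof (cases "degree f > n")
        case True
        then show ?thesis using Suc.prems by (intro exI[of _ 0] exI[of _ h]) auto
      next
        case False
        then show ?thesis using Suc.IH[of h] Suc.prems \<open>\<forall>k\<ge>n. coeff h k = 0 \<or> degree f > n\<close> by blast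
      qed
    next
      case True
      let ?m = "monom (coeff h n) (n - degree f)"
      obtain j where j: "coeff (coeff h n) j \<noteq> 0" using True by (meson leading_coeff_neq_0)
      have nN: "n \<le> N" using totdeg_leD[OF Suc.prems(2), of j n] j by fastforce
      have "totdeg_le (N - degree f) ?m"
        using Suc.prems(2) True nN unfolding totdeg_le_def by (auto simp: coeff_monom)
      then have "totdeg_le (degree f + (N - degree f)) (f * ?m)" using f(2) totdeg_le_mult by blast
      then have w: "totdeg_le N (h - f * ?m)" using True nN Suc.prems(2) by (intro totdeg_le_diff) auto
      have "coeff (h - f * ?m) k = 0" if "k \<ge> n" for k
      proof (cases "k = n")
        case True
        then show ?thesis using \<open>degree f \<le> n \<and> _\<close> f(1)
          by (simp add: coeff_monom_mult mult.commute[of f])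
      next
        case False
        then show ?thesis using \<open>degree f \<le> n \<and> _\<close> that Suc.prems
          by (simp add: coeff_monom_mult mult.commute[of f] coeff_eq_0)
      qed
      then obtain q r where "h - f * ?m = f * q + r" and
        r: "\<forall>k\<ge>degree f. coeff r k = 0" "totdeg_le N r"
        using Suc.IH w by blast
      then have "h = f * (q + ?m) + r" by (simp add: algebra_simps)
      then show ?thesis using r by blast
    qed
  qed
  from this[of "Suc (degree h)" h] obtain q r
    where "h = f * q + r" "\<forall>k\<ge>degree f. coeff r k = 0" "totdeg_le N r"
    using coeff_eq_0 Suc_le_lessD assms(3) by metis
  then show ?thesis using that by blast
qed

subsection \<open>Evaluation of bivariate polynomials\<close>

definition eval2 :: "('a::zero \<Rightarrow> 'b::comm_ring_1) \<Rightarrow> 'b \<Rightarrow> 'b \<Rightarrow> 'a poly poly \<Rightarrow> 'b" where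
  "eval2 h x y q = poly (map_poly (\<lambda>c. poly (map_poly h c) x) q) y"

abbreviation bimap :: "('a::zero \<Rightarrow> 'b::zero) \<Rightarrow> 'a poly poly \<Rightarrow> 'b poly poly" where
  "bimap h \<equiv> map_poly (map_poly h)"

lemma idom_hom_eval1:
  assumes "idom_hom h"
  shows "idom_hom (\<lambda>c. poly (map_poly h c) x)"
proof -
  interpret idom_hom h by fact
  interpret map_poly_hom: map_poly_idom_hom h ..
  show ?thesis by unfold_locales (auto simp: hom_distribs)
qed

lemma idom_hom_map_poly:
  assumes "idom_hom h"
  shows "idom_hom (map_poly h)"
proof -
  interpret idom_hom h by fact
  interpret map_poly_hom: map_poly_idom_hom h ..
  show ?thesis ..
qed

lemma idom_hom_eval2:
  assumes "idom_hom h"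
  shows "idom_hom (eval2 h x y)"
  unfolding eval2_def by (intro idom_hom_eval1 assms)

lemma idom_hom_id: "idom_hom (\<lambda>x::'a::idom. x)"
  by unfold_locales auto

lemma idom_hom_of_int: "idom_hom (of_int :: int \<Rightarrow> 'a::idom)"
  by unfold_locales auto

text \<open>These rules are needed for many homomorphisms at once (coefficient maps,
  specialisations, their composites); with the locale predicate as premise they can be instantiated
  by \<open>note\<close>.\<close>

lemma idom_homD:
  assumes "idom_hom h"
  shows "h 0 = 0" "h 1 = 1" "h (a + b) = h a + h b" "h (a - b) = h a - h b" "h (- a) = - h a"
    "h (a * b) = h a * h b" "h (a ^ n) = h a ^ n" "h (sum g I) = (\<Sum>i\<in>I. h (g i))"
    "h (prod g I) = (\<Prod>i\<in>I. h (g i))" "a dvd b \<Longrightarrow> h a dvd h b"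
    "det (map_mat h B) = h (det B)" "map_poly h (pderiv q) = pderiv (map_poly h q)"
proof -
  interpret idom_hom h by fact
  show "h 0 = 0" "h 1 = 1" "h (a + b) = h a + h b" "h (a - b) = h a - h b" "h (- a) = - h a"
    "h (a * b) = h a * h b" "h (a ^ n) = h a ^ n" "h (sum g I) = (\<Sum>i\<in>I. h (g i))"
    "h (prod g I) = (\<Prod>i\<in>I. h (g i))" "a dvd b \<Longrightarrow> h a dvd h b"
    "det (map_mat h B) = h (det B)" "map_poly h (pderiv q) = pderiv (map_poly h q)"
    by (simp_all add: hom_distribs map_poly_pderiv)
qed

lemma eval2_0 [simp]: "eval2 h x y 0 = 0"
  by (simp add: eval2_def)

lemma eval2_pCons:
  assumes "h 0 = 0"
  shows "eval2 h x y (pCons c q) = poly (map_poly h c) x + y * eval2 h x y q"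
  using assms by (simp add: eval2_def Polynomial.map_poly_pCons)

lemma eval2_monom:
  assumes "idom_hom h"
  shows "eval2 h x y (monom (monom a j) i) = h a * x ^ j * y ^ i"
proof -
  interpret idom_hom h by fact
  show ?thesis unfolding eval2_def by (simp add: map_poly_monom poly_monom)
qed

lemma eval2_const:
  assumes "idom_hom h"
  shows "eval2 h x y [:c:] = poly (map_poly h c) x"
proof -
  interpret idom_hom h by fact
  show ?thesis unfolding eval2_def by (simp add: Polynomial.map_poly_pCons)
qed

lemma xderiv_bimap:
  assumes "idom_hom h"
  shows "xderiv (bimap h q) = bimap h (xderiv q)"
proof -
  interpret idom_hom h by fact
  show ?thesis by (rule poly_eqI) (simp add: coeff_map_poly map_poly_pderiv)
qed

lemma hderiv_bimap:
  assumes "idom_hom h"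
  shows "hderiv (bimap h f) (bimap h q) = bimap h (hderiv f q)"
proof -
  note a = idom_homD[OF idom_hom_map_poly[OF assms]]
    and b = idom_homD[OF idom_hom_map_poly[OF idom_hom_map_poly[OF assms]]]
  show ?thesis unfolding hderiv_def by (simp add: b xderiv_bimap[OF assms] a)
qed

lemma hderiv_iter_bimap:
  assumes "idom_hom h"
  shows "(hderiv (bimap h f) ^^ m) (bimap h q) = bimap h ((hderiv f ^^ m) q)"
  by (induction m) (simp_all add: hderiv_bimap[OF assms])

lemma poly_taylor:
  fixes P :: "'a::idom poly"
  shows "b\<^sup>2 dvd poly P (y + b) - (poly P y + b * poly (pderiv P) y)"
proof (induction P)
  case (pCons a P)
  then obtain k where k: "poly P (y + b) = poly P y + b * poly (pderiv P) y + b\<^sup>2 * k"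
    by (metis add.commute diff_eq_eq dvdE)
  have "poly (pCons a P) (y + b) - (poly (pCons a P) y + b * poly (pderiv (pCons a P)) y)
     = b\<^sup>2 * ((y + b) * k + poly (pderiv P) y)"
    by (simp only: poly_pCons pderiv_pCons poly_add k power2_eq_square) (simp add: algebra_simps)
  then show ?case by simp
qed simp

subsection \<open>Power series roots\<close>

lemma fps_X_power_dvd_iff:
  "fps_X ^ n dvd (g :: 'a::field fps) \<longleftrightarrow> (\<forall>i<n. fps_nth g i = 0)"
proof
  assume "\<forall>i<n. fps_nth g i = 0"
  then have "g = fps_X ^ n * fps_shift n g"
    by (intro fps_ext) (simp add: fps_X_power_mult_nth)
  then show "fps_X ^ n dvd g" by (metis dvd_triv_left)
qed (auto simp: fps_X_power_mult_nth dvd_def)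

text \<open>Newton iteration: the new error is a multiple of the square of the old one, so each step
  gains a power of X, and the derivative stays invertible because all iterates agree with
  \<open>y0\<close> modulo X.\<close>

lemma fps_hensel:
  fixes P :: "'a::field fps poly"
  assumes "fps_nth (poly P y0) 0 = 0" "fps_nth (poly (pderiv P) y0) 0 \<noteq> 0"
  obtains y where "poly P y = 0" "fps_X dvd y - y0"
proof -
  define s where "s = (\<lambda>y. y - poly P y * inverse (poly (pderiv P) y))"
  define Y where "Y n = (s ^^ n) y0" for n
  have cong: "fps_X ^ n dvd poly Q a - poly Q b" if "fps_X ^ n dvd a - b" for n a b and Q :: "'a fps poly"
  proof -
    have "(a - b)\<^sup>2 dvd poly Q a - (poly Q b + (a - b) * poly (pderiv Q) b)"
      using poly_taylor[of "a - b" Q b] by simp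
    then have "a - b dvd poly Q a - (poly Q b + (a - b) * poly (pderiv Q) b)"
      unfolding power2_eq_square by (rule dvd_mult_left)
    then have "a - b dvd (poly Q a - (poly Q b + (a - b) * poly (pderiv Q) b)) + (a - b) * poly (pderiv Q) b"
      by (rule dvd_add) simp
    then show ?thesis using that by (auto intro: dvd_trans)
  qed
  have "fps_X ^ Suc n dvd poly P (Y n) \<and> fps_X dvd Y n - y0 \<and> fps_X ^ Suc n dvd Y (Suc n) - Y n" for n
  proof (induction n)
    case 0
    have "fps_X ^ Suc 0 dvd poly P y0" unfolding fps_X_power_dvd_iff using assms by simp
    then show ?case by (simp add: Y_def s_def)
  next
    case (Suc n)
    define i where "i = inverse (poly (pderiv P) (Y n))"
    have "fps_X ^ 1 dvd Y n - y0" using Suc by simp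
    then have "fps_X ^ 1 dvd poly (pderiv P) (Y n) - poly (pderiv P) y0" by (rule cong)
    then have "fps_nth (poly (pderiv P) (Y n)) 0 \<noteq> 0"
      unfolding fps_X_power_dvd_iff using assms by simp
    then have i: "poly (pderiv P) (Y n) * i = 1" unfolding i_def by (rule inverse_mult_eq_1')
    have YS: "Y (Suc n) = Y n + (- (poly P (Y n) * i))" by (simp add: Y_def s_def i_def)
    obtain k where "poly P (Y (Suc n)) - (poly P (Y n) + (- (poly P (Y n) * i)) * poly (pderiv P) (Y n))
        = (- (poly P (Y n) * i))\<^sup>2 * k"
      using poly_taylor unfolding YS by (metis dvdE)
    moreover have "poly P (Y n) + (- (poly P (Y n) * i)) * poly (pderiv P) (Y n) = 0"
      using i by (simp add: algebra_simps)
    ultimately have "poly P (Y (Suc n)) = (- (poly P (Y n) * i))\<^sup>2 * k" by (simp only: diff_zero)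
    also have "\<dots> = poly P (Y n) * poly P (Y n) * (i * i * k)"
      by (simp add: power2_eq_square algebra_simps)
    finally have PY: "poly P (Y (Suc n)) = poly P (Y n) * poly P (Y n) * (i * i * k)" .
    have "fps_X ^ Suc (Suc n) dvd poly P (Y n) * poly P (Y n)"
    proof -
      have "fps_X ^ (Suc n + 1) dvd poly P (Y n) * poly P (Y n)"
        unfolding power_add using Suc by (intro mult_dvd_mono) (auto intro: dvd_trans[OF le_imp_power_dvd])
      then show ?thesis by simp
    qed
    then have 1: "fps_X ^ Suc (Suc n) dvd poly P (Y (Suc n))" unfolding PY by (rule dvd_mult2)
    have "fps_X dvd Y (Suc n) - Y n" using Suc by (metis dvd_mult_left power_Suc)
    then have "fps_X dvd (Y (Suc n) - Y n) + (Y n - y0)" using Suc by (intro dvd_add) auto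
    then have 2: "fps_X dvd Y (Suc n) - y0" by simp
    have "Y (Suc (Suc n)) - Y (Suc n) = - (poly P (Y (Suc n)) * inverse (poly (pderiv P) (Y (Suc n))))"
      by (simp add: Y_def s_def)
    then show ?case using 1 2 by simp
  qed
  then have YP: "fps_X ^ Suc n dvd poly P (Y n)" and Y0: "fps_X dvd Y n - y0"
    and Yd: "fps_X ^ Suc n dvd Y (Suc n) - Y n" for n by blast+
  have Ydd: "fps_X ^ Suc n dvd Y (n + j) - Y n" for n j
  proof (induction j)
    case (Suc j)
    have "fps_X ^ Suc n dvd Y (Suc (n + j)) - Y (n + j)"
      by (rule dvd_trans[OF _ Yd[of "n + j"]]) (simp add: le_imp_power_dvd)
    then have "fps_X ^ Suc n dvd (Y (Suc (n + j)) - Y (n + j)) + (Y (n + j) - Y n)"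
      using Suc by (rule dvd_add)
    then show ?case by simp
  qed simp
  \<comment> \<open>\<open>Y n\<close> and all later iterates agree below order n + 1, so the
    coefficient of index n is final from step n on.\<close>
  define y where "y = Abs_fps (\<lambda>n. fps_nth (Y n) n)"
  have yY: "fps_X ^ Suc n dvd y - Y n" for n
    unfolding fps_X_power_dvd_iff
  proof (intro allI impI)
    fix i assume "i < Suc n"
    then have "fps_X ^ Suc i dvd Y n - Y i" using Ydd[of i "n - i"] by simp
    then have "fps_nth (Y n) i = fps_nth (Y i) i" unfolding fps_X_power_dvd_iff by simp
    then show "fps_nth (y - Y n) i = 0" by (simp add: y_def)
  qed
  have "fps_X ^ Suc n dvd poly P y" for n
  proof -
    have "fps_X ^ Suc n dvd (poly P y - poly P (Y n)) + poly P (Y n)"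
      by (intro dvd_add cong yY YP)
    then show ?thesis by simp
  qed
  then have "fps_nth (poly P y) n = 0" for n unfolding fps_X_power_dvd_iff by blast
  then have "poly P y = 0" by (intro fps_ext) simp
  moreover have "fps_X ^ Suc 0 dvd (y - Y 0) + (Y 0 - y0)"
    using yY[of 0] Y0[of 0] by (intro dvd_add) simp_all
  then have "fps_X dvd y - y0" by simp
  ultimately show ?thesis using that by blast
qed

lemma fps_deriv_eval1:
  "fps_deriv (poly (map_poly fps_const c) fps_X) = poly (map_poly fps_const (pderiv c)) fps_X"
  for c :: "'a::field_char_0 poly"
proof (induction c)
  case (pCons a c)
  have "map_poly fps_const (c + pCons 0 (pderiv c)) = map_poly fps_const c + map_poly fps_const (pCons 0 (pderiv c))"
    by (rule poly_eqI) (simp add: coeff_map_poly)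
  then show ?case using pCons by (simp add: Polynomial.map_poly_pCons pderiv_pCons algebra_simps)
qed simp

lemma idom_hom_fps_const: "idom_hom (fps_const :: 'a::idom \<Rightarrow> 'a fps)"
  by unfold_locales auto

lemma fps_deriv_eval2:
  fixes q :: "'a::field_char_0 poly poly"
  shows "fps_deriv (eval2 fps_const fps_X y q) =
    eval2 fps_const fps_X y (xderiv q) + eval2 fps_const fps_X y (pderiv q) * fps_deriv y"
proof (induction q)
  case (pCons c q)
  interpret idom_hom "eval2 fps_const fps_X y" by (intro idom_hom_eval2 idom_hom_fps_const)
  have "xderiv (pCons c q) = pCons (pderiv c) (xderiv q)"
    by (rule poly_eqI) (simp add: coeff_pCons split: nat.splits)
  then show ?case using pCons
    by (simp add: eval2_pCons pderiv_pCons fps_deriv_eval1 hom_distribs algebra_simps)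
qed (simp add: xderiv_def)

text \<open>Implicit differentiation of f(x, y(x)) = 0 gives f_x = - f_Y y', so on a branch of the
  curve \<open>hderiv f\<close> acts as f_Y d/dx.\<close>

lemma eval2_hderiv:
  fixes f q :: "'a::field_char_0 poly poly"
  assumes "eval2 fps_const fps_X y f = 0"
  shows "eval2 fps_const fps_X y (hderiv f q) =
    eval2 fps_const fps_X y (pderiv f) * fps_deriv (eval2 fps_const fps_X y q)"
proof -
  interpret idom_hom "eval2 fps_const fps_X y" by (intro idom_hom_eval2 idom_hom_fps_const)
  have "eval2 fps_const fps_X y (xderiv f) = - (eval2 fps_const fps_X y (pderiv f) * fps_deriv y)"
    using fps_deriv_eval2[of y f] assms by (simp add: eq_neg_iff_add_eq_0)
  then show ?thesis
    unfolding hderiv_def fps_deriv_eval2 by (simp add: hom_distribs algebra_simps)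
qed

subsection \<open>Wronskians\<close>

lemma fps_mult_nth_lowest:
  fixes a b :: "'a::idom fps"
  assumes "\<And>i. i < n \<Longrightarrow> fps_nth a i = 0" "\<And>i. i < k \<Longrightarrow> fps_nth b i = 0"
  shows "fps_nth (a * b) (n + k) = fps_nth a n * fps_nth b k"
proof -
  have "fps_nth a i * fps_nth b (n + k - i) = 0" if "i \<le> n + k" "i \<noteq> n" for i
    using that assms(1)[of i] assms(2)[of "n + k - i"] by (cases "i < n") auto
  then have "(\<Sum>i=0..n + k. fps_nth a i * fps_nth b (n + k - i)) = (\<Sum>i\<in>{n}. fps_nth a i * fps_nth b (n + k - i))"
    by (intro sum.mono_neutral_right) auto
  then show ?thesis by (simp add: fps_mult_nth)
qed

text \<open>The hypothesis says that v/w has derivative 0. To avoid the quotient, subtract the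
  multiple of \<open>w\<close> that kills the coefficient of \<open>v\<close> at the order of
  \<open>w\<close>, and compare lowest terms.\<close>

lemma fps_constant_ratio:
  fixes v w :: "'a::field_char_0 fps"
  assumes "w \<noteq> 0" "w * fps_deriv v = v * fps_deriv w"
  obtains c where "v = fps_const c * w"
proof -
  define n where "n = subdegree w"
  define c where "c = fps_nth v n / fps_nth w n"
  define e where "e = v - fps_const c * w"
  have wn: "fps_nth w n \<noteq> 0" using assms(1) unfolding n_def by simp
  have en: "fps_nth e n = 0" unfolding e_def c_def using wn by simp
  have eq: "w * fps_deriv e = e * fps_deriv w"
    unfolding e_def using assms(2) by (simp add: algebra_simps)
  have "e = 0"
  proof (rule ccontr)
    assume "e \<noteq> 0"
    define k where "k = subdegree e"
    have ek: "fps_nth e k \<noteq> 0" using \<open>e \<noteq> 0\<close> unfolding k_def by simp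
    \<comment> \<open>The operator X d/dX multiplies the coefficient of index i by i. Comparing
      lowest terms thus gives k = n in characteristic zero, although \<open>e\<close> vanishes at
      index n and not at k.\<close>
    have X: "fps_nth (fps_X * fps_deriv g) i = of_nat i * fps_nth g i" for i and g :: "'a fps"
      by (cases i) simp_all
    have "w * (fps_X * fps_deriv e) = e * (fps_X * fps_deriv w)" using eq by (simp add: algebra_simps)
    moreover have low: "fps_nth w i = 0" if "i < n" for i
      using that unfolding n_def by (rule nth_less_subdegree_zero)
    moreover have low': "fps_nth e i = 0" if "i < k" for i
      using that unfolding k_def by (rule nth_less_subdegree_zero)
    moreover have "fps_nth (w * (fps_X * fps_deriv e)) (n + k) = fps_nth w n * (of_nat k * fps_nth e k)"
      using fps_mult_nth_lowest[of n w k "fps_X * fps_deriv e"] low low' by (simp only: X) simp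
    moreover have "fps_nth (e * (fps_X * fps_deriv w)) (k + n) = fps_nth e k * (of_nat n * fps_nth w n)"
      using fps_mult_nth_lowest[of k e n "fps_X * fps_deriv w"] low low' by (simp only: X) simp
    ultimately have "fps_nth w n * (of_nat k * fps_nth e k) = fps_nth e k * (of_nat n * fps_nth w n)"
      by (metis add.commute)
    then have "of_nat k = (of_nat n :: 'a)" using wn ek by simp
    then show False using en ek by simp
  qed
  then show ?thesis using that[of c] unfolding e_def by simp
qed

text \<open>Differentiating a relation with coefficients v and eliminating the last column leaves a
  shorter relation with coefficients v_N D v_s - v_s D v_N. By induction these vanish, so the ratios
  v_s / v_N are constants and row 0 becomes a constant relation between the z_s.\<close>

lemma wronskian_fps:
  fixes \<eta> :: "'a::field_char_0 fps"
  defines "D \<equiv> \<lambda>z. \<eta> * fps_deriv z"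
  assumes "\<eta> \<noteq> 0"
    and "\<And>c. (\<Sum>s<N. fps_const (c s) * z s) = 0 \<Longrightarrow> \<forall>s<N. c s = 0"
    and "\<And>m. m < N \<Longrightarrow> (\<Sum>s<N. v s * (D ^^ m) (z s)) = 0"
  shows "\<forall>s<N. v s = 0"
  using assms(3,4)
proof (induction N arbitrary: v)
  case (Suc N)
  interpret derivation D
    by standard (auto simp: D_def algebra_simps)
  have IH: "\<forall>s<N. w s = 0" if "\<And>m. m < N \<Longrightarrow> (\<Sum>s<N. w s * (D ^^ m) (z s)) = 0" for w
  proof (rule Suc.IH[OF _ that])
    fix c assume "(\<Sum>s<N. fps_const (c s) * z s) = 0"
    then have "(\<Sum>s<Suc N. fps_const (if s < N then c s else 0) * z s) = 0" by simp
    then have "\<forall>s<Suc N. (if s < N then c s else 0) = 0" by (rule Suc.prems(1))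
    then show "\<forall>s<N. c s = 0" by (metis less_Suc_eq)
  qed
  have vN: "v N = 0"
  proof (rule ccontr)
    assume nz: "v N \<noteq> 0"
    have "\<forall>s<N. v N * D (v s) - v s * D (v N) = 0"
    proof (rule IH)
      fix m assume m: "m < N"
      have a: "(\<Sum>s<Suc N. v s * (D ^^ m) (z s)) = 0" "(\<Sum>s<Suc N. v s * (D ^^ Suc m) (z s)) = 0"
        using m Suc.prems(2)[of m] Suc.prems(2)[of "Suc m"] by auto
      have "D (\<Sum>s<Suc N. v s * (D ^^ m) (z s)) = 0" unfolding a(1) by simp
      then have "(\<Sum>s<Suc N. D (v s) * (D ^^ m) (z s)) + (\<Sum>s<Suc N. v s * (D ^^ Suc m) (z s)) = 0"
        unfolding sum leibniz by (simp add: sum.distrib)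
      then have b: "(\<Sum>s<Suc N. D (v s) * (D ^^ m) (z s)) = 0" unfolding a(2) by simp
      have "v N * (\<Sum>s<Suc N. D (v s) * (D ^^ m) (z s)) - D (v N) * (\<Sum>s<Suc N. v s * (D ^^ m) (z s)) = 0"
        unfolding a(1) b by simp
      then have "(\<Sum>s<Suc N. (v N * D (v s) - v s * D (v N)) * (D ^^ m) (z s)) = 0"
        by (simp only: sum_distrib_left sum_subtractf[symmetric]) (simp add: algebra_simps)
      then show "(\<Sum>s<N. (v N * D (v s) - v s * D (v N)) * (D ^^ m) (z s)) = 0" by simp
    qed
    then have "\<eta> * (v N * fps_deriv (v s) - v s * fps_deriv (v N)) = 0" if "s < N" for s
      using that unfolding D_def by (simp add: right_diff_distrib mult.left_commute)
    then have "\<forall>s<N. v N * fps_deriv (v s) = v s * fps_deriv (v N)"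
      using \<open>\<eta> \<noteq> 0\<close> by simp
    then have "\<forall>s<N. \<exists>c. v s = fps_const c * v N" using fps_constant_ratio[OF nz] by metis
    then obtain c where c: "\<And>s. s < N \<Longrightarrow> v s = fps_const (c s) * v N" by metis
    define c' where "c' s = (if s < N then c s else 1)" for s
    have "v s = fps_const (c' s) * v N" if "s < Suc N" for s
      using c that by (cases "s < N") (auto simp: c'_def not_less less_Suc_eq)
    then have "v s * z s = v N * (fps_const (c' s) * z s)" if "s < Suc N" for s
      using that by (metis mult.assoc mult.commute)
    then have "(\<Sum>s<Suc N. v s * z s) = v N * (\<Sum>s<Suc N. fps_const (c' s) * z s)"
      unfolding sum_distrib_left by (intro sum.cong) blast+
    moreover have "(\<Sum>s<Suc N. v s * z s) = 0" using Suc.prems(2)[of 0] by simp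
    ultimately have "(\<Sum>s<Suc N. fps_const (c' s) * z s) = 0" using nz by simp
    then have "c' N = 0" using Suc.prems(1) by blast
    then show False by (simp add: c'_def)
  qed
  have "(\<Sum>s<N. v s * (D ^^ m) (z s)) = 0" if "m < N" for m
    using Suc.prems(2)[of m] that vN by simp
  then show ?case using IH[of v] vN by (metis less_Suc_eq)
qed simp

text \<open>A flat index for the columns of the Wronskian: for s < A * d, the pairs (s div d, s mod
  d) run once through all exponents of x below A and of Y below d.\<close>

definition bimonom :: "nat \<Rightarrow> nat \<Rightarrow> 'a::comm_ring_1 poly poly" where
  "bimonom d s = monom (monom 1 (s div d)) (s mod d)"

definition wronski_mat :: "'a::idom poly poly \<Rightarrow> nat \<Rightarrow> 'a poly poly mat" where
  "wronski_mat f N = mat N N (\<lambda>(m, s). (hderiv f ^^ m) (bimonom (degree f) s))"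

lemma wronski_mat_bimap:
  assumes "idom_hom h" "degree (bimap h f) = degree f"
  shows "wronski_mat (bimap h f) N = map_mat (bimap h) (wronski_mat f N)"
proof -
  interpret idom_hom h by fact
  have m: "bimonom d s = bimap h (bimonom d s)" for d s by (simp add: bimonom_def map_poly_monom)
  have "(hderiv (bimap h f) ^^ m) (bimonom d s) = bimap h ((hderiv f ^^ m) (bimonom d s))" for m d s
    by (subst m) (rule hderiv_iter_bimap[OF assms(1)])
  then show ?thesis unfolding wronski_mat_def assms(2) by (intro eq_matI) auto
qed

lemma coeff_bimonom_sum:
  fixes c :: "nat \<Rightarrow> 'a::comm_ring_1"
  assumes "0 < d"
  shows "coeff (coeff (\<Sum>s<A * d. [:[:c s:]:] * bimonom d s) k) j = (if k < d \<and> j < A then c (j * d + k) else 0)"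
proof -
  have "coeff (coeff (\<Sum>s<A * d. [:[:c s:]:] * bimonom d s) k) j =
    (\<Sum>s<A * d. if s div d = j \<and> s mod d = k then c s else 0)"
    by (auto simp: coeff_sum bimonom_def coeff_monom smult_monom intro!: sum.cong)
  also have "\<dots> = (\<Sum>s\<in>{..<A * d} \<inter> {s. s div d = j \<and> s mod d = k}. c s)"
    by (simp add: sum.If_cases)
  also have "{..<A * d} \<inter> {s. s div d = j \<and> s mod d = k} = (if k < d \<and> j < A then {j * d + k} else {})"
  proof -
    have "s < A * d \<longleftrightarrow> s div d < A" for s using assms by (simp add: div_less_iff_less_mult)
    moreover have "s div d = j \<and> s mod d = k \<longleftrightarrow> k < d \<and> s = j * d + k" for s
      using assms by auto
    ultimately show ?thesis by auto
  qed
  finally show ?thesis by auto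
qed

lemma eval2_fps_const_eq_0_iff:
  fixes c :: "'a::field poly"
  shows "poly (map_poly fps_const c) fps_X = 0 \<longleftrightarrow> c = 0"
proof -
  have "poly (map_poly fps_const c) fps_X = fps_of_poly c"
    by (induction c) (simp_all add: Polynomial.map_poly_pCons fps_of_poly_pCons mult.commute)
  then show ?thesis by simp
qed

text \<open>If \<open>f\<close> does not divide \<open>h\<close>, the norm of \<open>h\<close> is a
  nonzero polynomial in x alone, and such a polynomial cannot vanish on a branch parametrised by
  x.\<close>

lemma eval2_root_dvd:
  fixes f h :: "'a::field_char_0 poly poly"
  assumes f: "lead_coeff f = 1" "prime_elem f" and "eval2 fps_const fps_X y f = 0"
    and "eval2 fps_const fps_X y h = 0"
  shows "f dvd h"
proof -
  interpret idom_hom "eval2 fps_const fps_X y" by (intro idom_hom_eval2 idom_hom_fps_const)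
  from f(1) show ?thesis
  proof (cases rule: monic_norm[of f h])
    case (zero_divisor v)
    then have "f dvd v \<or> f dvd h" using f(2) by (simp add: prime_elem_dvd_mult_iff)
    moreover have "\<not> f dvd v" using monic_dvd_small[of f v] zero_divisor f(2) by auto
    ultimately show ?thesis by blast
  next
    case (norm \<Omega> z z')
    have "eval2 fps_const fps_X y [:\<Omega>:] = 0" unfolding norm(2) using assms by (simp add: hom_distribs)
    then show ?thesis using norm(1)
      by (simp add: eval2_const[OF idom_hom_fps_const] eval2_fps_const_eq_0_iff)
  qed
qed

text \<open>Expand the curve at the simple point (0, \<open>\<theta>\<close>) as a power series in
  x. A polynomial of degree below d in Y that vanishes on this branch is 0, so the monomials are
  linearly independent there and the Wronskian criterion applies.\<close>

lemma wronskian_not_dvd: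
  fixes f :: "complex poly poly"
  assumes f: "lead_coeff f = 1" "prime_elem f" "0 < degree f"
    and root: "eval2 (\<lambda>x. x) 0 \<theta> f = 0" "eval2 (\<lambda>x. x) 0 \<theta> (pderiv f) \<noteq> 0"
  shows "\<not> f dvd det (wronski_mat f (A * degree f))"
proof
  assume dvd: "f dvd det (wronski_mat f (A * degree f))"
  define P where "P = map_poly (\<lambda>c. poly (map_poly fps_const c) fps_X) f"
  interpret e1: idom_hom "\<lambda>c. poly (map_poly fps_const c) (fps_X :: complex fps)"
    by (intro idom_hom_eval1 idom_hom_fps_const)
  have c0: "fps_nth (poly (map_poly fps_const c) fps_X) 0 = poly c 0" for c :: "complex poly"
    by (induction c) (simp_all add: Polynomial.map_poly_pCons)
  have n0: "fps_nth (poly (map_poly (\<lambda>c. poly (map_poly fps_const c) fps_X) q) (fps_const \<theta>)) 0 = eval2 (\<lambda>x. x) 0 \<theta> q"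
    for q :: "complex poly poly"
    by (induction q) (simp_all add: Polynomial.map_poly_pCons eval2_pCons c0 map_poly_idI')
  have "pderiv P = map_poly (\<lambda>c. poly (map_poly fps_const c) fps_X) (pderiv f)"
    unfolding P_def by (rule e1.map_poly_pderiv[symmetric])
  then have "fps_nth (poly P (fps_const \<theta>)) 0 = 0" "fps_nth (poly (pderiv P) (fps_const \<theta>)) 0 \<noteq> 0"
    using root by (simp_all only: P_def n0 not_False_eq_True)
  then obtain y where y: "poly P y = 0" by (metis fps_hensel)
  then have y: "eval2 fps_const fps_X y f = 0" unfolding P_def eval2_def .
  interpret \<phi>: idom_hom "eval2 fps_const fps_X y" by (intro idom_hom_eval2 idom_hom_fps_const)
  define d where "d = degree f"
  define \<eta> where "\<eta> = eval2 fps_const fps_X y (pderiv f)"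
  define D where "D = (\<lambda>z. \<eta> * fps_deriv z)"
  have small: "h = 0" if "eval2 fps_const fps_X y h = 0" "\<And>k. degree f \<le> k \<Longrightarrow> coeff h k = 0" for h
    using eval2_root_dvd[OF f(1,2) y that(1)] monic_dvd_small[of f h] that(2) f(1) by force
  have "pderiv f \<noteq> 0" using f(3) by (simp add: pderiv_eq_0_iff)
  then have "\<eta> \<noteq> 0" using small[of "pderiv f"] f(3) unfolding \<eta>_def
    by (metis coeff_eq_0 degree_pderiv diff_Suc_less less_le_trans One_nat_def)
  have iter: "eval2 fps_const fps_X y ((hderiv f ^^ m) q) = (D ^^ m) (eval2 fps_const fps_X y q)" for m q
    by (induction m) (simp_all add: eval2_hderiv[OF y] D_def \<eta>_def)
  define N where "N = A * d"
  define B where "B = map_mat (eval2 fps_const fps_X y) (wronski_mat f N)"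
  have B: "B \<in> carrier_mat N N" unfolding B_def wronski_mat_def by simp
  have "det B = eval2 fps_const fps_X y (det (wronski_mat f N))" unfolding B_def by simp
  also have "\<dots> = 0" using dvd y unfolding N_def d_def by (auto simp: dvd_def hom_distribs)
  finally obtain w where w: "w \<in> carrier_vec N" "w \<noteq> 0\<^sub>v N" "B *\<^sub>v w = 0\<^sub>v N"
    using det_0_iff_vec_prod_zero[OF B] by blast
  have "\<forall>s<N. w $ s = 0"
  proof (rule wronskian_fps[where \<eta> = \<eta> and z = "\<lambda>s. eval2 fps_const fps_X y (bimonom d s)"], unfold D_def[symmetric])
    show "\<eta> \<noteq> 0" by fact
  next
    fix c assume c: "(\<Sum>s<N. fps_const (c s) * eval2 fps_const fps_X y (bimonom d s)) = 0"
    define h where "h = (\<Sum>s<A * d. [:[:c s:]:] * bimonom d s)"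
    have "eval2 fps_const fps_X y h = 0"
      using c unfolding h_def N_def
      by (simp only: \<phi>.hom_sum \<phi>.hom_mult eval2_const[OF idom_hom_fps_const])
        (simp add: Polynomial.map_poly_pCons)
    moreover have coeffs: "coeff (coeff h k) j = (if k < d \<and> j < A then c (j * d + k) else 0)" for k j
      unfolding h_def by (rule coeff_bimonom_sum) (use f(3) in \<open>simp add: d_def\<close>)
    ultimately have "h = 0" by (intro small) (auto simp: d_def poly_eq_iff)
    show "\<forall>s<N. c s = 0"
    proof (intro allI impI)
      fix s assume "s < N"
      then have "s mod d < d \<and> s div d < A" using f(3) unfolding N_def d_def
        by (simp add: div_less_iff_less_mult)
      then show "c s = 0" using coeffs[of "s mod d" "s div d"] \<open>h = 0\<close> by simp
    qed
  next
    fix m assume m: "m < N"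
    have "(B *\<^sub>v w) $ m = (\<Sum>s<N. w $ s * (D ^^ m) (eval2 fps_const fps_X y (bimonom d s)))"
      using m w(1) unfolding B_def wronski_mat_def d_def
      by (simp add: scalar_prod_def lessThan_atLeast0 iter mult.commute)
    then show "(\<Sum>s<N. w $ s * (D ^^ m) (eval2 fps_const fps_X y (bimonom d s))) = 0"
      using w(3) m by simp
  qed
  then have "w = 0\<^sub>v N" using w(1) by auto
  then show False using w(2) by simp
qed

text \<open>Over the complex numbers the prime \<open>f\<close> divides neither factor, which
  excludes the zero divisor case of \<open>monic_norm\<close> over the integers. The factor
  \<open>pderiv f\<close> is included so that the same \<open>\<Omega>\<close> controls ramification
  and makes \<open>f\<close> squarefree modulo p.\<close>

lemma wronskian_certificate:
  fixes f :: "int poly poly"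
  assumes f: "lead_coeff f = 1" "0 < degree f" "prime_elem (bimap of_int f :: complex poly poly)"
    and root: "eval2 of_int 0 \<theta> f = 0" "eval2 of_int 0 \<theta> (pderiv f) \<noteq> (0 :: complex)"
  obtains \<Omega> z z' where "\<Omega> \<noteq> 0" "[:\<Omega>:] = det (wronski_mat f (A * degree f)) * pderiv f * z + f * z'"
proof -
  define g where "g = (bimap of_int f :: complex poly poly)"
  note ah = idom_hom_map_poly[OF idom_hom_of_int[where 'a = complex]]
  note b = idom_homD[OF idom_hom_map_poly[OF ah]]
  have cg: "coeff g (degree f) = 1" unfolding g_def using f(1) by (simp add: coeff_map_poly)
  have deg: "degree g = degree f"
    using cg degree_map_poly_le[of _ f] unfolding g_def
    by (metis le_antisym le_degree zero_neq_one)
  have lg: "lead_coeff g = 1" using cg deg by simp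
  have pd: "pderiv g = bimap of_int (pderiv f)" unfolding g_def by (rule idom_homD(12)[OF ah, symmetric])
  have ev: "eval2 (\<lambda>x. x) 0 \<theta> (bimap of_int q) = eval2 of_int 0 \<theta> q" for q :: "int poly poly" and \<theta> :: complex
    by (induction q) (simp_all add: Polynomial.map_poly_pCons eval2_pCons map_poly_idI')
  have W: "bimap of_int (det (wronski_mat f N)) = det (wronski_mat g N)" for N
    unfolding g_def by (subst wronski_mat_bimap[OF idom_hom_of_int])
      (use deg in \<open>simp_all add: g_def b\<close>)
  have inj: "bimap (of_int :: int \<Rightarrow> complex) q = 0 \<longleftrightarrow> q = 0" for q
    by (auto simp: poly_eq_iff coeff_map_poly)
  from f(1) show ?thesis
  proof (cases rule: monic_norm[of f "det (wronski_mat f (A * degree f)) * pderiv f"])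
    case (zero_divisor v)
    have small: "\<not> g dvd h" if "h \<noteq> 0" "\<And>k. degree g \<le> k \<Longrightarrow> coeff h k = 0" for h
      using monic_dvd_small[of g h] that lg by force
    have "g dvd bimap of_int (v * (det (wronski_mat f (A * degree f)) * pderiv f))"
      unfolding g_def using zero_divisor(3) by (rule b)
    then have "g dvd bimap of_int v \<or> g dvd det (wronski_mat g (A * degree g)) \<or> g dvd pderiv g"
      using f(3) unfolding g_def[symmetric] by (simp add: b W deg prime_elem_dvd_mult_iff pd)
    moreover have "\<not> g dvd bimap of_int v"
      using zero_divisor(1,2) by (intro small) (auto simp: inj deg coeff_map_poly)
    moreover have "pderiv g \<noteq> 0" using f(2) deg by (simp add: pderiv_eq_0_iff)
    then have "\<not> g dvd pderiv g"
      using f(2) by (intro small) (auto simp: deg degree_pderiv intro!: coeff_eq_0)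
    moreover have "\<not> g dvd det (wronski_mat g (A * degree g))"
    proof (rule wronskian_not_dvd[OF lg])
      show "prime_elem g" "0 < degree g" using f(2,3) deg by (simp_all only: g_def)
      show "eval2 (\<lambda>x. x) 0 \<theta> g = 0" using root(1) by (simp only: ev g_def)
      show "eval2 (\<lambda>x. x) 0 \<theta> (pderiv g) \<noteq> 0" using root(2) by (simp only: ev pd not_False_eq_True)
    qed
    ultimately show ?thesis by blast
  next
    case (norm \<Omega> z z')
    then show ?thesis using that by blast
  qed
qed

subsection \<open>Squarefree elements\<close>

lemma squarefree_dvdI:
  fixes f h :: "'a::factorial_semiring"
  assumes "squarefree f" "\<And>p. prime p \<Longrightarrow> p dvd f \<Longrightarrow> p dvd h"
  shows "f dvd h"
proof (cases "h = 0")
  case False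
  have nz: "f \<noteq> 0" using assms(1) by auto
  show ?thesis
  proof (rule multiplicity_le_imp_dvd[OF nz])
    fix p :: 'a assume p: "prime p"
    show "multiplicity p f \<le> multiplicity p h"
    proof (cases "p dvd f")
      case True
      then have "1 \<le> multiplicity p h"
        using assms(2)[OF p] p False by (intro multiplicity_geI) auto
      moreover have "multiplicity p f \<le> 1"
        using assms(1) p nz by (simp add: squarefree_factorial_semiring'')
      ultimately show ?thesis by simp
    qed (simp add: not_dvd_imp_multiplicity_0)
  qed
qed simp

text \<open>This undoes Frobenius: in characteristic p one arrives at \<open>f dvd h ^ q\<close>,
  where \<open>f\<close> is known to be squarefree but may be reducible.\<close>

lemma squarefree_dvd_power:
  fixes f h :: "'a::factorial_semiring"
  assumes "squarefree f" "f dvd h ^ n"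
  shows "f dvd h"
  using assms(1) by (rule squarefree_dvdI) (meson assms(2) dvd_trans prime_dvd_power)

lemma monic_dvd_unit:
  fixes x :: "'a::idom poly"
  assumes "x dvd f" "lead_coeff f = 1" "degree x = 0"
  shows "x dvd 1"
proof -
  obtain c where c: "x = [:c:]" using assms(3) by (meson degree_eq_zeroE)
  obtain y where y: "f = [:c:] * y" using assms(1) unfolding c by (auto simp: dvd_def)
  have "lead_coeff f = c * lead_coeff y" unfolding y by (subst lead_coeff_mult) simp
  then have "c * lead_coeff y = 1" using assms(2) by simp
  then have "x * [:lead_coeff y:] = 1" unfolding c by (simp add: one_pCons mult.commute)
  then show ?thesis by (metis dvd_triv_left)
qed

lemma squarefree_of_norm:
  fixes f :: "'a::idom poly"
  assumes "lead_coeff f = 1" "\<Omega> \<noteq> 0" "[:\<Omega>:] = pderiv f * z + f * z'"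
  shows "squarefree f"
proof (rule squarefreeI)
  fix x assume "x ^ 2 dvd f"
  then obtain y where y: "f = x * (x * y)" by (auto simp: power2_eq_square dvd_def mult.assoc)
  have "x dvd pderiv f" unfolding y by (simp add: pderiv_mult)
  moreover have xf: "x dvd f" using y by simp
  ultimately have "x dvd [:\<Omega>:]" unfolding assms(3) by (intro dvd_add dvd_mult2)
  then have "degree x = 0" using assms(2) dvd_imp_degree_le[of x "[:\<Omega>:]"] by simp
  then show "x dvd 1" using monic_dvd_unit xf assms(1) by blast
qed

lemma dvd_diff_swap: "a dvd b - c \<Longrightarrow> a dvd c - b" for a b c :: "'a::comm_ring_1"
  by (metis dvd_minus_iff minus_diff_eq)

subsection \<open>Stepanov's method\<close>

lemma card_small_polys:
  "finite {r :: 'a::{finite,zero} poly poly. (\<forall>k\<ge>d. coeff r k = 0) \<and> totdeg_le N r}" (is "finite ?S")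
  "card {r :: 'a poly poly. (\<forall>k\<ge>d. coeff r k = 0) \<and> totdeg_le N r} \<le> CARD('a) ^ (d * Suc N)"
proof -
  let ?I = "{..<d} \<times> {..N}"
  let ?g = "\<lambda>r. restrict (\<lambda>(k, j). coeff (coeff r k) j) ?I"
  have "inj_on ?g ?S"
  proof (rule inj_onI, rule poly_eqI, rule poly_eqI)
    fix r r' k j assume r: "r \<in> ?S" "r' \<in> ?S" "?g r = ?g r'"
    show "coeff (coeff r k) j = coeff (coeff r' k) j"
    proof (cases "k < d \<and> j \<le> N")
      case True
      then show ?thesis using fun_cong[OF r(3), of "(k, j)"] by simp
    next
      case False
      then show ?thesis using r(1,2) by (auto simp: totdeg_le_def)
    qed
  qed
  moreover have sub: "?g ` ?S \<subseteq> (?I \<rightarrow>\<^sub>E UNIV)" by (auto split: if_splits)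
  moreover have fin: "finite (?I \<rightarrow>\<^sub>E (UNIV :: 'a set))" by (intro finite_PiE) auto
  ultimately show "finite ?S" using finite_imageD finite_subset by blast
  have "card ?S = card (?g ` ?S)" using \<open>inj_on ?g ?S\<close> by (simp add: card_image)
  also have "\<dots> \<le> card (?I \<rightarrow>\<^sub>E (UNIV :: 'a set))" by (rule card_mono[OF fin sub])
  also have "\<dots> = CARD('a) ^ (d * Suc N)" by (simp add: card_PiE)
  finally show "card ?S \<le> CARD('a) ^ (d * Suc N)" .
qed

definition varX :: "'a::comm_ring_1 poly poly" where "varX = [:[:0, 1:]:]"

text \<open>The coefficients of \<open>(f(w) - f(Y)) / (w - Y)\<close> as a polynomial in \<open>w\<close>.\<close>

definition polar :: "'a::comm_ring_1 poly \<Rightarrow> nat \<Rightarrow> 'a poly" where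
  "polar f k = (\<Sum>i\<in>{k<..degree f}. monom (coeff f i) (i - 1 - k))"

lemma polar_sum:
  fixes f w :: "'a::comm_ring_1 poly"
  shows "(w - [:0, 1:]) * (\<Sum>k<degree f. polar f k * w ^ k) = (\<Sum>i\<le>degree f. [:coeff f i:] * w ^ i) - f"
proof -
  let ?y = "[:0, 1:] :: 'a poly"
  have "(\<Sum>k<degree f. polar f k * w ^ k) =
      (\<Sum>k<degree f. \<Sum>i\<le>degree f. if k < i then [:coeff f i:] * (?y ^ (i - Suc k) * w ^ k) else 0)"
  proof (rule sum.cong[OF refl])
    fix k
    have "polar f k * w ^ k = (\<Sum>i\<in>{..degree f} \<inter> {i. k < i}. [:coeff f i:] * (?y ^ (i - Suc k) * w ^ k))"
      unfolding polar_def sum_distrib_right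
      by (intro sum.cong) (auto simp: monom_altdef)
    then show "polar f k * w ^ k = (\<Sum>i\<le>degree f. if k < i then [:coeff f i:] * (?y ^ (i - Suc k) * w ^ k) else 0)"
      by (simp add: sum.If_cases)
  qed
  also have "\<dots> = (\<Sum>i\<le>degree f. \<Sum>k<degree f. if k < i then [:coeff f i:] * (?y ^ (i - Suc k) * w ^ k) else 0)"
    by (rule sum.swap)
  also have "\<dots> = (\<Sum>i\<le>degree f. [:coeff f i:] * (\<Sum>k<i. ?y ^ (i - Suc k) * w ^ k))"
  proof (rule sum.cong[OF refl])
    fix i assume "i \<in> {..degree f}"
    then have "{..<degree f} \<inter> {k. k < i} = {..<i}" by auto
    then show "(\<Sum>k<degree f. if k < i then [:coeff f i:] * (?y ^ (i - Suc k) * w ^ k) else 0) =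
        [:coeff f i:] * (\<Sum>k<i. ?y ^ (i - Suc k) * w ^ k)"
      by (simp add: sum.If_cases smult_sum2)
  qed
  finally have "(w - ?y) * (\<Sum>k<degree f. polar f k * w ^ k) =
      (\<Sum>i\<le>degree f. [:coeff f i:] * ((w - ?y) * (\<Sum>k<i. ?y ^ (i - Suc k) * w ^ k)))"
    by (simp only: sum_distrib_left) (simp only: mult.left_commute)
  also have "\<dots> = (\<Sum>i\<le>degree f. [:coeff f i:] * (w ^ i - ?y ^ i))"
    by (simp only: power_diff_sumr2)
  also have "\<dots> = (\<Sum>i\<le>degree f. [:coeff f i:] * w ^ i) - (\<Sum>i\<le>degree f. monom (coeff f i) i)"
    by (simp add: algebra_simps sum_subtractf monom_altdef)
  finally show ?thesis by (simp add: poly_as_sum_of_monoms)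
qed

text \<open>This leading coefficient 1 permits expressing w^(d - 1) through lower powers of
  w.\<close>

lemma polar_last:
  assumes "lead_coeff f = 1" "0 < degree f"
  shows "polar f (degree f - 1) = 1"
proof -
  have "{degree f - 1<..degree f} = {degree f}" using assms(2) by auto
  then show ?thesis using assms by (simp add: polar_def)
qed

lemma totdeg_le_polar: "totdeg_le (degree f) f \<Longrightarrow> totdeg_le (degree f) (polar f k)"
  unfolding polar_def by (intro totdeg_le_sum) (auto simp: totdeg_le_def coeff_monom)

text \<open>The situation to be refuted: \<open>no_smooth\<close> says that f_Y vanishes at every
  point of the curve over the prime field, and by \<open>cert\<close> all these points lie over
  roots of \<open>\<Omega>\<close>.\<close>

locale stepanov =
  fixes f :: "'p::prime_card mod_ring poly poly" and \<Omega> :: "'p mod_ring poly"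
    and z z' :: "'p mod_ring poly poly" and A :: nat
  assumes monic: "lead_coeff f = 1" and degree_pos: "0 < degree f"
    and totdeg: "totdeg_le (degree f) f"
    and \<Omega>_nz: "\<Omega> \<noteq> 0"
    and cert: "[:\<Omega>:] = det (wronski_mat f (A * degree f)) * pderiv f * z + f * z'"
    and no_smooth: "\<And>x y. eval2 (\<lambda>c. c) x y f = 0 \<Longrightarrow> eval2 (\<lambda>c. c) x y (pderiv f) = 0"
begin

definition "q = CARD('p)"
definition "t = (\<Prod>a\<in>UNIV. [:- a, 1:] :: 'p mod_ring poly)"
abbreviation "d \<equiv> degree f"
abbreviation "T \<equiv> [:t:]"
abbreviation "Y \<equiv> [:0, 1:] :: 'p mod_ring poly poly"
abbreviation "X \<equiv> varX :: 'p mod_ring poly poly"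
abbreviation "D \<equiv> hderiv f"
abbreviation "\<sigma> \<equiv> [:\<Omega>:] * pderiv f"

lemma f_nz: "f \<noteq> 0" using degree_pos by auto

lemma q_prime: "prime q" unfolding q_def by (rule prime_card)

lemma q_gt_1: "1 < q" using q_prime by (rule prime_gt_1_nat)

lemma CHAR_polys: "CHAR('p mod_ring poly) = q" "CHAR('p mod_ring poly poly) = q"
  by (simp_all add: q_def)

lemma of_nat_q: "of_nat q = (0 :: 'p mod_ring)" "of_nat q = (0 :: 'p mod_ring poly)"
  "of_nat q = (0 :: 'p mod_ring poly poly)"
  unfolding q_def by (simp_all add: of_nat_poly)

lemma power_q: "(a :: 'p mod_ring) ^ q = a"
  unfolding q_def using finite_field_power_card_eq_same[of a] by simp

text \<open>Both sides are monic of degree q and vanish at all q elements of the field.\<close>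

lemma t_eq: "t = monom 1 q - monom 1 1"
proof (rule ccontr)
  let ?r = "t - (monom 1 q - monom 1 1)"
  assume "t \<noteq> monom 1 q - monom 1 1"
  then have nz: "?r \<noteq> 0" by simp
  have deg_t: "degree t = q"
    unfolding t_def q_def by (subst degree_prod_eq_sum_degree) auto
  have lead_t: "lead_coeff t = 1" unfolding t_def by (simp add: lead_coeff_prod)
  have "coeff ?r k = 0" if "k \<ge> q" for k
    using that lead_t deg_t q_gt_1 by (cases "k = q") (auto simp: coeff_eq_0 coeff_monom)
  then have "degree ?r < q" using nz by (meson leading_coeff_0_iff not_le)
  have "poly ?r a = 0" for a
    using power_q[of a] by (simp add: t_def poly_prod poly_monom prod_zero_iff) 
  then have "{a. poly ?r a = 0} = UNIV" by auto
  then have "q \<le> degree ?r" using card_poly_roots_bound[OF nz] by (simp add: q_def)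
  then show False using \<open>degree ?r < q\<close> by simp
qed

lemma degree_t: "degree t = q"
  unfolding t_def q_def by (subst degree_prod_eq_sum_degree) auto

lemma t_nz: "t \<noteq> 0" using degree_t q_gt_1 by auto

lemma t_dvdI:
  assumes "\<And>x. poly c x = 0"
  shows "t dvd c"
proof -
  have "degree (c mod t) < q \<or> c mod t = 0"
    using degree_mod_less[OF t_nz, of c] degree_t by auto
  moreover have "poly t x = 0" for x by (auto simp: t_def poly_prod)
  then have "poly (c mod t) x = 0" for x
    using assms[of x] div_mult_mod_eq[of c t] by (metis add_0 mult_zero_right poly_add poly_mult)
  then have "{a. poly (c mod t) a = 0} = UNIV" by auto
  then have "c mod t = 0 \<or> q \<le> degree (c mod t)" using card_poly_roots_bound[of "c mod t"] by (auto simp: q_def)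
  ultimately show ?thesis by (auto simp: mod_eq_0_iff_dvd)
qed

text \<open>The ideal (T, f): membership means vanishing on the fibres of the curve over all x in
  F_p.\<close>

definition "I = {h. \<exists>u v. h = T * u + f * v}"

lemma I_add: "a \<in> I \<Longrightarrow> b \<in> I \<Longrightarrow> a + b \<in> I"
proof -
  assume "a \<in> I" "b \<in> I"
  then obtain u v u' v' where "a = T * u + f * v" "b = T * u' + f * v'" unfolding I_def by blast
  then have "a + b = T * (u + u') + f * (v + v')" by (simp only: distrib_left) (simp only: ac_simps)
  then show ?thesis unfolding I_def by blast
qed

lemma I_mult: "a \<in> I \<Longrightarrow> b * a \<in> I"
proof -
  assume "a \<in> I"
  then obtain u v where "a = T * u + f * v" unfolding I_def by blast
  then have "b * a = T * (b * u) + f * (b * v)" by (simp only: distrib_left) (simp only: ac_simps)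
  then show ?thesis unfolding I_def by blast
qed

lemma I_dvd_f: "f dvd a \<Longrightarrow> a \<in> I"
  unfolding I_def by (auto simp: dvd_def intro: exI[of _ 0])

lemma I_dvd_T: "T dvd a \<Longrightarrow> a \<in> I"
proof -
  assume "T dvd a"
  then obtain u where "a = T * u + f * 0" by (auto simp: dvd_def)
  then show ?thesis unfolding I_def by blast
qed

lemma I_diff: "a - b \<in> I \<Longrightarrow> b \<in> I \<Longrightarrow> a \<in> I"
  using I_add[of "a - b" b] by simp

lemma I_sum: "(\<And>i. i \<in> S \<Longrightarrow> g i \<in> I) \<Longrightarrow> sum g S \<in> I"
  by (induction S rule: infinite_finite_induct) (auto intro: I_add I_dvd_f)

abbreviation "G \<equiv> \<Sum>k<d. polar f k * (Y ^ q) ^ k"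

lemma eval_certificate:
  assumes "eval2 (\<lambda>c. c) x y f = 0"
  shows "poly \<Omega> x = 0"
proof -
  note hom = idom_hom_eval2[OF idom_hom_id, of x y]
  have "eval2 (\<lambda>c. c) x y [:\<Omega>:] = 0"
    unfolding cert using assms no_smooth[OF assms] by (simp add: idom_homD[OF hom])
  then show ?thesis using eval2_const[OF idom_hom_id, of x y \<Omega>] by (simp add: map_poly_idI')
qed

text \<open>Fibre by fibre: where \<open>\<Omega>\<close> is nonzero, f(x, Y) has no root in F_p and
  is coprime to Y^q - Y. By Frobenius f(x, Y^q) = f(x, Y)^q, so f(x, Y) divides (Y^q - Y) G and
  hence G. Over the roots of \<open>\<Omega>\<close> the product vanishes anyway.\<close>

lemma \<Omega>_G_in_I: "[:\<Omega>:] * G \<in> I"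
proof -
  obtain Q r where Qr: "[:\<Omega>:] * G = f * Q + r" "\<And>k. d \<le> k \<Longrightarrow> coeff r k = 0"
    using monic_division[OF monic] by blast
  have "poly (coeff r k) x = 0" for k x
  proof -
    define E where "E = map_poly (\<lambda>c. poly c x)"
    have h0: "idom_hom (\<lambda>c :: 'p mod_ring poly. poly c x)" by unfold_locales auto
    have E: "idom_hom E" unfolding E_def by (rule idom_hom_map_poly[OF h0])
    note E_simps = idom_homD[OF E]
    have cE: "coeff (E h) k = poly (coeff h k) x" for h k unfolding E_def by (simp add: coeff_map_poly)
    have "coeff (E f) d = 1" using monic by (simp add: cE)
    moreover have "degree (E f) \<le> d" unfolding E_def by (rule degree_map_poly_le)
    ultimately have dE: "degree (E f) = d" by (metis le_antisym le_degree zero_neq_one)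
    have "E f dvd E ([:\<Omega>:] * G)"
    proof (cases "poly \<Omega> x = 0")
      case True
      have "E [:\<Omega>:] = 0" using True unfolding E_def by (simp add: Polynomial.map_poly_pCons)
      then show ?thesis by (simp only: E_simps mult_zero_left dvd_0_right)
    next
      case False
      have nr: "poly (E f) a \<noteq> 0" for a
      proof -
        have "poly (E f) a = eval2 (\<lambda>c. c) x a f" unfolding E_def eval2_def by (simp add: map_poly_idI')
        then show ?thesis using eval_certificate[of x a] False by auto
      qed
      have EY: "E Y = [:0, 1:]" unfolding E_def by (simp add: Polynomial.map_poly_pCons)
      have "E (\<Sum>i\<le>d. [:coeff f i:] * (Y ^ q) ^ i) = (\<Sum>i\<le>d. [:coeff (E f) i:] * ([:0, 1:] ^ q) ^ i)"
        by (simp only: E_simps EY) (simp add: E_def Polynomial.map_poly_pCons coeff_map_poly)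
      also have "\<dots> = (\<Sum>i\<le>d. (monom (coeff (E f) i) i) ^ q)"
        by (intro sum.cong refl) (simp add: monom_altdef power_q smult_power power_mult[symmetric] mult.commute)
      also have "\<dots> = (\<Sum>i\<le>d. monom (coeff (E f) i) i) ^ q"
        by (rule freshmans_dream_sum[symmetric]) (simp_all only: CHAR_polys q_prime)
      also have "(\<Sum>i\<le>d. monom (coeff (E f) i) i) = E f"
        using poly_as_sum_of_monoms[of "E f"] dE by simp
      finally have "E ((Y ^ q - Y) * G) = E f ^ q - E f"
        unfolding polar_sum by (simp only: E_simps)
      then have "([:0, 1:] ^ q - [:0, 1:]) * E G = E f ^ q - E f"
        by (simp only: E_simps EY)
      moreover have "[:0, 1:] ^ q - [:0, 1:] = t" unfolding t_eq by (simp add: monom_altdef)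
      moreover have "E f dvd E f ^ q - E f" using q_gt_1 by (intro dvd_diff dvd_power) auto
      ultimately have "E f dvd t * E G" by simp
      moreover have "coprime (E f) t" unfolding t_def
      proof (rule prod_coprime_right)
        fix a :: "'p mod_ring"
        have "prime_elem [:- a, 1:]" by (rule prime_elem_linear_field_poly) simp
        moreover have "\<not> [:- a, 1:] dvd E f" using nr[of a] by (simp add: poly_eq_0_iff_dvd)
        ultimately show "coprime (E f) [:- a, 1:]"
          using prime_elem_imp_coprime coprime_commute by blast
      qed
      ultimately have "E f dvd E G" by (simp add: coprime_dvd_mult_right_iff)
      then show ?thesis unfolding E_simps(6) by (rule dvd_mult)
    qed
    then have "E f dvd E r" unfolding Qr(1) by (simp only: E_simps) (simp add: dvd_add_right_iff)
    then have "E r = 0"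
      by (rule monic_dvd_small) (use dE degree_pos Qr(2) in \<open>auto simp: cE\<close>)
    then show ?thesis using cE[of r k] by simp
  qed
  then have "t dvd coeff r k" for k by (intro t_dvdI)
  then have "T dvd r" by (simp add: const_poly_dvd_iff)
  then show ?thesis unfolding Qr(1) by (intro I_add I_dvd_f I_dvd_T) auto
qed

end

section \<open>The auxiliary function: order of vanishing, degree, choice of coefficients\<close>

context stepanov
begin

definition "b a j k = (\<Sum>s<A * d. [:[:a s j k:]:] * (bimonom d s :: 'p mod_ring poly poly))"
definition "\<Phi> J a = (\<Sum>j<J. \<Sum>k<d. b a j k * (X ^ j * Y ^ k) ^ q)"
text \<open>The coefficient of w^k in D^l \<Phi> once X^q has been replaced by X and w^(d - 1)
  eliminated by means of \<open>G\<close>. Its vanishing on the curve for k < d - 1 is the condition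
  imposed on \<open>a\<close>.\<close>

definition "defect J a l k = (\<Sum>j<J. X ^ j * ((D ^^ l) (b a j k) - polar f k * (D ^^ l) (b a j (d - 1))))"

lemma D_power_q: "D (h ^ q) = 0"
  by (simp add: hderiv.power of_nat_q)

text \<open>In characteristic p the q-th powers are constants of \<open>D\<close>, so a derivative
  of \<Phi> has the same shape, with only the small cofactors \<open>b a j k\<close>
  differentiated.\<close>

lemma iter_\<Phi>: "(D ^^ l) (\<Phi> J a) = (\<Sum>j<J. \<Sum>k<d. (D ^^ l) (b a j k) * (X ^ j * Y ^ k) ^ q)"
  unfolding \<Phi>_def hderiv.iter_sum by (simp only: hderiv.iter_const_mult[OF D_power_q])

lemma X_power_q: "X ^ q - X = T"
proof -
  have Xn: "X ^ n = [:monom 1 n:]" for n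
    by (induction n) (simp_all add: varX_def monom_Suc one_pCons)
  have "X ^ q - X ^ 1 = T" unfolding Xn t_eq by simp
  then show ?thesis by simp
qed

text \<open>Modulo \<open>T\<close>, X^q is X, so D^l \<Phi> becomes a polynomial in w = Y^q of
  degree below d with coefficients c_k. Subtracting c_(d - 1) times \<open>G\<close>, which
  \<open>\<Omega>\<close> brings into the ideal, leaves exactly the defects.\<close>

lemma \<Omega>_iter_\<Phi>_in_I:
  assumes "\<And>k. k < d - 1 \<Longrightarrow> f dvd defect J a l k"
  shows "[:\<Omega>:] * (D ^^ l) (\<Phi> J a) \<in> I"
proof -
  define c where "c k = (\<Sum>j<J. X ^ j * (D ^^ l) (b a j k))" for k
  have 1: "(D ^^ l) (\<Phi> J a) - (\<Sum>k<d. c k * (Y ^ q) ^ k) \<in> I"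
  proof -
    have "(\<Sum>k<d. c k * (Y ^ q) ^ k) = (\<Sum>j<J. \<Sum>k<d. X ^ j * (D ^^ l) (b a j k) * (Y ^ q) ^ k)"
      unfolding c_def sum_distrib_right by (rule sum.swap)
    then have "(D ^^ l) (\<Phi> J a) - (\<Sum>k<d. c k * (Y ^ q) ^ k) =
        (\<Sum>j<J. \<Sum>k<d. (D ^^ l) (b a j k) * (X ^ j * Y ^ k) ^ q - X ^ j * (D ^^ l) (b a j k) * (Y ^ q) ^ k)"
      unfolding iter_\<Phi> by (simp only: sum_subtractf)
    also have "\<dots> \<in> I"
    proof (intro I_sum)
      fix j k
      have "X ^ q - X dvd (X ^ q) ^ j - X ^ j" unfolding power_diff_sumr2 by (rule dvd_triv_left)
      moreover have "(D ^^ l) (b a j k) * (X ^ j * Y ^ k) ^ q - X ^ j * (D ^^ l) (b a j k) * (Y ^ q) ^ k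
        = ((D ^^ l) (b a j k) * (Y ^ q) ^ k) * ((X ^ q) ^ j - X ^ j)"
      proof -
        have "(X ^ j * Y ^ k) ^ q = (X ^ q) ^ j * (Y ^ q) ^ k"
          unfolding power_mult_distrib power_commutes[symmetric] by (simp only: power_mult[symmetric] mult.commute)
        moreover have "B * (P * Q) - R * B * Q = B * Q * (P - R)" for B P Q R :: "'p mod_ring poly poly"
          by (simp add: algebra_simps)
        ultimately show ?thesis by simp
      qed
      ultimately show "(D ^^ l) (b a j k) * (X ^ j * Y ^ k) ^ q - X ^ j * (D ^^ l) (b a j k) * (Y ^ q) ^ k \<in> I"
        unfolding X_power_q using I_mult I_dvd_T by metis
    qed
    finally show ?thesis .
  qed
  have 2: "(\<Sum>k<d. c k * (Y ^ q) ^ k) - c (d - 1) * G \<in> I"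
  proof -
    have "(\<Sum>k<d. c k * (Y ^ q) ^ k) - c (d - 1) * G = (\<Sum>k<d. (Y ^ q) ^ k * (c k - polar f k * c (d - 1)))"
      unfolding sum_distrib_left right_diff_distrib sum_subtractf by (simp only: ac_simps)
    also have "\<dots> \<in> I"
    proof (intro I_sum I_mult)
      fix k assume "k \<in> {..<d}"
      then consider "k = d - 1" | "k < d - 1" by fastforce
      then show "c k - polar f k * c (d - 1) \<in> I"
      proof cases
        case 1
        then show ?thesis using polar_last[OF monic degree_pos] by (simp add: I_dvd_f)
      next
        case 2
        have "c k - polar f k * c (d - 1) = defect J a l k"
          unfolding c_def defect_def sum_distrib_left right_diff_distrib sum_subtractf by (simp only: ac_simps)
        then show ?thesis using assms[OF 2] I_dvd_f by simp
      qed
    qed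
    finally show ?thesis .
  qed
  have 3: "c (d - 1) * ([:\<Omega>:] * G) \<in> I" by (rule I_mult[OF \<Omega>_G_in_I])
  have "[:\<Omega>:] * ((D ^^ l) (\<Phi> J a) - (\<Sum>k<d. c k * (Y ^ q) ^ k)) +
      ([:\<Omega>:] * ((\<Sum>k<d. c k * (Y ^ q) ^ k) - c (d - 1) * G) + c (d - 1) * ([:\<Omega>:] * G)) \<in> I"
    by (intro I_add I_mult 1 2 3)
  moreover have "[:\<Omega>:] * ((D ^^ l) (\<Phi> J a) - (\<Sum>k<d. c k * (Y ^ q) ^ k)) +
      ([:\<Omega>:] * ((\<Sum>k<d. c k * (Y ^ q) ^ k) - c (d - 1) * G) + c (d - 1) * ([:\<Omega>:] * G)) =
      [:\<Omega>:] * (D ^^ l) (\<Phi> J a)"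
    by (simp only: right_diff_distrib mult.left_commute[of "c (d - 1)"]) (simp only: diff_add_cancel)
  ultimately show ?thesis by simp
qed

text \<open>Since x^q - x has derivative -1, \<open>T\<close> is a local parameter wherever f_Y is
  nonzero.\<close>

lemma D_T: "D T = - pderiv f"
proof -
  have "pderiv t = -1" unfolding t_eq
    by (simp add: pderiv_diff pderiv_monom of_nat_q one_pCons monom_0)
  moreover have "xderiv T = [:pderiv t:]" by (rule poly_eqI) (simp add: coeff_pCons split: nat.splits)
  ultimately show ?thesis by (simp add: hderiv_def pderiv_pCons)
qed

lemma fact_unit:
  assumes "l < q"
  obtains u where "of_nat (fact l) * u = (1 :: 'p mod_ring poly poly)"
proof -
  have "\<not> q dvd fact l" using prime_dvd_fact_iff[OF q_prime] assms by simp
  then have "of_nat (fact l) \<noteq> (0 :: 'p mod_ring)" unfolding q_def by (metis of_nat_0_mod_ring_dvd)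
  then have "of_nat (fact l) * [:[:inverse (of_nat (fact l)):]:] = (1 :: 'p mod_ring poly poly)"
    by (simp add: of_nat_poly one_pCons del: of_nat_fact)
  then show ?thesis using that by blast
qed

text \<open>Vanishing derivatives are turned into divisibility by powers of \<open>T\<close>. If S =
  T^l \<Psi> modulo f, then D^l S is l! (D T)^l \<Psi> modulo T and f, and \<open>\<Omega>\<close>
  times it lies in the ideal, so multiplying \<Psi> by \<open>\<sigma> ^ Suc l\<close> produces
  another factor \<open>T\<close>. These costs add up to the exponent \<open>\<Sum>{..l}\<close>; l
  < q keeps l! invertible.\<close>

lemma T_adic:
  assumes "\<And>i k. i < l \<Longrightarrow> k < d - 1 \<Longrightarrow> f dvd defect J a i k" "l \<le> q"
  shows "\<exists>\<Psi>. f dvd \<sigma> ^ (\<Sum>{..l}) * \<Phi> J a - T ^ l * \<Psi>"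
  using assms
proof (induction l)
  case 0
  show ?case by (rule exI[of _ "\<sigma> ^ (\<Sum>{..0}) * \<Phi> J a"]) simp
next
  case (Suc l)
  obtain \<Psi> where \<Psi>: "f dvd \<sigma> ^ (\<Sum>{..l}) * \<Phi> J a - T ^ l * \<Psi>"
    using Suc.IH Suc.prems by (meson Suc_leD less_SucI)
  let ?S = "\<sigma> ^ (\<Sum>{..l}) * \<Phi> J a"
  \<comment> \<open>The ideal quotient of \<open>I\<close> by \<open>\<Omega>\<close>.\<close>
  let ?I = "{h. [:\<Omega>:] * h \<in> I}"
  have "(D ^^ l) ?S \<in> ?I"
  proof (rule hderiv.iter_mult_ideal)
    show "x + y \<in> ?I" if "x \<in> ?I" "y \<in> ?I" for x y
      using that I_add[of "[:\<Omega>:] * x" "[:\<Omega>:] * y"] by (simp only: mem_Collect_eq distrib_left)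
    show "y * x \<in> ?I" if "x \<in> ?I" for x y
      using that I_mult[of "[:\<Omega>:] * x" y] by (simp only: mem_Collect_eq mult.left_commute)
    show "(D ^^ i) (\<Phi> J a) \<in> ?I" if "i \<le> l" for i
      using \<Omega>_iter_\<Phi>_in_I[of J a i] Suc.prems(1) that by (simp only: mem_Collect_eq less_Suc_eq_le)
  qed
  moreover have "f dvd (D ^^ l) ?S - (D ^^ l) (T ^ l * \<Psi>)"
    using hderiv.iter_dvd[OF hderiv_self \<Psi>, of l] by (simp only: hderiv.iter_diff)
  then have "f dvd (D ^^ l) (T ^ l * \<Psi>) - (D ^^ l) ?S" by (rule dvd_diff_swap)
  then have "[:\<Omega>:] * ((D ^^ l) (T ^ l * \<Psi>) - (D ^^ l) ?S) \<in> I"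
    by (intro I_mult I_dvd_f)
  ultimately have 1: "[:\<Omega>:] * (D ^^ l) (T ^ l * \<Psi>) \<in> I"
    using I_diff[of "[:\<Omega>:] * (D ^^ l) (T ^ l * \<Psi>)" "[:\<Omega>:] * (D ^^ l) ?S"]
    by (simp only: mem_Collect_eq right_diff_distrib)
  have "T dvd of_nat (fact l) * D T ^ l * \<Psi> - (D ^^ l) (T ^ l * \<Psi>)"
    using hderiv.iter_power_mult_mod by (rule dvd_diff_swap)
  then have "[:\<Omega>:] * (of_nat (fact l) * D T ^ l * \<Psi> - (D ^^ l) (T ^ l * \<Psi>)) \<in> I"
    by (intro I_mult I_dvd_T)
  then have 2: "[:\<Omega>:] * (of_nat (fact l) * D T ^ l * \<Psi>) \<in> I"
    using I_diff 1 by (simp only: right_diff_distrib)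
  obtain u where u: "of_nat (fact l) * u = (1 :: 'p mod_ring poly poly)"
    using fact_unit Suc.prems(2) by (metis Suc_le_lessD)
  \<comment> \<open>These multipliers clear the sign and l!, and complete \<Omega> f_Y^l to
    \<open>\<sigma> ^ Suc l\<close>.\<close>
  have "(-1) ^ l * (u * ([:\<Omega>:] ^ l * (pderiv f * ([:\<Omega>:] * (of_nat (fact l) * D T ^ l * \<Psi>))))) \<in> I"
    by (intro I_mult 2)
  also have "(-1) ^ l * (u * ([:\<Omega>:] ^ l * (pderiv f * ([:\<Omega>:] * (of_nat (fact l) * D T ^ l * \<Psi>))))) =
      (of_nat (fact l) * u) * (((-1) ^ l * (-1) ^ l) * (\<sigma> ^ Suc l * \<Psi>))"
    unfolding D_T power_minus[of "pderiv f"] power_mult_distrib power_Suc by (simp only: ac_simps)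
  also have "\<dots> = \<sigma> ^ Suc l * \<Psi>" unfolding u by (simp flip: power_add power_mult_distrib)
  finally obtain v w where vw: "\<sigma> ^ Suc l * \<Psi> = T * v + f * w" unfolding I_def by blast
  obtain r where r: "?S = T ^ l * \<Psi> + f * r" using \<Psi> by (metis dvdE add_diff_cancel_left' diff_add_cancel add.commute)
  have "\<sigma> ^ (\<Sum>{..Suc l}) * \<Phi> J a = \<sigma> ^ Suc l * ?S" by (simp add: power_add mult.assoc mult.left_commute)
  also have "\<dots> = T ^ l * (\<sigma> ^ Suc l * \<Psi>) + f * (\<sigma> ^ Suc l * r)"
    unfolding r distrib_left by (simp only: ac_simps)
  also have "\<dots> = T ^ Suc l * v + f * (T ^ l * w + \<sigma> ^ Suc l * r)"
    unfolding vw by (simp only: distrib_left power_Suc ac_simps)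
  finally have "\<sigma> ^ (\<Sum>{..Suc l}) * \<Phi> J a - T ^ Suc l * v = f * (T ^ l * w + \<sigma> ^ Suc l * r)"
    by (simp only: add_diff_cancel_left')
  then show ?case by (metis dvd_triv_left)
qed

lemma totdeg_le_const: "totdeg_le (degree c) [:c:]"
  by (auto simp: totdeg_le_def coeff_pCons coeff_eq_0 split: nat.splits)

lemma totdeg_le_bimonom: "s < A * d \<Longrightarrow> totdeg_le (A + d) (bimonom d s :: 'p mod_ring poly poly)"
  unfolding bimonom_def using degree_pos
  by (intro totdeg_le_monom) (metis add.commute add_mono div_less_iff_less_mult less_imp_le mod_less_divisor)

lemma totdeg_le_b: "totdeg_le (A + d) (b a j k)"
  unfolding b_def
proof (rule totdeg_le_sum)
  fix s assume "s \<in> {..<A * d}"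
  then have "totdeg_le (degree [:a s j k:] + (A + d)) ([:[:a s j k:]:] * bimonom d s)"
    by (intro totdeg_le_mult[OF totdeg_le_const totdeg_le_bimonom]) simp
  then show "totdeg_le (A + d) ([:[:a s j k:]:] * bimonom d s)" by simp
qed

lemma totdeg_le_X: "totdeg_le 1 X" and totdeg_le_Y: "totdeg_le 1 Y"
  by (auto simp: totdeg_le_def varX_def coeff_pCons split: nat.splits)

lemma totdeg_le_\<Phi>: "totdeg_le (A + d + q * (J + d)) (\<Phi> J a)"
  unfolding \<Phi>_def
proof (intro totdeg_le_sum totdeg_le_mult totdeg_le_b)
  fix j k assume jk: "j \<in> {..<J}" "k \<in> {..<d}"
  have "totdeg_le (q * (j * 1 + k * 1)) ((X ^ j * Y ^ k) ^ q)"
    by (intro totdeg_le_power totdeg_le_mult totdeg_le_X totdeg_le_Y)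
  then show "totdeg_le (q * (J + d)) ((X ^ j * Y ^ k) ^ q)"
    by (rule totdeg_le_mono) (use jk in \<open>simp add: add_mono\<close>)
qed

text \<open>The remainder of \<open>\<sigma> ^ E * \<Phi> J a\<close> modulo f is T^M \<Psi>. Each
  of its nonzero coefficients has degree at least M q in x, while the bound on q keeps its total
  degree below q (J + d) + q. With M = J + d + 1 only \<Psi> = 0 is left.\<close>

lemma f_dvd_\<Phi>:
  assumes "\<And>i k. i < M \<Longrightarrow> k < d - 1 \<Longrightarrow> f dvd defect J a i k" "M \<le> q"
    and M: "M = J + d + 1" and q: "\<Sum>{..M} * (degree \<Omega> + d) + (A + d) < q"
  shows "f dvd \<Phi> J a"
proof -
  define E where "E = \<Sum>{..M}"
  obtain \<Psi>0 where \<Psi>0: "f dvd \<sigma> ^ E * \<Phi> J a - T ^ M * \<Psi>0"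
    using T_adic[of M J a] assms(1,2) unfolding E_def by blast
  obtain u \<Psi> where \<Psi>: "\<Psi>0 = f * u + \<Psi>" "\<And>k. d \<le> k \<Longrightarrow> coeff \<Psi> k = 0"
    using monic_division[OF monic] by blast
  define N where "N = E * (degree \<Omega> + d) + (A + d + q * (J + d))"
  have "totdeg_le N (\<sigma> ^ E * \<Phi> J a)" unfolding N_def
    by (intro totdeg_le_mult totdeg_le_power totdeg_le_const totdeg_le_pderiv totdeg totdeg_le_\<Phi>)
  then obtain v r where r: "\<sigma> ^ E * \<Phi> J a = f * v + r" "\<And>k. d \<le> k \<Longrightarrow> coeff r k = 0" "totdeg_le N r"
    using monic_division_totdeg[OF monic totdeg] by blast
  have Tc: "T ^ M = [:t ^ M:]" by (induction M) (simp_all add: one_pCons)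
  have "r - T ^ M * \<Psi> = 0"
  proof (rule monic_dvd_small)
    have "f dvd f * v + r - T ^ M * (f * u + \<Psi>)" using \<Psi>0 unfolding \<Psi>(1) r(1) .
    moreover have "f * v + r - T ^ M * (f * u + \<Psi>) = f * (v - T ^ M * u) + (r - T ^ M * \<Psi>)"
      unfolding distrib_left right_diff_distrib by (simp only: mult.left_commute[of "T ^ M"]) simp
    ultimately show "f dvd r - T ^ M * \<Psi>" by (simp add: dvd_add_right_iff)
    show "f \<noteq> 0" by (rule f_nz)
    fix k assume "d \<le> k"
    then show "coeff (r - T ^ M * \<Psi>) k = 0" using r(2) \<Psi>(2) unfolding Tc by simp
  qed
  then have rT: "r = [:t ^ M:] * \<Psi>" unfolding Tc by simp
  have "\<Psi> = 0"
  proof (rule ccontr)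
    assume "\<Psi> \<noteq> 0"
    then obtain k where k: "coeff \<Psi> k \<noteq> 0" by (meson leading_coeff_neq_0)
    have ck: "coeff r k = t ^ M * coeff \<Psi> k" unfolding rT by simp
    then have nz: "coeff r k \<noteq> 0" using t_nz k by simp
    have "degree (coeff r k) = M * q + degree (coeff \<Psi> k)"
      unfolding ck using t_nz k by (simp add: degree_mult_eq degree_power_eq degree_t)
    moreover have "N < M * q" using q unfolding N_def E_def M by (simp add: algebra_simps)
    ultimately have "coeff (coeff r k) (degree (coeff r k)) = 0"
      by (intro totdeg_leD[OF r(3)]) simp
    then show False using nz by simp
  qed
  then have dvd: "f dvd \<sigma> ^ E * \<Phi> J a" using rT r(1) by simp
  \<comment> \<open>f_Y W is \<Omega> modulo f, so multiplying by \<open>W ^ E\<close> trades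
    \<open>\<sigma> ^ E\<close> for a power of \<Omega>; this is a polynomial in x and can be
    cancelled modulo the monic \<open>f\<close>.\<close>
  define W where "W = det (wronski_mat f (A * d)) * z"
  have "f dvd pderiv f * W - [:\<Omega>:]" unfolding cert W_def by (simp add: algebra_simps)
  moreover have "pderiv f * W - [:\<Omega>:] dvd (pderiv f * W) ^ E - [:\<Omega>:] ^ E"
    unfolding power_diff_sumr2 by (rule dvd_triv_left)
  ultimately have "f dvd (pderiv f * W) ^ E - [:\<Omega>:] ^ E" by (rule dvd_trans)
  then have "f dvd ((pderiv f * W) ^ E - [:\<Omega>:] ^ E) * ([:\<Omega>:] ^ E * \<Phi> J a)" by (rule dvd_mult2)
  moreover have "f dvd W ^ E * (\<sigma> ^ E * \<Phi> J a)" using dvd by (rule dvd_mult)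
  moreover have "W ^ E * (\<sigma> ^ E * \<Phi> J a) - ((pderiv f * W) ^ E - [:\<Omega>:] ^ E) * ([:\<Omega>:] ^ E * \<Phi> J a)
      = ([:\<Omega>:] ^ E * [:\<Omega>:] ^ E) * \<Phi> J a"
    unfolding power_mult_distrib left_diff_distrib by (simp only: ac_simps) simp
  ultimately have "f dvd ([:\<Omega>:] ^ E * [:\<Omega>:] ^ E) * \<Phi> J a" by (metis dvd_diff)
  moreover have "[:\<Omega>:] ^ E * [:\<Omega>:] ^ E = [:\<Omega> ^ E * \<Omega> ^ E:]"
  proof -
    have "[:\<Omega>:] ^ n = [:\<Omega> ^ n:]" for n by (induction n) (simp_all add: one_pCons)
    then show ?thesis by simp
  qed
  ultimately show ?thesis
    using monic_dvd_const_mult[OF monic, of "\<Omega> ^ E * \<Omega> ^ E" "\<Phi> J a"] \<Omega>_nz by simp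
qed

text \<open>Elements of F_p are their own q-th powers, so \<Phi> is a combination of the monomials
  with coefficients h_s^q, which are constants of \<open>D\<close>. Its derivatives form a linear
  system whose matrix is the Wronskian; adjugate and certificate give f | \<Omega> h_s^q,
  squarefreeness gives f | h_s, and h_s has degree below d in Y.\<close>

lemma coeffs_zero:
  assumes "f dvd \<Phi> J a" "s < A * d" "j < J" "k < d"
  shows "a s j k = 0"
proof -
  define N where "N = A * d"
  define h where "h s = (\<Sum>j<J. \<Sum>k<d. [:[:a s j k:]:] * (X ^ j * Y ^ k))" for s
  have hq: "h s ^ q = (\<Sum>j<J. \<Sum>k<d. [:[:a s j k:]:] * (X ^ j * Y ^ k) ^ q)" for s
  proof -
    have pr: "prime CHAR('p mod_ring poly poly)" "q = CHAR('p mod_ring poly poly)"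
      by (simp_all only: CHAR_polys q_prime)
    have c: "[:[:c:]:] ^ q = [:[:c:]:]" for c :: "'p mod_ring"
    proof -
      have "[:[:c:]:] ^ n = [:[:c ^ n:]:]" for n by (induction n) (simp_all add: one_pCons)
      then show ?thesis by (simp add: power_q)
    qed
    show ?thesis unfolding h_def
      by (simp only: freshmans_dream_sum[OF pr] power_mult_distrib[of "[:[:_:]:]"] c)
  qed
  have \<Phi>: "\<Phi> J a = (\<Sum>s<N. bimonom d s * h s ^ q)"
  proof -
    have "(\<Sum>s<N. bimonom d s * h s ^ q) =
        (\<Sum>s<N. \<Sum>j<J. \<Sum>k<d. [:[:a s j k:]:] * bimonom d s * (X ^ j * Y ^ k) ^ q)"
      unfolding hq sum_distrib_left by (simp only: ac_simps)
    also have "\<dots> = (\<Sum>j<J. \<Sum>s<N. \<Sum>k<d. [:[:a s j k:]:] * bimonom d s * (X ^ j * Y ^ k) ^ q)"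
      by (rule sum.swap)
    also have "\<dots> = (\<Sum>j<J. \<Sum>k<d. \<Sum>s<N. [:[:a s j k:]:] * bimonom d s * (X ^ j * Y ^ k) ^ q)"
      by (intro sum.cong refl sum.swap)
    finally show ?thesis unfolding \<Phi>_def b_def N_def sum_distrib_right by simp
  qed
  define B where "B = wronski_mat f N"
  have B: "B \<in> carrier_mat N N" unfolding B_def wronski_mat_def by simp
  define v where "v = vec N (\<lambda>s. h s ^ q)"
  have v: "v \<in> carrier_vec N" unfolding v_def by simp
  have Bv: "f dvd (B *\<^sub>v v) $ m" if "m < N" for m
  proof -
    have "f dvd (D ^^ m) (\<Phi> J a)" by (rule hderiv.iter_dvd[OF hderiv_self assms(1)])
    also have "(D ^^ m) (\<Phi> J a) = (\<Sum>s<N. (D ^^ m) (bimonom d s) * h s ^ q)"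
      unfolding \<Phi> hderiv.iter_sum by (simp only: hderiv.iter_const_mult[OF D_power_q])
    also have "\<dots> = (B *\<^sub>v v) $ m" using that unfolding B_def wronski_mat_def v_def
      by (simp add: scalar_prod_def lessThan_atLeast0)
    finally show ?thesis .
  qed
  have "f dvd det B * h s ^ q" if "s < N" for s
  proof -
    have "adj_mat B *\<^sub>v (B *\<^sub>v v) = det B \<cdot>\<^sub>v v"
    proof -
      have "adj_mat B *\<^sub>v (B *\<^sub>v v) = (det B \<cdot>\<^sub>m 1\<^sub>m N) *\<^sub>v v"
        using adj_mat[OF B] B v by (simp flip: assoc_mult_mat_vec)
      also have "\<dots> = det B \<cdot>\<^sub>v v"
        using v by (intro eq_vecI) (auto simp: scalar_prod_def sum.delta if_distrib[where f = "\<lambda>x. x * _"] if_distrib[where f = "\<lambda>x. _ * x"] mult.assoc cong: if_cong)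
      finally show ?thesis .
    qed
    then have "det B * h s ^ q = (adj_mat B *\<^sub>v (B *\<^sub>v v)) $ s" using that v by (simp add: v_def)
    also have "\<dots> = (\<Sum>m<N. adj_mat B $$ (s, m) * (B *\<^sub>v v) $ m)"
      using that adj_mat(1)[OF B] B v by (simp add: scalar_prod_def lessThan_atLeast0)
    also have "f dvd \<dots>" using Bv by (intro dvd_sum dvd_mult) auto
    finally show ?thesis .
  qed
  then have "f dvd det B * h s ^ q" using assms(2) unfolding N_def by blast
  then have "f dvd (det B * h s ^ q) * (pderiv f * z) + f * (z' * h s ^ q)" by simp
  also have "\<dots> = [:\<Omega>:] * h s ^ q"
    unfolding cert B_def[symmetric] N_def[symmetric] distrib_right by (simp only: ac_simps)
  finally have "f dvd h s ^ q" using monic_dvd_const_mult[OF monic \<Omega>_nz] by blast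
  moreover have "squarefree f"
    by (rule squarefree_of_norm[OF monic \<Omega>_nz, of "det (wronski_mat f (A * d)) * z" z'])
      (simp only: cert ac_simps)
  ultimately have "f dvd h s" using squarefree_dvd_power by blast
  have XY: "[:[:c:]:] * (X ^ j * Y ^ k) = monom (monom c j) k" for c j k
  proof -
    have "X ^ j = [:monom 1 j:]" by (induction j) (simp_all add: varX_def monom_Suc one_pCons)
    then show ?thesis by (simp add: monom_altdef mult.commute smult_monom)
  qed
  have ch: "coeff (coeff (h s) k') j' = (if j' < J \<and> k' < d then a s j' k' else 0)" for k' j'
  proof -
    have "coeff (coeff (h s) k') j' = (\<Sum>j<J. \<Sum>k<d. if k = k' then if j = j' then a s j k else 0 else 0)"
      unfolding h_def XY by (auto simp: coeff_sum coeff_monom intro!: sum.cong)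
    then show ?thesis by (cases "k' < d") simp_all
  qed
  have "h s = 0"
    by (rule monic_dvd_small[OF \<open>f dvd h s\<close> f_nz]) (simp add: poly_eq_iff ch)
  then show ?thesis using ch[of k j] assms by simp
qed

lemma defect_diff: "defect J (\<lambda>s j k. a s j k - a' s j k) l k = defect J a l k - defect J a' l k"
proof -
  have b: "b (\<lambda>s j k. a s j k - a' s j k) j k = b a j k - b a' j k" for j k
    unfolding b_def sum_subtractf[symmetric] left_diff_distrib[symmetric] by simp
  show ?thesis
    unfolding defect_def b hderiv.iter_diff right_diff_distrib sum_subtractf by simp
qed

text \<open>Pigeonhole in place of linear algebra: over F_p there are more coefficient arrays than
  tuples of remainders of the defects modulo \<open>f\<close>. The difference of two arrays with
  equal remainders has all defects divisible by \<open>f\<close>.\<close>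

lemma auxiliary_exists:
  assumes "M * (d - 1) * (d * (A + J + 2 * d + M * d + 1)) < A * d * (J * d)"
  obtains a where "\<And>i k. i < M \<Longrightarrow> k < d - 1 \<Longrightarrow> f dvd defect J a i k"
    "\<exists>s<A * d. \<exists>j<J. \<exists>k<d. a s j k \<noteq> 0"
proof -
  \<comment> \<open>J from X^j, d from \<open>polar f k\<close>, A + d from \<open>b a j k\<close>,
    and d for each of at most M derivations.\<close>
  define N where "N = A + J + 2 * d + M * d"
  define S where "S = {r :: 'p mod_ring poly poly. (\<forall>k\<ge>d. coeff r k = 0) \<and> totdeg_le N r}"
  have ex: "\<exists>r. f dvd defect J a i k - r \<and> r \<in> S" if "i < M" for a i k
  proof -
    have "totdeg_le (J * 1 + (d + (i * d + (A + d)))) (defect J a i k)"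
      unfolding defect_def
    proof (intro totdeg_le_sum totdeg_le_mult totdeg_le_diff)
      fix j assume "j \<in> {..<J}"
      then show "totdeg_le (J * 1) (X ^ j)" using totdeg_le_power[OF totdeg_le_X, of j] by (auto elim: totdeg_le_mono)
      show "totdeg_le (d + (i * d + (A + d))) ((D ^^ i) (b a j k))"
        by (rule totdeg_le_mono[OF totdeg_le_hderiv_iter[OF totdeg totdeg_le_b]]) simp
      show "totdeg_le d (polar f k)" by (rule totdeg_le_polar[OF totdeg])
      show "totdeg_le (i * d + (A + d)) ((D ^^ i) (b a j (d - 1)))"
        by (rule totdeg_le_hderiv_iter[OF totdeg totdeg_le_b])
    qed
    moreover have "J * 1 + (d + (i * d + (A + d))) \<le> N"
      using that unfolding N_def by (simp add: mult_le_mono1 less_imp_le)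
    ultimately have "totdeg_le N (defect J a i k)" by (rule totdeg_le_mono)
    then obtain u r where "defect J a i k = f * u + r" "\<And>k. d \<le> k \<Longrightarrow> coeff r k = 0" "totdeg_le N r"
      using monic_division_totdeg[OF monic totdeg] by blast
    then show ?thesis unfolding S_def by (intro exI[of _ r]) simp
  qed
  define red where "red a i k = (SOME r. f dvd defect J a i k - r \<and> r \<in> S)" for a i k
  have red: "f dvd defect J a i k - red a i k" "red a i k \<in> S" if "i < M" for a i k
    using someI_ex[OF ex[OF that, of a k]] unfolding red_def by blast+
  define P where "P = {..<A * d} \<times> {..<J} \<times> {..<d}"
  define C where "C = {..<M} \<times> {..<d - 1}"
  define F where "F = P \<rightarrow>\<^sub>E (UNIV :: 'p mod_ring set)"
  define \<rho> where "\<rho> \<alpha> = restrict (\<lambda>(i, k). red (\<lambda>s j k. \<alpha> (s, j, k)) i k) C" for \<alpha> :: "nat \<times> nat \<times> nat \<Rightarrow> 'p mod_ring"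
  have finS: "finite S" and cardS: "card S \<le> q ^ (d * Suc N)"
    using card_small_polys[where 'a = "'p mod_ring", of d N] unfolding S_def q_def by simp_all
  have "\<rho> ` F \<subseteq> C \<rightarrow>\<^sub>E S" using red(2) unfolding \<rho>_def C_def by (auto split: if_splits)
  then have "card (\<rho> ` F) \<le> card (C \<rightarrow>\<^sub>E S)" using finS by (intro card_mono finite_PiE) (auto simp: C_def)
  also have "\<dots> = card S ^ (M * (d - 1))" by (simp add: card_PiE C_def)
  also have "\<dots> \<le> (q ^ (d * Suc N)) ^ (M * (d - 1))" using cardS by (rule power_mono) simp
  also have "\<dots> = q ^ (M * (d - 1) * (d * Suc N))" by (simp add: mult.commute flip: power_mult)
  also have "\<dots> < q ^ (A * d * (J * d))"
    using assms q_gt_1 unfolding N_def by (intro power_strict_increasing) (simp_all add: algebra_simps)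
  also have "\<dots> = card F" unfolding F_def P_def by (simp add: card_PiE q_def)
  finally have "\<not> inj_on \<rho> F" by (rule pigeonhole)
  then obtain \<alpha> \<beta> where ab: "\<alpha> \<in> F" "\<beta> \<in> F" "\<alpha> \<noteq> \<beta>" "\<rho> \<alpha> = \<rho> \<beta>" unfolding inj_on_def by blast
  define a where "a s j k = \<alpha> (s, j, k) - \<beta> (s, j, k)" for s j k
  obtain x where x: "\<alpha> x \<noteq> \<beta> x" using ab(3) by blast
  then have "x \<in> P" using ab(1,2) unfolding F_def by (metis PiE_arb)
  then have "\<exists>s<A * d. \<exists>j<J. \<exists>k<d. a s j k \<noteq> 0" using x unfolding P_def a_def by auto
  moreover have "f dvd defect J a i k" if "i < M" "k < d - 1" for i k
  proof -
    have e: "red (\<lambda>s j k. \<alpha> (s, j, k)) i k = red (\<lambda>s j k. \<beta> (s, j, k)) i k"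
      using fun_cong[OF ab(4), of "(i, k)"] that by (simp add: \<rho>_def C_def)
    have "defect J a i k = (defect J (\<lambda>s j k. \<alpha> (s, j, k)) i k - red (\<lambda>s j k. \<alpha> (s, j, k)) i k)
        - (defect J (\<lambda>s j k. \<beta> (s, j, k)) i k - red (\<lambda>s j k. \<beta> (s, j, k)) i k)"
      unfolding a_def defect_diff e by simp
    then show ?thesis using red(1)[OF that(1)] by (simp only: dvd_diff)
  qed
  ultimately show ?thesis using that by blast
qed

end

text \<open>The terms proportional to A in the parameter count ask for J d > M (d - 1), the degree
  comparison for M = J + d + 1. These values give J d - M (d - 1) = d, and \<open>stepanov_A\<close>
  is large enough to outweigh the terms without A.\<close>

definition stepanov_M :: "nat \<Rightarrow> nat" where "stepanov_M d = d * (d + 2)"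

definition stepanov_J :: "nat \<Rightarrow> nat" where "stepanov_J d = (d - 1) * (d + 2) + 1"

definition stepanov_A :: "nat \<Rightarrow> nat" where
  "stepanov_A d = stepanov_M d * (d - 1) * (stepanov_J d + 2 * d + stepanov_M d * d + 1) + 1"

lemma (in stepanov) contradiction:
  assumes A: "A = stepanov_A d"
    and q: "stepanov_M d + \<Sum>{..stepanov_M d} * (degree \<Omega> + d) + (A + d) < CARD('p)"
  shows False
proof -
  let ?M = "stepanov_M d" and ?J = "stepanov_J d"
  obtain e where e: "d = Suc e" using degree_pos by (metis Suc_pred)
  have M: "?M = ?J + d + 1" unfolding stepanov_M_def stepanov_J_def e by simp
  have J: "?J * d = ?M * (d - 1) + d" unfolding stepanov_M_def stepanov_J_def e by (simp add: algebra_simps)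
  have "?M * (d - 1) * (?J + 2 * d + ?M * d + 1) < A * d"
    unfolding A stepanov_A_def e by simp
  then have "?M * (d - 1) * (A + ?J + 2 * d + ?M * d + 1) < A * (?J * d)"
    unfolding J by (simp add: algebra_simps)
  then have "d * (?M * (d - 1) * (A + ?J + 2 * d + ?M * d + 1)) < d * (A * (?J * d))"
    using degree_pos by simp
  then have "?M * (d - 1) * (d * (A + ?J + 2 * d + ?M * d + 1)) < A * d * (?J * d)"
    by (simp only: ac_simps)
  then obtain a where a: "\<And>i k. i < ?M \<Longrightarrow> k < d - 1 \<Longrightarrow> f dvd defect ?J a i k"
    "\<exists>s<A * d. \<exists>j<?J. \<exists>k<d. a s j k \<noteq> 0"
    using auxiliary_exists by blast
  have "f dvd \<Phi> ?J a" using q M by (intro f_dvd_\<Phi>[where M = ?M] a(1)) (simp_all add: q_def)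
  then show False using coeffs_zero a(2) by blast
qed

subsection \<open>Smooth points on plane curves modulo large primes\<close>

text \<open>The first summand gives M <= p, the next two serve the degree comparison, and the last
  keeps \<open>\<Omega>\<close> nonzero modulo p.\<close>

definition curve_bound :: "nat \<Rightarrow> int poly \<Rightarrow> nat" where
  "curve_bound d \<Omega> = stepanov_M d + \<Sum>{..stepanov_M d} * (degree \<Omega> + d) + (stepanov_A d + d)
     + nat \<bar>lead_coeff \<Omega>\<bar>"

definition certified_curve :: "int poly poly \<Rightarrow> int poly \<Rightarrow> bool" where
  "certified_curve f \<Omega> \<longleftrightarrow> lead_coeff f = 1 \<and> 0 < degree f \<and> totdeg_le (degree f) f \<and> \<Omega> \<noteq> 0 \<and>
     (\<exists>z z'. [:\<Omega>:] = det (wronski_mat f (stepanov_A (degree f) * degree f)) * pderiv f * z + f * z')"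

definition has_smooth_point :: "int poly poly \<Rightarrow> nat \<Rightarrow> bool" where
  "has_smooth_point f p \<longleftrightarrow> (\<exists>x y. int p dvd eval2 (\<lambda>c. c) x y f \<and> \<not> int p dvd eval2 (\<lambda>c. c) x y (pderiv f))"

lemma eval2_of_int:
  "eval2 (\<lambda>c. c) (of_int x) (of_int y) (bimap of_int q) = (of_int (eval2 (\<lambda>c. c) x y q) :: 'a::idom)"
proof (induction q)
  case (pCons c q)
  have "poly (map_poly of_int c) (of_int x) = (of_int (poly c x) :: 'a)"
    by (induction c) (simp_all add: Polynomial.map_poly_pCons)
  then show ?case using pCons by (simp add: Polynomial.map_poly_pCons eval2_pCons map_poly_idI')
qed simp

text \<open>Wronskians commute with ring homomorphisms and \<open>f\<close> is monic, so the
  certificate and the degree of \<open>f\<close> pass to F_p.\<close>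

lemma smooth_point_mod_ring:
  assumes "certified_curve f \<Omega>" "curve_bound (degree f) \<Omega> < CARD('p::prime_card)"
  shows "has_smooth_point f CARD('p)"
proof (rule ccontr)
  assume no: "\<not> has_smooth_point f CARD('p)"
  let ?h = "of_int :: int \<Rightarrow> 'p mod_ring"
  define g where "g = bimap ?h f"
  define d where "d = degree f"
  note f = assms(1)[unfolded certified_curve_def]
  note ah = idom_hom_map_poly[OF idom_hom_of_int[where 'a = "'p mod_ring"]]
  note b = idom_homD[OF idom_hom_map_poly[OF ah]]
  obtain z z' where cert: "[:\<Omega>:] = det (wronski_mat f (stepanov_A d * d)) * pderiv f * z + f * z'"
    using f unfolding d_def by blast
  have of_int_0: "?h c = 0 \<longleftrightarrow> int CARD('p) dvd c" for c
    by (simp add: of_int_eq_0_iff_char_dvd)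
  have cg: "coeff g (degree f) = 1" unfolding g_def using f by (simp add: coeff_map_poly)
  have deg: "degree g = d"
    using cg degree_map_poly_le[of _ f] unfolding g_def d_def
    by (metis le_antisym le_degree zero_neq_one)
  have pd: "pderiv g = bimap ?h (pderiv f)" unfolding g_def by (rule idom_homD(12)[OF ah, symmetric])
  have "\<not> int CARD('p) dvd lead_coeff \<Omega>"
  proof
    assume "int CARD('p) dvd lead_coeff \<Omega>"
    moreover have "lead_coeff \<Omega> \<noteq> 0" using f by simp
    ultimately have "\<bar>int CARD('p)\<bar> \<le> \<bar>lead_coeff \<Omega>\<bar>" using dvd_imp_le_int by blast
    then show False using assms(2) unfolding curve_bound_def by linarith
  qed
  then have "coeff (map_poly ?h \<Omega>) (degree \<Omega>) \<noteq> 0" by (simp add: coeff_map_poly of_int_0)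
  then have \<Omega>: "map_poly ?h \<Omega> \<noteq> 0" by (metis coeff_0)
  interpret stepanov g "map_poly ?h \<Omega>" "bimap ?h z" "bimap ?h z'" "stepanov_A d"
  proof
    show "lead_coeff g = 1" using cg deg unfolding d_def by simp
    show "0 < degree g" using deg f unfolding d_def by simp
    show "totdeg_le (degree g) g"
      using f deg unfolding d_def g_def totdeg_le_def by (simp add: coeff_map_poly)
    show "map_poly ?h \<Omega> \<noteq> 0" by fact
    have "[:map_poly ?h \<Omega>:] = bimap ?h [:\<Omega>:]" by (simp add: Polynomial.map_poly_pCons)
    also have "\<dots> = bimap ?h (det (wronski_mat f (stepanov_A d * d))) * bimap ?h (pderiv f) * bimap ?h z
        + bimap ?h f * bimap ?h z'" unfolding cert by (simp only: b)
    also have "bimap ?h (det (wronski_mat f (stepanov_A d * d))) = det (wronski_mat g (stepanov_A d * d))"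
      unfolding g_def by (subst wronski_mat_bimap[OF idom_hom_of_int])
        (use deg in \<open>simp_all only: g_def b d_def\<close>)
    finally show "[:map_poly ?h \<Omega>:] = det (wronski_mat g (stepanov_A d * degree g)) * pderiv g * bimap ?h z
        + g * bimap ?h z'" by (simp only: deg pd g_def[symmetric])
  next
    fix x y :: "'p mod_ring"
    assume xy: "eval2 (\<lambda>c. c) x y g = 0"
    obtain i j where ij: "x = ?h i" "y = ?h j" by (metis of_int_of_nat_eq surj_of_nat_mod_ring)
    have "int CARD('p) dvd eval2 (\<lambda>c. c) i j f" using xy unfolding ij g_def eval2_of_int of_int_0 .
    then have "int CARD('p) dvd eval2 (\<lambda>c. c) i j (pderiv f)" using no unfolding has_smooth_point_def by blast
    then show "eval2 (\<lambda>c. c) x y (pderiv g) = 0" unfolding ij pd eval2_of_int of_int_0 .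
  qed
  show False
  proof (rule contradiction)
    show "stepanov_A d = stepanov_A (degree g)" by (simp add: deg)
    have "degree (map_poly ?h \<Omega>) \<le> degree \<Omega>" by (rule degree_map_poly_le)
    then have "\<Sum>{..stepanov_M d} * (degree (map_poly ?h \<Omega>) + d) \<le> \<Sum>{..stepanov_M d} * (degree \<Omega> + d)"
      by simp
    then show "stepanov_M (degree g) + \<Sum>{..stepanov_M (degree g)} * (degree (map_poly ?h \<Omega>) + degree g)
        + (stepanov_A d + degree g) < CARD('p)"
      using assms(2) unfolding deg curve_bound_def d_def[symmetric] by linarith
  qed
qed

text \<open>HOL has no type of cardinality \<open>p\<close> for a variable \<open>p\<close>. It suffices to have one for a single
  prime violating the next lemma, chosen once and for all; \<open>2\<close> is a dummy value if there is none.\<close>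

definition exceptional_prime :: nat where
  "exceptional_prime =
    (if \<exists>p f \<Omega>. prime p \<and> certified_curve f \<Omega> \<and> curve_bound (degree f) \<Omega> < p \<and> \<not> has_smooth_point f p
     then SOME p. \<exists>f \<Omega>. prime p \<and> certified_curve f \<Omega> \<and> curve_bound (degree f) \<Omega> < p \<and> \<not> has_smooth_point f p
     else 2)"

lemma exceptional_prime: "prime exceptional_prime"
  unfolding exceptional_prime_def
  by (auto intro: someI2_ex)

typedef exceptional = "{..<exceptional_prime}"
  using prime_gt_0_nat[OF exceptional_prime] by blast

lemma CARD_exceptional: "CARD(exceptional) = exceptional_prime"
  using type_definition.card[OF type_definition_exceptional] by simp

instance exceptional :: nontriv
  by standard (use prime_gt_1_nat[OF exceptional_prime] in \<open>simp add: CARD_exceptional\<close>)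

instance exceptional :: prime_card
  by standard (simp add: CARD_exceptional exceptional_prime)

lemma certified_curve_smooth_point:
  assumes "prime p" "certified_curve f \<Omega>" "curve_bound (degree f) \<Omega> < p"
  shows "has_smooth_point f p"
proof (rule ccontr)
  let ?P = "\<lambda>p. \<exists>f \<Omega>. prime p \<and> certified_curve f \<Omega> \<and> curve_bound (degree f) \<Omega> < p \<and> \<not> has_smooth_point f p"
  assume "\<not> has_smooth_point f p"
  then have ex: "\<exists>p. ?P p" using assms by blast
  then have "exceptional_prime = (SOME p. ?P p)" unfolding exceptional_prime_def by simp
  then have "?P exceptional_prime" using someI_ex[OF ex] by simp
  then show False
    using smooth_point_mod_ring[where 'p = exceptional] unfolding CARD_exceptional by blast
qed

theorem curve_smooth_point:
  fixes f :: "int poly poly"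
  assumes "lead_coeff f = 1" "0 < degree f" "totdeg_le (degree f) f"
    and "irreducible (bimap of_int f :: complex poly poly)"
    and "eval2 of_int 0 \<theta> f = 0" "eval2 of_int 0 \<theta> (pderiv f) \<noteq> (0 :: complex)"
  obtains M where "\<And>p. prime p \<Longrightarrow> M < p \<Longrightarrow> has_smooth_point f p"
proof -
  have "prime_elem (bimap of_int f :: complex poly poly)"
    using assms(4) by (simp add: prime_elem_iff_irreducible)
  then obtain \<Omega> z z' where "\<Omega> \<noteq> 0"
    "[:\<Omega>:] = det (wronski_mat f (stepanov_A (degree f) * degree f)) * pderiv f * z + f * z'"
    using wronskian_certificate[OF assms(1,2) _ assms(5,6)] by blast
  then have "certified_curve f \<Omega>" using assms unfolding certified_curve_def by blast
  then show ?thesis using that certified_curve_smooth_point by blast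
qed

subsection \<open>Specialising the inner variable\<close>

definition evx :: "'a::idom \<Rightarrow> 'a poly poly \<Rightarrow> 'a poly" where
  "evx x h = map_poly (\<lambda>c. poly c x) h"

lemma idom_hom_poly: "idom_hom (\<lambda>c. poly c (x :: 'a::idom))"
  by unfold_locales auto

lemma idom_hom_evx: "idom_hom (evx x)"
  unfolding evx_def by (intro idom_hom_map_poly idom_hom_poly)

lemmas evx_hom = idom_homD[OF idom_hom_evx]

lemma coeff_evx [simp]: "coeff (evx x h) k = poly (coeff h k) x"
  by (simp add: evx_def coeff_map_poly)

lemma degree_evx_le: "degree (evx x h) \<le> degree h"
  unfolding evx_def by (rule degree_map_poly_le)

lemma degree_evx: "poly (lead_coeff h) x \<noteq> 0 \<Longrightarrow> degree (evx x h) = degree h"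
  by (metis coeff_evx degree_evx_le le_antisym le_degree)

lemma evx_monic:
  assumes "lead_coeff h = 1"
  shows "degree (evx x h) = degree h" "lead_coeff (evx x h) = 1"
  using assms degree_evx[of h x] by simp_all

lemma poly_evx: "poly (evx x h) y = eval2 (\<lambda>c. c) x y h"
  by (simp add: evx_def eval2_def map_poly_idI')

lemma evx_eq_0_iff: "evx x h = 0 \<longleftrightarrow> [:[:- x, 1:]:] dvd h"
  by (simp add: poly_eq_iff const_poly_dvd_iff flip: poly_eq_0_iff_dvd)

lemma evx_0_eq_0_iff: "evx 0 h = 0 \<longleftrightarrow> varX dvd h"
  using evx_eq_0_iff[of 0 h] by (simp add: varX_def)

lemma evx_pderiv: "pderiv (evx x h) = evx x (pderiv h)"
  unfolding evx_def by (rule idom_homD(12)[OF idom_hom_poly, symmetric])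

definition lift_const :: "'a::idom poly \<Rightarrow> 'a poly poly" where
  "lift_const p = map_poly (\<lambda>c. [:c:]) p"

lemma coeff_lift_const [simp]: "coeff (lift_const p) k = [:coeff p k:]"
  by (simp add: lift_const_def coeff_map_poly)

lemma evx_lift_const [simp]: "evx x (lift_const p) = p"
  by (rule poly_eqI) simp

lemma evx_varX [simp]: "evx x varX = [:x:]"
  by (rule poly_eqI) (simp add: varX_def coeff_pCons split: nat.splits)

lemma varX_nz [simp]: "varX \<noteq> (0 :: 'a::idom poly poly)"
  by (simp add: varX_def)

lemma varX_power: "varX ^ n = ([:monom 1 n:] :: 'a::idom poly poly)"
  by (induction n) (simp_all add: varX_def monom_Suc one_pCons)

lemma coeff_varX_power_mult: "coeff (varX ^ n * h) k = monom 1 n * coeff (h :: 'a::idom poly poly) k"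
  by (simp add: varX_power)

lemma varX_power_dvd_small:
  fixes h :: "'a::idom poly poly"
  assumes "varX ^ n dvd h" "\<And>k. degree (coeff h k) < n"
  shows "h = 0"
proof (rule poly_eqI)
  fix k
  obtain h' where "h = varX ^ n * h'" using assms(1) by (auto simp: dvd_def)
  then have "coeff h k = monom 1 n * coeff h' k" by (simp add: coeff_varX_power_mult)
  then show "coeff h k = coeff 0 k"
    using assms(2)[of k] by (cases "coeff h' k = 0") (auto simp: degree_mult_eq degree_monom_eq)
qed

subsection \<open>Hensel lifting along a line\<close>

text \<open>If the differences are x^m d1 and x^m d2, then g d2 + h d1 vanishes at x = 0. As g and h
  are comaximal, g divides d1 at x = 0, which has smaller degree and so vanishes; likewise d2. Thus
  m can be raised.\<close>

lemma hensel_unique: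
  fixes G H G' H' :: "'a::idom poly poly"
  assumes monic: "lead_coeff G = 1" "lead_coeff H = 1" "lead_coeff G' = 1" "lead_coeff H' = 1"
    and deg: "degree G = degree G'" "degree H = degree H'"
    and at0: "evx 0 G = g" "evx 0 H = h" "evx 0 G' = g" "evx 0 H' = h" "u * g + v * h = 1"
    and dvd: "varX ^ Suc N dvd G * H - G' * H'"
  shows "varX ^ Suc N dvd G - G'"
proof -
  have gh: "degree g = degree G" "lead_coeff g = 1" "degree h = degree H" "lead_coeff h = 1"
    using evx_monic[OF monic(1), of 0] evx_monic[OF monic(2), of 0] unfolding at0 by simp_all
  have small: "p = 0" if "q dvd r * p" "s * q + w * r = 1" "lead_coeff q = 1" "\<And>k. degree q \<le> k \<Longrightarrow> coeff p k = 0"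
    for p q r s w :: "'a poly"
  proof -
    have "p = q * (s * p) + w * (r * p)"
      using arg_cong[OF that(2), of "\<lambda>t. t * p"] by (simp add: algebra_simps)
    then have "q dvd p" using that(1) by (metis dvd_add dvd_mult dvd_triv_left)
    then show ?thesis using that(3,4) by (intro monic_dvd_small[of q p]) auto
  qed
  have "varX ^ m dvd G - G' \<and> varX ^ m dvd H - H'" if "m \<le> Suc N" for m
    using that
  proof (induction m)
    case (Suc m)
    obtain d1 where d1: "G - G' = varX ^ m * d1" using Suc by (auto simp: dvd_def)
    obtain d2 where d2: "H - H' = varX ^ m * d2" using Suc by (auto simp: dvd_def)
    have "G * H - G' * H' = G * (H - H') + (G - G') * H'" by (simp add: algebra_simps)
    also have "\<dots> = varX ^ m * (G * d2 + d1 * H')" unfolding d1 d2 by (simp add: algebra_simps)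
    finally have "varX ^ m * varX dvd varX ^ m * (G * d2 + d1 * H')"
      using dvd Suc.prems by (metis dvd_trans le_imp_power_dvd power_Suc2)
    then have "varX dvd G * d2 + d1 * H'" by simp
    then have e: "g * evx 0 d2 + evx 0 d1 * h = 0" using at0 by (simp add: evx_hom flip: evx_0_eq_0_iff)
    have c1: "coeff d1 k = 0" if "degree G \<le> k" for k
    proof -
      have "coeff (G - G') k = 0" using that monic deg by (cases "k = degree G") (auto simp: coeff_eq_0)
      then show ?thesis unfolding d1 coeff_varX_power_mult by simp
    qed
    have c2: "coeff d2 k = 0" if "degree H \<le> k" for k
    proof -
      have "coeff (H - H') k = 0" using that monic deg by (cases "k = degree H") (auto simp: coeff_eq_0)
      then show ?thesis unfolding d2 coeff_varX_power_mult by simp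
    qed
    have "h * evx 0 d1 = g * (- evx 0 d2)" using e by (simp add: algebra_simps eq_neg_iff_add_eq_0)
    then have "g dvd h * evx 0 d1" by (rule dvdI)
    then have "evx 0 d1 = 0" using small[of g h "evx 0 d1" u v] at0(5) gh c1 by simp
    moreover have "g * evx 0 d2 = h * (- evx 0 d1)" using e by (simp add: algebra_simps eq_neg_iff_add_eq_0)
    then have "h dvd g * evx 0 d2" by (rule dvdI)
    then have "evx 0 d2 = 0" using small[of h g "evx 0 d2" v u] at0(5) gh c2 by (simp add: add.commute)
    ultimately have "varX dvd d1" "varX dvd d2" by (simp_all add: evx_0_eq_0_iff)
    then show ?case unfolding d1 d2 power_Suc2 by (simp add: mult_dvd_mono)
  qed simp
  then show ?thesis by blast
qed

text \<open>The coefficient ring is only a domain, because it will be C[s] with s the parameter of a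
  pencil. Hence comaximality is given by a Bezout identity and all divisions are by monic
  polynomials.\<close>

lemma hensel_exists:
  fixes F :: "'a::idom poly poly"
  assumes F: "lead_coeff F = 1" "evx 0 F = g * h" and gh: "lead_coeff g = 1" "lead_coeff h = 1"
    and cop: "u * g + v * h = 1"
  shows "\<exists>G H. varX ^ Suc N dvd F - G * H \<and> lead_coeff G = 1 \<and> lead_coeff H = 1 \<and> degree G = degree g \<and>
    degree H = degree h \<and> evx 0 G = g \<and> evx 0 H = h \<and> (\<forall>k. degree (coeff G k) \<le> N \<and> degree (coeff H k) \<le> N)"
proof -
  have nz: "g \<noteq> 0" "h \<noteq> 0" using gh by auto
  have dF: "degree F = degree g + degree h"
    using evx_monic(1)[OF F(1), of 0] F(2) nz by (simp add: degree_mult_eq)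
  show ?thesis
  proof (induction N)
    case 0
    have lg: "lead_coeff (lift_const q) = 1 \<and> degree (lift_const q) = degree q" if "lead_coeff q = 1" for q :: "'a poly"
    proof -
      have "degree (lift_const q) \<le> degree q" unfolding lift_const_def by (rule degree_map_poly_le)
      moreover have "coeff (lift_const q) (degree q) = 1" using that by (simp add: one_pCons)
      ultimately show ?thesis by (metis le_antisym le_degree zero_neq_one)
    qed
    have "evx 0 (F - lift_const g * lift_const h) = 0" using F(2) by (simp add: evx_hom)
    then have "varX ^ Suc 0 dvd F - lift_const g * lift_const h" by (simp add: evx_0_eq_0_iff)
    moreover have "\<forall>k. degree (coeff (lift_const g) k) \<le> 0 \<and> degree (coeff (lift_const h) k) \<le> 0" by simp
    ultimately show ?case using lg[OF gh(1)] lg[OF gh(2)] evx_lift_const by blast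
  next
    case (Suc N)
    then obtain G H where GH: "varX ^ Suc N dvd F - G * H" "lead_coeff G = 1" "lead_coeff H = 1"
      "degree G = degree g" "degree H = degree h" "evx 0 G = g" "evx 0 H = h" "\<And>k. degree (coeff G k) \<le> N" "\<And>k. degree (coeff H k) \<le> N"
      by blast
    define m where "m = Suc N"
    obtain E where E: "F - G * H = varX ^ m * E" using GH(1) unfolding m_def by (auto simp: dvd_def)
    define E0 where "E0 = evx 0 E"
    have nzGH: "G \<noteq> 0" "H \<noteq> 0" using GH(2,3) by auto
    have cE: "coeff E0 k = 0" if "degree g + degree h \<le> k" for k
    proof -
      have dGH: "degree (G * H) = degree g + degree h" using nzGH GH(4,5) by (simp add: degree_mult_eq)
      have "lead_coeff (G * H) = 1" using GH(2,3) by (simp add: lead_coeff_mult)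
      then have "coeff (F - G * H) k = 0"
        using that F(1) dF dGH by (cases "k = degree g + degree h") (auto simp: coeff_eq_0)
      then have "coeff E k = 0" unfolding E coeff_varX_power_mult by simp
      then show ?thesis by (simp add: E0_def)
    qed
    \<comment> \<open>The correction has to solve g d2 + h d1 = E0 with degrees below those of g and
      h, so that the lifts stay monic. Dividing v E0 by g bounds d1; comparing degrees then bounds
      d2.\<close>
    obtain q d1 where d1: "v * E0 = g * q + d1" "\<And>k. degree g \<le> k \<Longrightarrow> coeff d1 k = 0"
      using monic_division[OF gh(1)] by blast
    define d2 where "d2 = u * E0 + h * q"
    have "E0 = u * g * E0 + h * (v * E0)"
      using arg_cong[OF cop, of "\<lambda>t. t * E0"] by (simp add: algebra_simps)
    also have "\<dots> = g * d2 + h * d1" unfolding d1(1) d2_def by (simp add: algebra_simps)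
    finally have sol: "g * d2 + h * d1 = E0" ..
    have d2: "coeff d2 k = 0" if "degree h \<le> k" for k
    proof (rule ccontr)
      assume "coeff d2 k \<noteq> 0"
      then have "d2 \<noteq> 0" "degree h \<le> degree d2" using that by (auto intro: le_degree order_trans)
      then have dg: "degree (g * d2) = degree g + degree d2" "degree g + degree h \<le> degree g + degree d2"
        using nz by (simp_all add: degree_mult_eq)
      have "coeff (h * d1) (degree g + degree d2) = 0"
      proof (cases "d1 = 0")
        case False
        then have "degree d1 < degree g" using d1(2) by (meson leading_coeff_0_iff not_le)
        then have "degree (h * d1) < degree g + degree d2"
          using False nz dg by (simp add: degree_mult_eq)
        then show ?thesis by (rule coeff_eq_0)
      qed simp
      then have "coeff E0 (degree g + degree d2) = lead_coeff (g * d2)" unfolding sol[symmetric] coeff_add dg(1) by simp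
      also have "\<dots> \<noteq> 0" using nz \<open>d2 \<noteq> 0\<close> by simp
      finally show False using cE dg(2) by blast
    qed
    define G' where "G' = G + varX ^ m * lift_const d1"
    define H' where "H' = H + varX ^ m * lift_const d2"
    have monic': "lead_coeff (P + varX ^ m * lift_const r) = 1 \<and> degree (P + varX ^ m * lift_const r) = degree P"
      if "lead_coeff P = 1" "\<And>k. degree P \<le> k \<Longrightarrow> coeff r k = 0" for P :: "'a poly poly" and r
    proof -
      let ?S = "P + varX ^ m * lift_const r"
      have c: "coeff ?S k = coeff P k" if "degree P \<le> k" for k
        using that \<open>\<And>k. degree P \<le> k \<Longrightarrow> coeff r k = 0\<close> by (simp add: coeff_varX_power_mult)
      then have "degree ?S \<le> degree P" by (intro degree_le) (simp add: coeff_eq_0)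
      moreover have "coeff ?S (degree P) = 1" using c that(1) by simp
      ultimately show ?thesis by (metis le_antisym le_degree zero_neq_one)
    qed
    have m0: "m > 0" by (simp add: m_def)
    have "F - G' * H' = varX ^ m * (E - G * lift_const d2 - H * lift_const d1 - varX ^ m * (lift_const d1 * lift_const d2))"
    proof -
      have "F - G' * H' = (F - G * H) - varX ^ m * (G * lift_const d2 + H * lift_const d1 + varX ^ m * (lift_const d1 * lift_const d2))"
        unfolding G'_def H'_def by (simp add: algebra_simps)
      then show ?thesis unfolding E by (simp add: algebra_simps)
    qed
    moreover have "evx 0 (E - G * lift_const d2 - H * lift_const d1 - varX ^ m * (lift_const d1 * lift_const d2)) = 0"
      using sol GH(6,7) by (simp add: evx_hom E0_def[symmetric] zero_power[OF m0] algebra_simps)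
    ultimately have "varX ^ m * varX dvd F - G' * H'" unfolding evx_0_eq_0_iff by simp
    then have "varX ^ Suc (Suc N) dvd F - G' * H'" unfolding m_def by (simp only: power_Suc2)
    moreover have "evx 0 G' = g" "evx 0 H' = h" using GH(6,7) m0 by (simp_all add: G'_def H'_def evx_hom)
    moreover have xdeg: "degree (coeff (P + varX ^ m * lift_const r) k) \<le> Suc N"
      if "degree (coeff P k) \<le> N" for P :: "'a poly poly" and r k
      unfolding coeff_add coeff_varX_power_mult coeff_lift_const
    proof (rule degree_add_le)
      show "degree (coeff P k) \<le> Suc N" using that by simp
      show "degree (monom 1 m * [:coeff r k:]) \<le> Suc N"
        using degree_mult_le[of "monom 1 m" "[:coeff r k:]"] degree_monom_le[of "1 :: 'a" m] by (simp add: m_def)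
    qed
    have "\<forall>k. degree (coeff G' k) \<le> Suc N \<and> degree (coeff H' k) \<le> Suc N"
      unfolding G'_def H'_def using xdeg GH(8,9) by blast
    moreover have "lead_coeff G' = 1 \<and> degree G' = degree G"
      unfolding G'_def by (rule monic'[OF GH(2)]) (simp only: d1(2) GH(4))
    moreover have "lead_coeff H' = 1 \<and> degree H' = degree H"
      unfolding H'_def by (rule monic'[OF GH(3)]) (simp only: d2 GH(5))
    ultimately show ?case using GH(4,5) by metis
  qed
qed

text \<open>In \<open>complex poly poly poly\<close> the innermost variable is the parameter s of a
  pencil of planes, followed by x and Y.\<close>

abbreviation spec :: "complex \<Rightarrow> complex poly poly poly \<Rightarrow> complex poly poly" where
  "spec s \<equiv> bimap (\<lambda>c. poly c s)"

lemma idom_hom_spec: "idom_hom (spec s)"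
  by (intro idom_hom_map_poly idom_hom_poly)

lemmas spec_hom = idom_homD[OF idom_hom_spec]

lemma spec_monic:
  assumes "lead_coeff F = 1"
  shows "degree (spec s F) = degree F" "lead_coeff (spec s F) = 1"
proof -
  have "coeff (spec s F) (degree F) = 1" using assms by (simp add: coeff_map_poly)
  moreover have "degree (spec s F) \<le> degree F" by (rule degree_map_poly_le)
  ultimately show "degree (spec s F) = degree F" by (metis le_antisym le_degree zero_neq_one)
  then show "lead_coeff (spec s F) = 1" using \<open>coeff (spec s F) (degree F) = 1\<close> by simp
qed

lemma evx_spec: "evx 0 (spec s F) = map_poly (\<lambda>c. poly c s) (evx 0 F)"
proof (rule poly_eqI)
  fix k
  have "poly (map_poly (\<lambda>c. poly c s) q) 0 = poly (poly q 0) s" for q :: "complex poly poly"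
    by (induction q) (simp_all add: Polynomial.map_poly_pCons)
  then show "coeff (evx 0 (spec s F)) k = coeff (map_poly (\<lambda>c. poly c s) (evx 0 F)) k"
    by (simp add: coeff_map_poly)
qed

lemma infinite_spec_zero:
  assumes "infinite {s. spec s F = 0}"
  shows "F = 0"
proof (rule poly_eqI, rule poly_eqI)
  fix k j
  have "{s. spec s F = 0} \<subseteq> {s. poly (coeff (coeff F k) j) s = 0}"
    by (auto simp: poly_eq_iff coeff_map_poly)
  then have "infinite {s. poly (coeff (coeff F k) j) s = 0}" using assms finite_subset by blast
  then show "coeff (coeff F k) j = coeff (coeff 0 k) j" using poly_roots_finite by auto
qed

text \<open>Take a Hensel lift G H over C[s], truncated to degree N in x. For s in S, uniqueness
  identifies its specialisation with the given factors, which also have degree at most N in x. So F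
  - G H vanishes for infinitely many s, hence identically.\<close>

lemma factor_along_line:
  fixes F :: "complex poly poly poly"
  assumes F: "lead_coeff F = 1" "evx 0 F = lift_const (g * h)"
    and gh: "lead_coeff g = 1" "lead_coeff h = 1" "u * g + v * h = 1"
    and inf: "infinite S"
    and fac: "\<And>s. s \<in> S \<Longrightarrow> \<exists>G H. spec s F = G * H \<and> lead_coeff G = 1 \<and> lead_coeff H = 1 \<and>
        evx 0 G = g \<and> evx 0 H = h \<and> (\<forall>k. degree (coeff G k) \<le> N \<and> degree (coeff H k) \<le> N)"
  obtains G H where "F = G * H" "lead_coeff G = 1" "evx 0 G = lift_const g"
proof -
  have lc: "idom_hom (lift_const :: complex poly \<Rightarrow> _)"
    unfolding lift_const_def by (intro idom_hom_map_poly) (unfold_locales, auto simp: one_pCons)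
  note lch = idom_homD[OF lc]
  have lm: "lead_coeff (lift_const q) = 1 \<and> degree (lift_const q) = degree q" if "lead_coeff q = 1" for q :: "complex poly"
  proof -
    have "degree (lift_const q) \<le> degree q" unfolding lift_const_def by (rule degree_map_poly_le)
    moreover have "coeff (lift_const q) (degree q) = 1" using that by (simp add: one_pCons)
    ultimately show ?thesis by (metis le_antisym le_degree zero_neq_one)
  qed
  have "lift_const u * lift_const g + lift_const v * lift_const h = 1"
    using arg_cong[OF gh(3), of lift_const] by (simp only: lch)
  then obtain G H where GH: "varX ^ Suc N dvd F - G * H" "lead_coeff G = 1" "lead_coeff H = 1"
    "degree G = degree (lift_const g)" "degree H = degree (lift_const h)"
    "evx 0 G = lift_const g" "evx 0 H = lift_const h" "\<And>k. degree (coeff G k) \<le> N" "\<And>k. degree (coeff H k) \<le> N"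
    using hensel_exists[OF F(1), of "lift_const g" "lift_const h" _ _ N] F(2) lm gh(1,2) by (metis lch(6))
  have sl: "map_poly (\<lambda>c. poly c s) (lift_const q) = q" for s and q :: "complex poly"
    by (rule poly_eqI) (simp add: coeff_map_poly)
  obtain Q where Q: "F - G * H = varX ^ Suc N * Q" using GH(1) by (auto simp: dvd_def)
  have sX: "spec s varX = varX" for s by (simp add: varX_def Polynomial.map_poly_pCons)
  have "spec s (F - G * H) = 0" if s: "s \<in> S" for s
  proof -
    obtain G' H' where GH': "spec s F = G' * H'" "lead_coeff G' = 1" "lead_coeff H' = 1"
        "evx 0 G' = g" "evx 0 H' = h" "\<And>k. degree (coeff G' k) \<le> N" "\<And>k. degree (coeff H' k) \<le> N"
      using fac[OF s] by blast
    have e: "evx 0 (spec s G) = g" "evx 0 (spec s H) = h" by (simp_all add: evx_spec GH(6,7) sl)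
    have dg: "degree (spec s G) = degree G'" "degree (spec s H) = degree H'"
      using spec_monic[OF GH(2), of s] spec_monic[OF GH(3), of s] e GH'(2-5) evx_monic(1) by metis+
    have dvd: "varX ^ Suc N dvd G' * H' - spec s G * spec s H"
      using arg_cong[OF Q, of "spec s"] by (simp only: spec_hom sX GH'(1)) simp
    have dvd': "varX ^ Suc N dvd spec s G * spec s H - G' * H'" using dvd by (rule dvd_diff_swap)
    have "varX ^ Suc N dvd spec s G - G'"
      by (rule hensel_unique[OF _ _ GH'(2,3) dg e GH'(4,5) gh(3) dvd']) (rule spec_monic GH)+
    moreover have "varX ^ Suc N dvd spec s H - H'"
    proof (rule hensel_unique[OF spec_monic(2)[OF GH(3)] spec_monic(2)[OF GH(2)] GH'(3,2) dg(2,1) e(2,1) GH'(5,4)])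
      show "v * h + u * g = 1" using gh(3) by (simp only: add.commute)
      show "varX ^ Suc N dvd spec s H * spec s G - H' * G'" using dvd' by (simp only: mult.commute)
    qed
    moreover have "degree (coeff (spec s P - P') k) < Suc N"
      if "degree (coeff P k) \<le> N" "degree (coeff P' k) \<le> N" for P P' k
    proof -
      have "degree (map_poly (\<lambda>c. poly c s) (coeff P k)) \<le> degree (coeff P k)" by (rule degree_map_poly_le)
      then have "degree (coeff (spec s P) k) \<le> N" using that(1) by (simp add: coeff_map_poly)
      then show ?thesis using that(2) by (simp add: degree_diff_le less_Suc_eq_le)
    qed
    ultimately have "spec s G - G' = 0" "spec s H - H' = 0"
      using GH(8,9) GH'(6,7) varX_power_dvd_small by metis+
    then have sG: "spec s G = G'" "spec s H = H'" by simp_all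
    then show ?thesis using GH'(1) sG by (simp add: spec_hom algebra_simps)
  qed
  then have "S \<subseteq> {s. spec s (F - G * H) = 0}" by blast
  then have "F - G * H = 0" using inf finite_subset infinite_spec_zero by blast
  then show ?thesis using that[of G H] GH(2,6) by simp
qed

subsection \<open>Persistent multiple roots\<close>

lemma dvd_monic_lead_unit:
  fixes c f :: "'a::idom poly"
  assumes "c dvd f" "lead_coeff f = 1"
  shows "lead_coeff c dvd 1"
  using assms by (metis dvd_def dvd_triv_left lead_coeff_mult)

lemma evx_nz: "lead_coeff h = 1 \<Longrightarrow> evx x h \<noteq> 0"
  using evx_monic(2)[of h x] by (metis coeff_0 zero_neq_one)

text \<open>R is a monic divisor of least degree with q | R^N. Minimality makes it squarefree, since
  a repeated factor could be dropped, and in characteristic zero this excludes the zero divisor case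
  of \<open>monic_norm\<close> for R and its derivative.\<close>

lemma separable_radical:
  fixes q :: "complex poly poly"
  assumes q: "lead_coeff q = 1"
  obtains R N \<Omega> z z' where "lead_coeff R = 1" "R dvd q" "q dvd R ^ N" "\<Omega> \<noteq> 0" "[:\<Omega>:] = pderiv R * z + R * z'"
proof -
  define P where "P R \<longleftrightarrow> lead_coeff R = 1 \<and> R dvd q \<and> (\<exists>N. q dvd R ^ N)" for R
  have "P q" unfolding P_def using q by (auto intro: exI[of _ 1])
  then obtain R where R: "P R" and min: "\<And>R'. P R' \<Longrightarrow> degree R \<le> degree R'"
    using ex_has_least_nat[of P q degree] by blast
  obtain N where RN: "lead_coeff R = 1" "R dvd q" "q dvd R ^ N" using R unfolding P_def by blast
  have nz: "R \<noteq> 0" using RN by auto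
  have sq: "squarefree R"
  proof (rule squarefreeI)
    fix x assume "x ^ 2 dvd R"
    then obtain y where y: "R = x * (x * y)" by (auto simp: power2_eq_square dvd_def mult.assoc)
    define a where "a = lead_coeff x"
    define b where "b = lead_coeff (x * y)"
    have ab: "a * b = 1" using RN(1) unfolding y lead_coeff_mult[of x "x * y"] a_def b_def .
    define R1 where "R1 = [:a:] * (x * y)"
    have "lead_coeff R1 = lead_coeff [:a:] * b" unfolding R1_def b_def by (rule lead_coeff_mult)
    then have "lead_coeff R1 = 1" using ab by simp
    moreover have u: "[:b:] * R1 = x * y"
    proof -
      have "[:b:] * [:a:] = (1 :: complex poly poly)" using ab by (simp add: one_pCons mult.commute)
      moreover have "[:b:] * R1 = ([:b:] * [:a:]) * (x * y)" unfolding R1_def by (simp only: mult.assoc)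
      ultimately show ?thesis by simp
    qed
    have "R = x * ([:b:] * R1)" unfolding u by (rule y)
    then have "R = R1 * ([:b:] * x)" by (simp only: ac_simps)
    then have "R1 dvd R" by (rule dvdI)
    moreover have "q dvd R1 ^ (2 * N)"
    proof -
      have "(x * y) * (x * y) = R * y" unfolding y by (simp add: ac_simps)
      then have "R dvd (x * y) * (x * y)" by (rule dvdI)
      moreover have "[:a:] * [:a:] * ((x * y) * (x * y)) = R1 ^ 2"
        unfolding R1_def power2_eq_square by (simp only: ac_simps)
      ultimately have "R dvd R1 ^ 2" by (metis dvd_mult)
      then have "R ^ N dvd (R1 ^ 2) ^ N" by (rule dvd_power_same)
      then show ?thesis using RN(3) by (metis dvd_trans power_mult)
    qed
    ultimately have "P R1" using RN(2) unfolding P_def by (meson dvd_trans)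
    then have "degree R \<le> degree R1" by (rule min)
    moreover have "R1 \<noteq> 0" "x \<noteq> 0" "x * y \<noteq> 0" using \<open>lead_coeff R1 = 1\<close> nz y by auto
    moreover have "degree R1 = degree (x * y)" unfolding u[symmetric] using ab by auto
    ultimately have "degree x = 0" unfolding y by (simp add: degree_mult_eq)
    then show "x dvd 1" using monic_dvd_unit[OF _ RN(1), of x] y by simp
  qed
  from RN(1) show ?thesis
  proof (cases rule: monic_norm[of R "pderiv R"])
    case (zero_divisor v)
    have "R dvd v"
    proof (rule squarefree_dvdI[OF sq])
      fix p :: "complex poly poly" assume p: "prime p" "p dvd R"
      obtain r where r: "R = p * r" using p(2) by (auto simp: dvd_def)
      have "p dvd v * pderiv R" using p(2) zero_divisor(3) by (rule dvd_trans)
      moreover have "\<not> p dvd pderiv R"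
      proof
        assume "p dvd pderiv R"
        then have "p dvd pderiv p * r" unfolding r
          by (simp add: pderiv_mult) (metis dvd_add_right_iff dvd_triv_left mult.commute)
        moreover have "\<not> p dvd r"
        proof
          assume "p dvd r"
          then have "p ^ 2 dvd R" unfolding r power2_eq_square by (intro mult_dvd_mono) auto
          then have "p dvd 1" using sq squarefreeD by blast
          then show False using p(1) by (simp add: prime_def prime_elem_def)
        qed
        moreover have "degree p \<noteq> 0" using monic_dvd_unit[OF p(2) RN(1)] p(1)
          by (auto simp: prime_def prime_elem_def)
        then have "pderiv p \<noteq> 0" "degree (pderiv p) < degree p" by (auto simp: pderiv_eq_0_iff degree_pderiv)
        then have "\<not> p dvd pderiv p" using dvd_imp_degree_le by force
        ultimately show False using p(1) by (simp add: prime_dvd_mult_iff)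
      qed
      ultimately show "p dvd v" using p(1) by (simp add: prime_dvd_mult_iff)
    qed
    then have "v = 0" using monic_dvd_small[OF _ nz zero_divisor(2)] by blast
    then show ?thesis using zero_divisor(1) by simp
  next
    case (norm \<Omega> z z')
    then show ?thesis using that RN by blast
  qed
qed

text \<open>Let R be the radical of q. A general fibre has \<open>degree R\<close> distinct roots;
  so then does the fibre at 0, and R(0, Y) has simple roots only. Writing q = R h, a multiple root
  of q(0, Y) is a zero of both factors, so q vanishes there to second order.\<close>

lemma persistent_multiple_root:
  fixes q :: "complex poly poly"
  assumes q: "lead_coeff q = 1"
    and inf: "infinite {s. card {y. poly (evx s q) y = 0} \<le> card {y. poly (evx 0 q) y = 0}}"
    and y0: "poly (evx 0 q) y0 = 0" "poly (pderiv (evx 0 q)) y0 = 0"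
  shows "eval2 (\<lambda>c. c) 0 y0 (xderiv q) = 0"
proof -
  obtain R N \<Omega> z z' where R: "lead_coeff R = 1" "R dvd q" "q dvd R ^ N"
    and \<Omega>: "\<Omega> \<noteq> 0" "[:\<Omega>:] = pderiv R * z + R * z'"
    by (rule separable_radical[OF q])
  have roots: "{y. poly (evx s q) y = 0} = {y. poly (evx s R) y = 0}" for s
  proof -
    have "evx s R dvd evx s q" "evx s q dvd evx s R ^ N"
      using evx_hom(10)[OF R(2)] evx_hom(10)[OF R(3)] by (simp_all add: evx_hom)
    then show ?thesis
      by (auto simp: dvd_def poly_power) (metis mult_eq_0_iff poly_mult poly_power power_eq_0_iff)
  qed
  have nzR: "evx s R \<noteq> 0" "degree (evx s R) = degree R" for s
    using evx_monic(1)[OF R(1), of s] evx_nz[OF R(1), of s] by simp_all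
  have gen: "card {y. poly (evx s R) y = 0} = degree R" if "poly \<Omega> s \<noteq> 0" for s
  proof -
    have "evx s [:\<Omega>:] = pderiv (evx s R) * evx s z + evx s R * evx s z'"
      unfolding \<Omega>(2) by (simp add: evx_hom evx_pderiv)
    then have "\<not> (poly (evx s R) a = 0 \<and> poly (pderiv (evx s R)) a = 0)" for a
    proof -
      have "poly (evx s [:\<Omega>:]) a = poly \<Omega> s" by (simp add: evx_def Polynomial.map_poly_pCons)
      then show ?thesis using that \<open>evx s [:\<Omega>:] = _\<close> by auto
    qed
    then have "rsquarefree (evx s R)" by (simp add: rsquarefree_roots)
    then show ?thesis using rsquarefree_card_degree[OF nzR(1)] nzR(2) by simp
  qed
  have "infinite ({s. card {y. poly (evx s q) y = 0} \<le> card {y. poly (evx 0 q) y = 0}} - {s. poly \<Omega> s = 0})"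
    using inf poly_roots_finite[OF \<Omega>(1)] by (rule Diff_infinite_finite[rotated])
  then obtain s where "card {y. poly (evx s q) y = 0} \<le> card {y. poly (evx 0 q) y = 0}" "poly \<Omega> s \<noteq> 0"
    using not_finite_existsD by (metis (mono_tags, lifting) Diff_iff all_not_in_conv finite.emptyI mem_Collect_eq)
  then have "degree R \<le> card {y. poly (evx 0 R) y = 0}" using gen roots by simp
  moreover have "card {y. poly (evx 0 R) y = 0} \<le> degree R"
    using card_poly_roots_bound[OF nzR(1)] nzR(2) by simp
  ultimately have "rsquarefree (evx 0 R)" using rsquarefree_card_degree[OF nzR(1)] nzR(2) by simp
  obtain h where h: "q = R * h" using R(2) by (auto simp: dvd_def)
  have e: "poly (evx 0 R) y0 = 0" using y0(1) roots[of 0] by blast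
  then have "poly (pderiv (evx 0 R)) y0 \<noteq> 0"
    using \<open>rsquarefree (evx 0 R)\<close> by (simp add: rsquarefree_roots)
  moreover have "poly (pderiv (evx 0 q)) y0 = poly (pderiv (evx 0 R)) y0 * poly (evx 0 h) y0"
    unfolding h by (simp add: evx_hom pderiv_mult e)
  ultimately have "poly (evx 0 h) y0 = 0" using y0(2) by simp
  then show ?thesis using e
    unfolding h xderiv.leibniz idom_homD[OF idom_hom_eval2[OF idom_hom_id]] by (simp add: poly_evx)
qed

subsection \<open>Homogeneous components\<close>

text \<open>The substitution x -> T x, Y -> T Y with a new outermost variable T: the coefficient of
  T^m is the homogeneous component of degree m, and total degree becomes an ordinary degree,
  additive on products.\<close>

definition tot :: "complex poly poly \<Rightarrow> complex poly poly poly" where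
  "tot = eval2 (\<lambda>c. [:[:[:c:]:]:]) (monom varX 1) (monom [:0, 1:] 1)"

lemma idom_hom_tot: "idom_hom tot"
  unfolding tot_def by (rule idom_hom_eval2) (unfold_locales, auto simp: one_pCons)

lemmas tot_hom = idom_homD[OF idom_hom_tot]

lemma coeff_tot:
  "coeff (coeff (coeff (tot h) m) k) j = (if j + k = m then coeff (coeff h k) j else 0)"
proof -
  have hc: "idom_hom (\<lambda>c :: complex. [:[:[:c:]:]:])" by unfold_locales (auto simp: one_pCons)
  define J where "J = Max ((\<lambda>k. degree (coeff h k)) ` {..degree h})"
  have J: "degree (coeff h k) \<le> J" for k
    by (cases "k \<le> degree h") (auto simp: J_def coeff_eq_0)
  have "h = (\<Sum>k\<le>degree h. \<Sum>j\<le>J. monom (monom (coeff (coeff h k) j) j) k)"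
  proof (rule poly_eqI, rule poly_eqI)
    fix k' j'
    have "coeff (coeff (\<Sum>k\<le>degree h. \<Sum>j\<le>J. monom (monom (coeff (coeff h k) j) j) k) k') j' =
        (\<Sum>k\<le>degree h. \<Sum>j\<le>J. if k = k' then if j = j' then coeff (coeff h k) j else 0 else 0)"
      by (auto simp: coeff_sum coeff_monom intro!: sum.cong)
    also have "\<dots> = (\<Sum>k\<le>degree h. if k = k' then if j' \<le> J then coeff (coeff h k) j' else 0 else 0)"
    proof (rule sum.cong[OF refl])
      fix k
      show "(\<Sum>j\<le>J. if k = k' then if j = j' then coeff (coeff h k) j else 0 else 0) =
          (if k = k' then if j' \<le> J then coeff (coeff h k) j' else 0 else 0)"
        by (cases "k = k'") simp_all
    qed
    also have "\<dots> = coeff (coeff h k') j'" using J[of k'] by (auto simp: coeff_eq_0)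
    finally show "coeff (coeff h k') j' =
        coeff (coeff (\<Sum>k\<le>degree h. \<Sum>j\<le>J. monom (monom (coeff (coeff h k) j) j) k) k') j'" ..
  qed
  then have "tot h = (\<Sum>k\<le>degree h. \<Sum>j\<le>J. tot (monom (monom (coeff (coeff h k) j) j) k))"
    using tot_hom(8) by (metis (no_types, lifting) sum.cong)
  also have "\<dots> = (\<Sum>k\<le>degree h. \<Sum>j\<le>J. monom (monom (monom (coeff (coeff h k) j) j) k) (j + k))"
  proof (intro sum.cong refl)
    fix k j
    have "[:[:[:c:]:]:] * monom varX 1 ^ j * monom [:0, 1:] 1 ^ k = monom (monom (monom c j) k) (j + k)" for c :: complex
    proof -
      have "[:0, 1:] ^ k = (monom 1 k :: complex poly poly)" by (simp add: monom_altdef)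
      then have "monom varX 1 ^ j = monom ([:monom 1 j:] :: complex poly poly) j"
        "monom [:0, 1:] 1 ^ k = monom (monom 1 k :: complex poly poly) k"
        by (simp_all add: monom_power varX_power)
      then show ?thesis by (simp only: mult_monom) (simp add: mult_monom smult_monom)
    qed
    then show "tot (monom (monom (coeff (coeff h k) j) j) k) = monom (monom (monom (coeff (coeff h k) j) j) k) (j + k)"
      unfolding tot_def eval2_monom[OF hc] by simp
  qed
  finally have "coeff (coeff (coeff (tot h) m) k) j =
      (\<Sum>k'\<le>degree h. \<Sum>j'\<le>J. if k' = k then if j' = j then if j' + k' = m then coeff (coeff h k') j' else 0 else 0 else 0)"
    by (auto simp: coeff_sum coeff_monom intro!: sum.cong)
  also have "\<dots> = (if k \<le> degree h then if j \<le> J then if j + k = m then coeff (coeff h k) j else 0 else 0 else 0)"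
  proof -
    have "(\<Sum>j'\<le>J. if k' = k then if j' = j then if j' + k' = m then coeff (coeff h k') j' else 0 else 0 else 0) =
      (if k' = k then if j \<le> J then if j + k = m then coeff (coeff h k) j else 0 else 0 else 0)" for k'
      by (cases "k' = k") simp_all
    then show ?thesis by simp
  qed
  also have "\<dots> = (if j + k = m then coeff (coeff h k) j else 0)"
    using J[of k] by (auto simp: coeff_eq_0)
  finally show ?thesis .
qed

lemma tot_eq_0_iff: "tot h = 0 \<longleftrightarrow> h = 0"
proof
  assume "tot h = 0"
  then show "h = 0" using coeff_tot[of h] by (intro poly_eqI) (metis coeff_0)
qed (simp add: tot_hom)

lemma totdeg_le_iff_tot: "totdeg_le N h \<longleftrightarrow> degree (tot h) \<le> N"
proof
  assume "totdeg_le N h"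
  then have "coeff (tot h) m = 0" if "N < m" for m
    using that by (auto simp: poly_eq_iff coeff_tot totdeg_le_def)
  then show "degree (tot h) \<le> N" by (intro degree_le) simp
next
  assume d: "degree (tot h) \<le> N"
  show "totdeg_le N h" unfolding totdeg_le_def
  proof (intro allI impI)
    fix k j assume "N < j + k"
    then have "coeff (tot h) (j + k) = 0" using d by (intro coeff_eq_0) simp
    then show "coeff (coeff h k) j = 0" using coeff_tot[of h "j + k" k j] by simp
  qed
qed

lemma tot_component: "tot (coeff (tot h) m) = monom (coeff (tot h) m) m"
  by (intro poly_eqI) (auto simp: coeff_tot coeff_monom)

lemma degree_tot_monic:
  assumes "lead_coeff h = 1"
  shows "degree h \<le> degree (tot h)" "coeff (coeff (tot h) (degree h)) (degree h) = 1"
proof -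
  have "coeff (coeff (coeff (tot h) (degree h)) (degree h)) 0 = 1" using assms by (simp add: coeff_tot)
  then show "degree h \<le> degree (tot h)" by (metis coeff_0 le_degree zero_neq_one)
  show "coeff (coeff (tot h) (degree h)) (degree h) = 1"
    using assms by (intro poly_eqI) (simp add: coeff_tot)
qed

text \<open>For a monic polynomial the total degree is at least the degree in Y. Both are additive,
  so equality for the product forces equality for the factors.\<close>

lemma totdeg_le_factor:
  assumes "totdeg_le (degree (G * H)) (G * H)" "lead_coeff G = 1" "lead_coeff H = 1"
  shows "degree (tot G) = degree G" "degree (tot H) = degree H"
proof -
  have nz: "G \<noteq> 0" "H \<noteq> 0" using assms by auto
  have "degree (tot G) + degree (tot H) \<le> degree G + degree H"
    using assms(1) nz unfolding totdeg_le_iff_tot tot_hom(6)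
    by (simp add: degree_mult_eq tot_eq_0_iff)
  then show "degree (tot G) = degree G" "degree (tot H) = degree H"
    using degree_tot_monic(1)[OF assms(2)] degree_tot_monic(1)[OF assms(3)] by linarith+
qed

subsection \<open>Intersection of two plane curves\<close>

lemma complex_coprime_iff:
  fixes p q :: "complex poly"
  assumes "\<And>x. \<not> (poly p x = 0 \<and> poly q x = 0)"
  shows "coprime p q"
proof (rule coprimeI)
  fix c assume c: "c dvd p" "c dvd q"
  show "is_unit c"
  proof (cases "degree c = 0")
    case True
    moreover have "c \<noteq> 0" using c assms by (metis dvd_0_left poly_0)
    ultimately show ?thesis by (simp add: is_unit_iff_degree)
  next
    case False
    then obtain x where "poly c x = 0" using fundamental_theorem_of_algebra constant_degree by metis
    then show ?thesis using c assms[of x] by (auto simp: dvd_def)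
  qed
qed

text \<open>At a root x of r the relation specialises to a syzygy of coprime polynomials, hence to a
  multiple w of the trivial one. Subtracting w times the trivial syzygy of G and H makes both
  cofactors divisible by X - x, and a linear factor of r cancels.\<close>

lemma bezout_unit:
  fixes G H :: "complex poly poly"
  assumes G: "lead_coeff G = 1" and H: "lead_coeff H = 1"
    and none: "\<And>x y. \<not> (poly (evx x G) y = 0 \<and> poly (evx x H) y = 0)"
    and "[:r:] = u * G + v * H" "r \<noteq> 0"
  shows "\<exists>u v. u * G + v * H = 1"
  using assms(4,5)
proof (induction "degree r" arbitrary: r u v rule: less_induct)
  case less
  show ?case
  proof (cases "degree r = 0")
    case True
    then obtain c where c: "r = [:c:]" by (meson degree_eq_zeroE)
    then have "[:[:inverse c:]:] * [:r:] = 1" using less.prems(2) by (simp add: one_pCons)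
    then have "([:[:inverse c:]:] * u) * G + ([:[:inverse c:]:] * v) * H = 1"
      using less.prems(1) by (simp add: algebra_simps)
    then show ?thesis by blast
  next
    case False
    then obtain x where x: "poly r x = 0" using fundamental_theorem_of_algebra constant_degree by metis
    define g h where "g = evx x G" and "h = evx x H"
    have "coprime g h" unfolding g_def h_def by (rule complex_coprime_iff) (rule none)
    have "evx x [:r:] = 0" using x by (simp add: evx_def Polynomial.map_poly_pCons)
    then have e: "evx x u * g + evx x v * h = 0" using less.prems(1) by (simp add: evx_hom g_def h_def)
    have "evx x u * g = h * (- evx x v)" using e by (simp add: eq_neg_iff_add_eq_0 mult.commute)
    then have "h dvd evx x u * g" by (rule dvdI)
    then have "h dvd evx x u" using \<open>coprime g h\<close> by (simp add: coprime_dvd_mult_left_iff coprime_commute)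
    then obtain w where w: "evx x u = h * w" by (auto simp: dvd_def)
    have "h \<noteq> 0" unfolding h_def by (rule evx_nz[OF H])
    have "h * (w * g + evx x v) = 0" using e unfolding w by (simp add: algebra_simps)
    then have "evx x v + w * g = 0" using \<open>h \<noteq> 0\<close> by (simp add: add.commute)
    then have w': "evx x v = - (w * g)" by (simp only: eq_neg_iff_add_eq_0)
    have "evx x (u - lift_const w * H) = 0" "evx x (v + lift_const w * G) = 0"
      using w w' by (simp_all add: evx_hom g_def h_def)
    then obtain u' v' where uv: "u - lift_const w * H = [:[:- x, 1:]:] * u'" "v + lift_const w * G = [:[:- x, 1:]:] * v'"
      unfolding evx_eq_0_iff dvd_def by blast
    obtain r' where r': "r = [:- x, 1:] * r'" using x by (auto simp: poly_eq_0_iff_dvd dvd_def)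
    have "[:[:- x, 1:]:] * [:r':] = [:r:]" unfolding r' by simp
    also have "\<dots> = (u - lift_const w * H) * G + (v + lift_const w * G) * H"
      unfolding less.prems(1) by (simp only: left_diff_distrib distrib_right) (simp add: ac_simps)
    also have "\<dots> = [:[:- x, 1:]:] * (u' * G + v' * H)" unfolding uv by (simp only: distrib_left mult.assoc)
    finally have "[:r':] = u' * G + v' * H" by (subst (asm) mult_left_cancel) auto
    moreover have r0: "r' \<noteq> 0" using less.prems(2) r' by auto
    moreover have "degree r = degree [:- x, 1:] + degree r'"
      unfolding r' by (rule degree_mult_eq) (use r0 in auto)
    then have "degree r' < degree r" by simp
    ultimately show ?thesis using less.hyps by blast
  qed
qed

text \<open>Otherwise 1 = u G + v H. The top components Ga and Hb are coprime, as the top form of G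
  H has no multiple root. The top component of u G cancels against v H, so Hb divides that of u, and
  subtracting a multiple of H lowers the total degree of u. The descent ends at u = 0, where H would
  be a unit.\<close>

lemma bezout_common_zero:
  fixes G H :: "complex poly poly"
  assumes G: "lead_coeff G = 1" "0 < degree G" and H: "lead_coeff H = 1" "0 < degree H"
    and tdeg: "totdeg_le (degree (G * H)) (G * H)"
    and top: "rsquarefree (evx 1 (coeff (tot (G * H)) (degree (G * H))))"
  obtains x y where "poly (evx x G) y = 0" "poly (evx x H) y = 0"
proof (rule ccontr)
  assume "\<not> thesis"
  then have none: "\<not> (poly (evx x G) y = 0 \<and> poly (evx x H) y = 0)" for x y using that by blast
  have nz: "G \<noteq> 0" "H \<noteq> 0" using G H by auto
  obtain \<Omega> u0 v0 where "\<Omega> \<noteq> 0" "[:\<Omega>:] = u0 * G + v0 * H"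
    using G(1)
  proof (cases rule: monic_norm[of G H])
    case (zero_divisor w)
    obtain k where "coeff w k \<noteq> 0" using zero_divisor(1) by (meson leading_coeff_neq_0)
    then obtain x where "poly (coeff w k) x \<noteq> 0" using poly_all_0_iff_0 by blast
    then have "evx x w \<noteq> 0" by (metis coeff_0 coeff_evx)
    have "coprime (evx x G) (evx x H)" by (rule complex_coprime_iff) (rule none)
    moreover have "evx x G dvd evx x w * evx x H" using evx_hom(10)[OF zero_divisor(3)] by (simp add: evx_hom)
    ultimately have "evx x G dvd evx x w" by (simp add: coprime_dvd_mult_left_iff)
    then have "evx x w = 0"
      by (rule monic_dvd_small) (use evx_monic(1)[OF G(1), of x] evx_nz[OF G(1)] zero_divisor(2) in \<open>auto\<close>)
    then show ?thesis using \<open>evx x w \<noteq> 0\<close> by simp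
  next
    case (norm \<Omega> z z')
    then show ?thesis using that[of \<Omega> z' z] by (simp add: algebra_simps)
  qed
  then obtain u0 v0 where uv0: "u0 * G + v0 * H = 1" using bezout_unit[OF G(1) H(1) none] by blast
  define a b where "a = degree G" and "b = degree H"
  have ta: "degree (tot G) = a" "degree (tot H) = b"
    using totdeg_le_factor[OF tdeg G(1) H(1)] by (simp_all add: a_def b_def)
  define Ga Hb where "Ga = coeff (tot G) a" and "Hb = coeff (tot H) b"
  have tnz: "tot G \<noteq> 0" "tot H \<noteq> 0" using nz by (simp_all add: tot_eq_0_iff)
  have Hb: "Hb \<noteq> 0" using tnz ta unfolding Hb_def by (metis leading_coeff_0_iff)
  have GH: "coeff (tot (G * H)) (degree (G * H)) = Ga * Hb"
    using coeff_mult_degree_sum[of "tot G" "tot H"] ta nz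
    by (simp add: tot_hom degree_mult_eq Ga_def Hb_def a_def b_def)
  have monic_ab: "lead_coeff (Ga * Hb) = 1"
  proof -
    have lGH: "lead_coeff (G * H) = 1" using G(1) H(1) by (simp add: lead_coeff_mult)
    have "coeff (Ga * Hb) (degree (G * H)) = 1" using degree_tot_monic(2)[OF lGH] unfolding GH .
    moreover have "coeff (Ga * Hb) k = 0" if "degree (G * H) < k" for k
      unfolding GH[symmetric] using that by (intro poly_eqI) (simp add: coeff_tot)
    then have "degree (Ga * Hb) \<le> degree (G * H)" by (intro degree_le) simp
    ultimately show ?thesis by (metis le_antisym le_degree zero_neq_one)
  qed
  have cop: "coprime Ga Hb"
  proof (rule coprimeI)
    fix c assume c: "c dvd Ga" "c dvd Hb"
    then have cc: "c * c dvd Ga * Hb" by (rule mult_dvd_mono)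
    have cd: "c dvd Ga * Hb" using c(1) by simp
    \<comment> \<open>Dividing a polynomial monic in Y, \<open>c\<close> has a constant leading
      coefficient and keeps its degree at x = 1.\<close>
    obtain e where e: "lead_coeff c = [:e:]" "e \<noteq> 0"
      using dvd_monic_lead_unit[OF cd monic_ab] by (metis is_unit_poly_iff dvd_field_iff zero_neq_one dvd_0_left)
    then have de: "degree (evx 1 c) = degree c" by (intro degree_evx) simp
    have "degree (evx 1 c) = 0"
    proof (rule ccontr)
      assume "degree (evx 1 c) \<noteq> 0"
      then obtain y where y: "poly (evx 1 c) y = 0" using fundamental_theorem_of_algebra constant_degree by metis
      obtain m where m: "Ga * Hb = c * c * m" using cc by (auto simp: dvd_def)
      have "evx 1 (Ga * Hb) = evx 1 c * evx 1 c * evx 1 m" unfolding m by (simp add: evx_hom)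
      then have "poly (evx 1 (Ga * Hb)) y = 0" "poly (pderiv (evx 1 (Ga * Hb))) y = 0"
        using y by (simp_all add: pderiv_mult)
      then show False using top unfolding GH rsquarefree_roots by blast
    qed
    then show "is_unit c" using monic_dvd_unit[OF cd monic_ab] de by simp
  qed
  have "False" if "u * G + v * H = 1" for u v
    using that
  proof (induction "degree (tot u)" arbitrary: u v rule: less_induct)
    case less
    define \<delta> where "\<delta> = degree (tot u)"
    define U where "U = coeff (tot u) \<delta>"
    have a0: "0 < a" and b0: "0 < b" using G(2) H(2) by (simp_all add: a_def b_def)
    show False
    proof (cases "u = 0")
      case True
      then have "H dvd 1" using less.prems by (metis add_0 dvd_triv_right mult_zero_left)
      then show False using H(2) by (metis degree_1 dvd_imp_degree_le leD one_neq_zero)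
    next
      case False
      then have tu: "tot u \<noteq> 0" by (simp add: tot_eq_0_iff)
      then have U0: "U \<noteq> 0" unfolding U_def \<delta>_def by simp
      have eq: "tot v * tot H = 1 - tot u * tot G"
        using arg_cong[OF less.prems, of tot] by (simp add: tot_hom algebra_simps)
      have top1: "coeff (tot u * tot G) (\<delta> + a) = U * Ga"
        using coeff_mult_degree_sum[of "tot u" "tot G"] ta by (simp add: U_def \<delta>_def Ga_def)
      have "coeff (tot v * tot H) (\<delta> + a) = - (U * Ga)"
        unfolding eq using top1 a0 by simp
      have Ga0: "Ga \<noteq> 0" using tnz ta unfolding Ga_def by (metis leading_coeff_0_iff)
      have dd: "degree (tot v * tot H) = \<delta> + a"
      proof (rule le_antisym)
        have "degree (tot u * tot G) \<le> \<delta> + a" using degree_mult_le[of "tot u" "tot G"] ta by (simp add: \<delta>_def)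
        then show "degree (tot v * tot H) \<le> \<delta> + a" unfolding eq by (intro degree_diff_le) simp_all
        show "\<delta> + a \<le> degree (tot v * tot H)"
          using \<open>coeff (tot v * tot H) (\<delta> + a) = - (U * Ga)\<close> U0 Ga0 by (intro le_degree) simp
      qed
      have "lead_coeff (tot v * tot H) = lead_coeff (tot v) * Hb"
        by (simp add: lead_coeff_mult ta Hb_def)
      then have "lead_coeff (tot v) * Hb = - (U * Ga)"
        using \<open>coeff (tot v * tot H) (\<delta> + a) = - (U * Ga)\<close> dd by simp
      then have "Hb dvd U * Ga" by (metis dvd_minus_iff dvd_triv_right)
      then have "Hb dvd U" using cop by (simp add: coprime_dvd_mult_left_iff coprime_commute)
      then obtain w where w: "U = Hb * w" by (auto simp: dvd_def)
      have w0: "tot w \<noteq> 0" using w U0 by (auto simp: tot_eq_0_iff)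
      have m: "monom U \<delta> = monom Hb b * tot w"
        using arg_cong[OF w, of tot] unfolding tot_hom(6) U_def Hb_def tot_component .
      have dw: "\<delta> = b + degree (tot w)"
        using arg_cong[OF m, of degree] U0 Hb w0 by (simp add: degree_monom_eq degree_mult_eq monom_eq_0_iff)
      have "coeff (monom Hb b * tot w) \<delta> = Hb * lead_coeff (tot w)"
        unfolding dw by (simp add: coeff_monom_mult)
      then have lw: "lead_coeff (tot w) = w" using m w Hb by (metis coeff_monom mult_left_cancel)
      define u' where "u' = u - w * H"
      define v' where "v' = v + w * G"
      have "u' * G + v' * H = 1" using less.prems unfolding u'_def v'_def by (simp add: algebra_simps)
      moreover have "degree (tot u') < \<delta>"
      proof -
        have tu': "tot u' = tot u - tot w * tot H" unfolding u'_def by (simp add: tot_hom)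
        have "degree (tot w * tot H) \<le> \<delta>" using degree_mult_le[of "tot w" "tot H"] ta dw by simp
        then have "degree (tot u') \<le> \<delta>" unfolding tu' by (intro degree_diff_le) (simp_all add: \<delta>_def)
        moreover have "coeff (tot w * tot H) \<delta> = w * Hb"
          using coeff_mult_degree_sum[of "tot w" "tot H"] ta lw unfolding dw by (simp add: add.commute Hb_def)
        then have "coeff (tot u') \<delta> = 0" unfolding tu' using w by (simp add: U_def mult.commute)
        moreover have "\<delta> \<noteq> 0" using dw b0 by simp
        ultimately show ?thesis by (metis leading_coeff_0_iff degree_0 le_neq_implies_less)
      qed
      ultimately show False using less.hyps unfolding \<delta>_def by blast
    qed
  qed
  then show False using uv0 by blast
qed

subsection \<open>Algebraic numbers\<close>

lemma algebraic_if_finite_span: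
  fixes z :: complex
  assumes fin: "finite S"
    and span: "\<And>i. z ^ i \<in> module.span (\<lambda>q z. of_rat q * z) S"
  shows "algebraic z"
proof -
  interpret V: vector_space "\<lambda>(q :: rat) (z :: complex). of_rat q * z"
    by standard (simp_all add: of_rat_add of_rat_mult algebra_simps)
  define m where "m = card S"
  show ?thesis
  proof (cases "inj_on (\<lambda>i. z ^ i) {..m}")
    case False
    then obtain i j where ij: "z ^ i = z ^ j" "i < j" unfolding inj_on_def by (metis linorder_neqE_nat)
    show ?thesis
    proof (rule algebraicI)
      show "coeff (monom 1 j - monom 1 i :: complex poly) k \<in> \<int>" for k by (simp add: coeff_monom)
      have "coeff (monom 1 j - monom 1 i :: complex poly) j = 1" using ij(2) by simp
      then show "monom 1 j - monom 1 i \<noteq> (0 :: complex poly)" by (metis coeff_0 zero_neq_one)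
      show "poly (monom 1 j - monom 1 i) z = 0" using ij(1) by (simp add: poly_monom)
    qed
  next
    case True
    let ?B = "(\<lambda>i. z ^ i) ` {..m}"
    have "card ?B = Suc m" using True by (simp add: card_image)
    then have "\<not> V.independent ?B"
      using V.independent_span_bound[OF fin, of ?B] span unfolding m_def by fastforce
    then obtain q b where q: "b \<in> ?B" "q b \<noteq> 0" "(\<Sum>x\<in>?B. of_rat (q x) * x) = 0"
      unfolding V.dependent_finite[OF finite_imageI[OF finite_atMost]] by blast
    define P where "P = (\<Sum>i\<le>m. monom (of_rat (q (z ^ i)) :: complex) i)"
    have cP: "coeff P i = (if i \<le> m then of_rat (q (z ^ i)) else 0)" for i
      unfolding P_def by (simp add: coeff_sum coeff_monom)
    show ?thesis
    proof (rule algebraicI')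
      show "coeff P i \<in> \<rat>" for i unfolding cP by simp
      obtain i where "i \<le> m" "b = z ^ i" using q(1) by auto
      then have "coeff P i \<noteq> 0" using q(2) by (simp add: cP)
      then show "P \<noteq> 0" by auto
      have "(\<Sum>x\<in>?B. of_rat (q x) * x) = (\<Sum>i\<le>m. of_rat (q (z ^ i)) * z ^ i)"
        using True by (simp add: sum.reindex)
      then show "poly P z = 0" using q(3) unfolding P_def by (simp add: poly_sum poly_monom)
    qed
  qed
qed

text \<open>\<open>non_singular\<close> speaks of algebraic points only. The rational span of the
  x^i y^j with bounded exponents is stable under multiplication by x and by y, so it contains all
  powers of the affine combination.\<close>

lemma algebraic_affine:
  fixes x y :: complex and f :: "int poly poly"
  assumes x: "algebraic x" and f: "lead_coeff f = 1" "eval2 of_int x y f = 0"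
  shows "algebraic (of_int a + of_int b * x + of_int c * y)"
proof -
  interpret V: vector_space "\<lambda>(q :: rat) (z :: complex). of_rat q * z"
    by standard (simp_all add: of_rat_add of_rat_mult algebra_simps)
  obtain p where p: "\<And>i. coeff p i \<in> \<rat>" "p \<noteq> 0" "poly p x = 0"
    using x by (auto simp: algebraic_altdef)
  define m where "m = degree p"
  define d where "d = degree f"
  define S where "S = (\<lambda>(i, j). x ^ i * y ^ j) ` ({..<m} \<times> {..<d})"
  have gen: "x ^ i * y ^ j \<in> V.span S" if "i < m" "j < d" for i j
    using that by (intro V.span_base) (auto simp: S_def)
  have scale: "r * w \<in> V.span S" if "r \<in> \<rat>" "w \<in> V.span S" for r w
    using that by (auto elim!: Rats_cases intro: V.span_scale)
  have mult: "t * w \<in> V.span S" if "\<And>s. s \<in> S \<Longrightarrow> t * s \<in> V.span S" "w \<in> V.span S" for t w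
    using that(2)
  proof (induction rule: V.span_induct_alt)
    case base
    show ?case by (simp add: V.span_zero)
  next
    case (step q s w)
    have "t * (of_rat q * s + w) = of_rat q * (t * s) + t * w" by (simp add: algebra_simps)
    then show ?case using step that(1) by (simp add: V.span_add V.span_scale)
  qed
  have lc: "lead_coeff p \<noteq> 0" using p(2) by simp
  have "m > 0"
  proof (rule ccontr)
    assume "\<not> m > 0"
    then obtain r where "p = [:r:]" unfolding m_def by (auto elim: degree_eq_zeroE)
    then show False using p(2,3) by simp
  qed
  have xm: "x ^ m = (\<Sum>i<m. (- coeff p i / lead_coeff p) * x ^ i)"
  proof -
    have "(\<Sum>i<m. coeff p i * x ^ i) + lead_coeff p * x ^ m = 0"
      using p(3) unfolding poly_altdef m_def[symmetric] lessThan_Suc_atMost[symmetric] by simp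
    then have "lead_coeff p * x ^ m = - (\<Sum>i<m. coeff p i * x ^ i)" by (simp add: eq_neg_iff_add_eq_0 add.commute)
    then have "x ^ m = - (\<Sum>i<m. coeff p i * x ^ i) / lead_coeff p"
      using lc by (simp add: field_simps)
    then show ?thesis by (simp add: sum_divide_distrib sum_negf)
  qed
  have x_closed: "x * w \<in> V.span S" if "w \<in> V.span S" for w
  proof (rule mult[OF _ that])
    fix s assume "s \<in> S"
    then obtain i j where ij: "s = x ^ i * y ^ j" "i < m" "j < d" unfolding S_def by auto
    show "x * s \<in> V.span S"
    proof (cases "Suc i < m")
      case True
      then show ?thesis using gen[of "Suc i" j] ij by (simp add: mult.assoc)
    next
      case False
      then have "Suc i = m" using ij by simp
      then have "x * s = (\<Sum>i<m. (- coeff p i / lead_coeff p) * (x ^ i * y ^ j))"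
        unfolding ij(1) mult.assoc[symmetric] power_Suc[symmetric] by (simp only: xm sum_distrib_right)
      also have "\<dots> \<in> V.span S"
        using p(1) ij by (intro V.span_sum scale gen) auto
      finally show ?thesis .
    qed
  qed
  have xpow: "x ^ i * y ^ j \<in> V.span S" if "j < d" for i j
  proof (induction i)
    case 0
    show ?case using gen[of 0 j] that \<open>m > 0\<close> by simp
  next
    case (Suc i)
    then show ?case using x_closed by (simp add: mult.assoc)
  qed
  have xpoly: "poly (map_poly of_int q) x * (x ^ i * y ^ j) \<in> V.span S" if "j < d" for q :: "int poly" and i j
  proof -
    have "poly (map_poly of_int q) x * (x ^ i * y ^ j) =
        (\<Sum>k\<le>degree (map_poly of_int q :: complex poly). of_int (coeff q k) * (x ^ (k + i) * y ^ j))"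
      unfolding poly_altdef sum_distrib_right by (simp add: coeff_map_poly power_add mult.assoc)
    also have "\<dots> \<in> V.span S" using that by (intro V.span_sum scale xpow) auto
    finally show ?thesis .
  qed
  have "d > 0"
  proof (rule ccontr)
    assume "\<not> d > 0"
    then have "f = 1" using f(1) unfolding d_def by (metis degree_0_id gr0I one_pCons)
    then show False using f(2) idom_homD(2)[OF idom_hom_eval2[OF idom_hom_of_int], of x y] by simp
  qed
  have yd: "y ^ d = - (\<Sum>k<d. poly (map_poly of_int (coeff f k)) x * y ^ k)"
  proof -
    define g where "g = map_poly (\<lambda>c. poly (map_poly of_int c) x) f"
    have h1: "idom_hom (\<lambda>c :: int poly. poly (map_poly of_int c) x)"
      by (intro idom_hom_eval1 idom_hom_of_int)
    have cg: "coeff g k = poly (map_poly of_int (coeff f k)) x" for k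
      unfolding g_def by (simp add: coeff_map_poly)
    have "coeff g d = 1" unfolding cg using f(1) idom_homD(2)[OF h1] by (simp add: d_def)
    moreover have "degree g \<le> d" unfolding g_def d_def by (rule degree_map_poly_le)
    ultimately have dg: "degree g = d" by (metis le_antisym le_degree zero_neq_one)
    have "poly g y = 0" using f(2) unfolding g_def eval2_def .
    then have "(\<Sum>k<d. coeff g k * y ^ k) + y ^ d = 0"
      unfolding poly_altdef dg lessThan_Suc_atMost[symmetric] using \<open>coeff g d = 1\<close> by simp
    then show ?thesis unfolding cg by (simp add: eq_neg_iff_add_eq_0 add.commute)
  qed
  have y_closed: "y * w \<in> V.span S" if "w \<in> V.span S" for w
  proof (rule mult[OF _ that])
    fix s assume "s \<in> S"
    then obtain i j where ij: "s = x ^ i * y ^ j" "i < m" "j < d" unfolding S_def by auto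
    show "y * s \<in> V.span S"
    proof (cases "Suc j < d")
      case True
      then show ?thesis using gen[of i "Suc j"] ij by (simp add: mult.left_commute)
    next
      case False
      then have "Suc j = d" using ij by simp
      then have "y * s = x ^ i * y ^ d" unfolding ij(1) by (auto simp: mult.left_commute)
      also have "\<dots> = - (\<Sum>k<d. poly (map_poly of_int (coeff f k)) x * (x ^ i * y ^ k))"
        unfolding yd by (simp add: sum_distrib_left mult.left_commute)
      also have "\<dots> \<in> V.span S" by (intro V.span_neg V.span_sum xpoly) simp
      finally show ?thesis .
    qed
  qed
  let ?z = "of_int a + of_int b * x + of_int c * y"
  have "?z ^ i \<in> V.span S" for i
  proof (induction i)
    case 0
    show ?case using gen[of 0 0] \<open>m > 0\<close> \<open>d > 0\<close> by simp
  next
    case (Suc i)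
    have "?z ^ Suc i = of_int a * ?z ^ i + of_int b * (x * ?z ^ i) + of_int c * (y * ?z ^ i)"
      by (simp add: algebra_simps)
    also have "\<dots> \<in> V.span S" by (intro V.span_add scale x_closed y_closed Suc) auto
    finally show ?case .
  qed
  then show ?thesis by (intro algebraic_if_finite_span[of S]) (simp_all add: S_def)
qed

subsection \<open>Evaluation of forms\<close>

lemma form_eval_cong: "(\<And>i. i \<le> n \<Longrightarrow> x i = y i) \<Longrightarrow> form_eval c n x = form_eval c n y"
  unfolding form_eval_def by (intro sum.cong arg_cong2[where f = "(*)"] prod.cong refl) auto

lemma idom_hom_of_int_eq:
  assumes "idom_hom h"
  shows "h (of_int k) = of_int k" "h (of_nat m) = of_nat m"
proof -
  note hD = idom_homD[OF assms]
  show nat: "h (of_nat m) = of_nat m" for m by (induction m) (simp_all add: hD)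
  show "h (of_int k) = of_int k" by (cases k) (simp_all add: hD nat del: of_nat_Suc)
qed

lemma form_eval_hom:
  assumes "idom_hom h"
  shows "h (form_eval c n x) = form_eval c n (\<lambda>i. h (x i))"
  unfolding form_eval_def by (simp add: idom_homD[OF assms] idom_hom_of_int_eq[OF assms])

lemma form_deriv_eval_hom:
  assumes "idom_hom h"
  shows "h (form_deriv_eval c n j x) = form_deriv_eval c n j (\<lambda>i. h (x i))"
  unfolding form_deriv_eval_def
  by (simp add: idom_homD[OF assms] idom_hom_of_int_eq[OF assms] if_distrib[of h] cong: if_cong)

context derivation
begin

lemma of_nat: "D (of_nat m) = 0"
  by (induction m) (simp_all add: add)

lemma of_int: "D (of_int k) = 0"
  by (cases k) (simp_all add: of_nat minus diff del: of_nat_Suc)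

lemma prod:
  assumes "finite S"
  shows "D (prod g S) = (\<Sum>j\<in>S. D (g j) * prod g (S - {j}))"
  using assms
proof (induction S rule: finite_induct)
  case (insert a S)
  have "D (g j) * prod g (insert a S - {j}) = g a * (D (g j) * prod g (S - {j}))" if "j \<in> S" for j
  proof -
    have "insert a S - {j} = insert a (S - {j})" using that insert by auto
    then show ?thesis using insert by (simp add: mult.left_commute)
  qed
  moreover have "insert a S - {a} = S" using insert by auto
  ultimately show ?case using insert by (simp add: leibniz sum_distrib_left)
qed simp

text \<open>The chain rule for an arbitrary derivation: it serves for d/dx on plane sections, for
  d/ds on pencils and for lines in \<open>nonzero_value\<close>.\<close>

lemma form_eval: "D (form_eval c n g) = (\<Sum>j\<le>n. form_deriv_eval c n j g * D (g j))"
proof -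
  have monomial: "D (\<Prod>i\<le>n. g i ^ \<alpha> i) =
      (\<Sum>j\<le>n. of_nat (\<alpha> j) * (\<Prod>i\<le>n. if i = j then g i ^ (\<alpha> i - 1) else g i ^ \<alpha> i) * D (g j))" for \<alpha>
  proof -
    have "(\<Prod>i\<le>n. if i = j then g i ^ (\<alpha> i - 1) else g i ^ \<alpha> i) =
        g j ^ (\<alpha> j - 1) * (\<Prod>i\<in>{..n} - {j}. g i ^ \<alpha> i)" if "j \<le> n" for j
      using that by (subst prod.remove[of _ j]) (auto intro!: prod.cong)
    then show ?thesis
      by (simp add: prod power mult.assoc mult.left_commute mult.commute)
  qed
  show ?thesis unfolding form_eval_def form_deriv_eval_def sum leibniz of_int monomial
    by (simp add: sum_distrib_left sum_distrib_right mult.assoc sum.swap[of _ "{..n}"])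
qed

end

lemma coeff_mult_bound:
  fixes p q :: "'a::comm_semiring_1 poly"
  assumes "degree p \<le> m" "degree q \<le> k"
  shows "coeff (p * q) (m + k) = coeff p m * coeff q k"
proof -
  have "coeff p i * coeff q (m + k - i) = 0" if "i \<noteq> m" "i \<le> m + k" for i
    using assms that by (cases "i < m") (auto simp: coeff_eq_0)
  then have "(\<Sum>i\<le>m + k. coeff p i * coeff q (m + k - i)) = (\<Sum>i\<in>{m}. coeff p i * coeff q (m + k - i))"
    by (intro sum.mono_neutral_right) auto
  then show ?thesis by (simp add: coeff_mult)
qed

lemma coeff_power_bound:
  fixes p :: "'a::comm_semiring_1 poly"
  assumes "degree p \<le> 1"
  shows "degree (p ^ k) \<le> k \<and> coeff (p ^ k) k = coeff p 1 ^ k"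
proof (induction k)
  case (Suc k)
  then have "coeff (p * p ^ k) (1 + k) = coeff p 1 * coeff p 1 ^ k" using coeff_mult_bound[OF assms] by simp
  moreover have "degree (p * p ^ k) \<le> Suc k" using degree_mult_le[of p "p ^ k"] assms Suc by linarith
  ultimately show ?case by simp
qed simp

lemma coeff_prod_bound:
  fixes p :: "'b \<Rightarrow> 'a::comm_semiring_1 poly"
  assumes "finite S" "\<And>i. i \<in> S \<Longrightarrow> degree (p i) \<le> m i"
  shows "degree (prod p S) \<le> sum m S \<and> coeff (prod p S) (sum m S) = (\<Prod>i\<in>S. coeff (p i) (m i))"
  using assms
proof (induction S rule: finite_induct)
  case (insert a S)
  then have "coeff (p a * prod p S) (m a + sum m S) = coeff (p a) (m a) * (\<Prod>i\<in>S. coeff (p i) (m i))"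
    using coeff_mult_bound[of "p a" "m a" "prod p S" "sum m S"] by simp
  moreover have "degree (p a * prod p S) \<le> m a + sum m S"
    using degree_mult_le[of "p a" "prod p S"] insert by (meson add_mono insertI1 insertI2 order_trans)
  ultimately show ?case using insert by simp
qed simp

lemma form_eval_linear:
  fixes w e :: "nat \<Rightarrow> 'a::comm_ring_1"
  assumes "is_form n d c"
  shows "degree (form_eval c n (\<lambda>i. [:w i, e i:])) \<le> d"
    "coeff (form_eval c n (\<lambda>i. [:w i, e i:])) d = form_eval c n e"
proof -
  have "degree (of_int (c \<alpha>) * (\<Prod>i\<le>n. [:w i, e i:] ^ \<alpha> i)) \<le> d \<and>
      coeff (of_int (c \<alpha>) * (\<Prod>i\<le>n. [:w i, e i:] ^ \<alpha> i)) d = of_int (c \<alpha>) * (\<Prod>i\<le>n. e i ^ \<alpha> i)"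
    if "c \<alpha> \<noteq> 0" for \<alpha>
  proof -
    have d: "(\<Sum>i\<le>n. \<alpha> i) = d" using assms that by (simp add: is_form_def)
    have l: "degree ([:w i, e i:] ^ \<alpha> i) \<le> \<alpha> i \<and> coeff ([:w i, e i:] ^ \<alpha> i) (\<alpha> i) = e i ^ \<alpha> i" for i
      using coeff_power_bound[of "[:w i, e i:]" "\<alpha> i"] by simp
    have "degree (\<Prod>i\<le>n. [:w i, e i:] ^ \<alpha> i) \<le> d \<and> coeff (\<Prod>i\<le>n. [:w i, e i:] ^ \<alpha> i) d = (\<Prod>i\<le>n. e i ^ \<alpha> i)"
      using coeff_prod_bound[of "{..n}" "\<lambda>i. [:w i, e i:] ^ \<alpha> i" \<alpha>] l unfolding d by simp
    moreover have "of_int (c \<alpha>) = [:of_int (c \<alpha>) :: 'a:]" by (rule of_int_poly)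
    ultimately show ?thesis using degree_smult_le order_trans by fastforce
  qed
  then show "degree (form_eval c n (\<lambda>i. [:w i, e i:])) \<le> d"
    "coeff (form_eval c n (\<lambda>i. [:w i, e i:])) d = form_eval c n e"
    unfolding form_eval_def by (auto simp: coeff_sum intro!: degree_sum_le sum.cong) (metis (mono_tags, lifting) assms degree_sum_le is_form_def mem_Collect_eq)
qed

lemma totdeg_le_form_eval:
  assumes "is_form n d c" "\<And>i. totdeg_le 1 (x i)"
  shows "totdeg_le d (form_eval c n x)"
  unfolding form_eval_def
proof (rule totdeg_le_sum)
  fix \<alpha> assume "\<alpha> \<in> {\<alpha>. c \<alpha> \<noteq> 0}"
  then have d: "(\<Sum>i\<le>n. \<alpha> i) = d" using assms(1) by (simp add: is_form_def)
  have prod: "totdeg_le (\<Sum>i\<in>S. \<alpha> i) (\<Prod>i\<in>S. x i ^ \<alpha> i)" if "finite S" for S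
    using that
  proof (induction S rule: finite_induct)
    case empty
    show ?case using totdeg_le_power[of 0 "0 :: 'a poly poly" 0] by (simp add: totdeg_le_def)
  next
    case (insert a S)
    then show ?case using totdeg_le_mult[OF totdeg_le_power[OF assms(2), of "\<alpha> a" a]] by simp
  qed
  have "totdeg_le 0 (of_int (c \<alpha>) :: 'a poly poly)"
    by (auto simp: totdeg_le_def of_int_poly coeff_pCons split: nat.splits)
  then have "totdeg_le (0 + d) (of_int (c \<alpha>) * (\<Prod>i\<le>n. x i ^ \<alpha> i))"
    using prod[of "{..n}"] d by (intro totdeg_le_mult) simp_all
  then show "totdeg_le d (of_int (c \<alpha>) * (\<Prod>i\<le>n. x i ^ \<alpha> i))" by simp
qed

subsection \<open>Density from a simple zero\<close>

text \<open>Since p divides m, a simple zero of h modulo p is one of h - m as well.\<close>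

lemma hensel_values:
  fixes h :: "int poly" and p :: nat
  assumes p: "prime p" and y0: "int p dvd poly h y0" "\<not> int p dvd poly (pderiv h) y0" and m: "int p dvd m"
  shows "\<exists>y. int p ^ k dvd poly h y - m"
proof -
  have "\<exists>y. int p ^ Suc k dvd poly h y - m \<and> int p dvd y - y0" for k
  proof (induction k)
    case 0
    show ?case using y0(1) m by (intro exI[of _ y0]) simp
  next
    case (Suc k)
    then obtain y where y: "int p ^ Suc k dvd poly h y - m" "int p dvd y - y0" by blast
    obtain r where r: "poly h y - m = int p ^ Suc k * r" using y(1) by (auto simp: dvd_def)
    have "y - y0 dvd poly (pderiv h) y - poly (pderiv h) y0"
    proof -
      have "(y - y0)\<^sup>2 dvd poly (pderiv h) (y0 + (y - y0)) - (poly (pderiv h) y0 + (y - y0) * poly (pderiv (pderiv h)) y0)"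
        by (rule poly_taylor)
      then have "y - y0 dvd poly (pderiv h) y - (poly (pderiv h) y0 + (y - y0) * poly (pderiv (pderiv h)) y0)"
        unfolding power2_eq_square by (metis add_diff_cancel_left' diff_add_cancel add.commute dvd_mult_left)
      then have "y - y0 dvd poly (pderiv h) y - (poly (pderiv h) y0 + (y - y0) * poly (pderiv (pderiv h)) y0)
          + (y - y0) * poly (pderiv (pderiv h)) y0" by (rule dvd_add) simp
      then show ?thesis by simp
    qed
    then have "int p dvd poly (pderiv h) y - poly (pderiv h) y0" using y(2) by (rule dvd_trans[rotated])
    then have "\<not> int p dvd poly (pderiv h) y" using y0(2) by (metis dvd_diff_commute dvd_diff diff_diff_eq2 add_diff_cancel_left')
    moreover have "prime (int p)" using p by simp
    ultimately have "coprime (poly (pderiv h) y) (int p)"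
      using prime_imp_coprime coprime_commute by blast
    then obtain i where i: "[poly (pderiv h) y * i = 1] (mod int p)" using cong_solve_coprime_int by blast
    define t where "t = - (r * i)"
    define b where "b = int p ^ Suc k * t"
    have "int p dvd r + t * poly (pderiv h) y"
    proof -
      have "int p dvd poly (pderiv h) y * i - 1" using i by (simp add: cong_iff_dvd_diff)
      then have "int p dvd - r * (poly (pderiv h) y * i - 1)" by (rule dvd_mult)
      then show ?thesis unfolding t_def by (simp add: algebra_simps)
    qed
    then have 1: "int p ^ Suc k * int p dvd int p ^ Suc k * (r + t * poly (pderiv h) y)" by simp
    obtain s where s: "poly h (y + b) - (poly h y + b * poly (pderiv h) y) = b\<^sup>2 * s"
      using poly_taylor by (metis dvdE)
    have "int p ^ Suc k * int p dvd int p ^ Suc k * int p ^ Suc k" by (intro mult_dvd_mono) auto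
    then have 2: "int p ^ Suc k * int p dvd b\<^sup>2 * s"
      unfolding b_def power2_eq_square by (metis dvd_mult2 mult.assoc mult.left_commute)
    have "poly h (y + b) - m = int p ^ Suc k * (r + t * poly (pderiv h) y) + b\<^sup>2 * s"
      using s r unfolding b_def by (simp add: algebra_simps)
    then have "int p ^ Suc (Suc k) dvd poly h (y + b) - m"
      using dvd_add[OF 1 2] by (simp add: mult.commute)
    moreover have "int p dvd (y - y0) + b" unfolding b_def using y(2) by (intro dvd_add) auto
    then have "int p dvd y + b - y0" by (simp add: algebra_simps)
    ultimately show ?case by blast
  qed
  then show ?thesis by (cases k) auto
qed

text \<open>For q = u/v, the polynomial h takes values close to p u and p v, whose quotient is close
  to q; the factor p brings the targets into the range of \<open>hensel_values\<close>.\<close>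

lemma padic_dense_if_simple_zero:
  assumes p: "prime p" and y0: "int p dvd poly h y0" "\<not> int p dvd poly (pderiv h) y0"
    and h: "\<And>y. poly h y = form_eval c n (\<lambda>i. w i + y * e i)"
  shows "padic_dense p (ratio_set n c)"
  unfolding padic_dense_def
proof (intro allI)
  fix q :: rat and k :: nat
  obtain u v where uv: "q = of_int u / of_int v" "v > 0" using quotient_of_div[of q] quotient_of_denom_pos[of q]
    by (metis surj_pair)
  have "\<not> is_unit (int p)" using prime_gt_1_nat[OF p] by simp
  then obtain v1 where v1: "v = int p ^ multiplicity (int p) v * v1" "\<not> int p dvd v1"
    using multiplicity_decompose'[of v "int p"] uv(2) by (metis less_irrefl)
  define j where "j = multiplicity (int p) v"
  \<comment> \<open>With j the valuation of v, the denominator v h(y) has valuation 2 j + 1, so this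
    precision leaves a factor p^(k + 1).\<close>
  define K where "K = k + j + j + 2"
  obtain y where "int p ^ K dvd poly h y - int p * v" using hensel_values[OF p y0, of "int p * v"] by auto
  then obtain \<alpha> where \<alpha>: "poly h y = int p * v + int p ^ K * \<alpha>" by (metis add.commute diff_add_cancel dvdE)
  obtain x where "int p ^ K dvd poly h x - int p * u" using hensel_values[OF p y0, of "int p * u"] by auto
  then obtain \<beta> where \<beta>: "poly h x = int p * u + int p ^ K * \<beta>" by (metis add.commute diff_add_cancel dvdE)
  have p0: "int p \<noteq> 0" using p by auto
  define b where "b = v1 + int p ^ (k + j + 1) * \<alpha>"
  have b: "\<not> int p dvd b"
  proof
    assume "int p dvd b"
    moreover have "int p dvd int p ^ (k + j + 1) * \<alpha>" by simp
    ultimately show False using v1(2) unfolding b_def by (metis dvd_add_left_iff)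
  qed
  have hy: "poly h y = int p ^ (j + 1) * b"
    unfolding \<alpha> b_def K_def by (subst v1(1)) (simp add: j_def power_add algebra_simps)
  have v: "v = int p ^ j * v1" using v1(1) unfolding j_def .
  have nz: "b \<noteq> 0" "v1 \<noteq> 0" using b v1(2) by auto
  then have "poly h y \<noteq> 0" unfolding hy using p0 by simp
  then have mem: "of_int (poly h x) / of_int (poly h y) \<in> ratio_set n c"
    unfolding ratio_set_def h by blast
  have "of_int (poly h x) / of_int (poly h y) - q =
      (of_int (int p ^ k * (int p * (v * \<beta> - u * \<alpha>))) / of_int (v1 * b) :: rat)"
  proof -
    have eq: "v * poly h x - u * poly h y = int p ^ j * int p ^ (j + 1) * (int p ^ k * (int p * (v * \<beta> - u * \<alpha>)))"
      unfolding \<alpha> \<beta> K_def by (simp add: algebra_simps power_add)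
    have "of_int (poly h x) / of_int (poly h y) - q =
        (of_int (v * poly h x - u * poly h y) / of_int (v * poly h y) :: rat)"
      using uv \<open>poly h y \<noteq> 0\<close> by (simp add: field_simps)
    also have "v * poly h y = int p ^ j * int p ^ (j + 1) * (v1 * b)" unfolding hy by (subst v) simp
    finally show ?thesis unfolding eq using p0 by simp
  qed
  moreover have "\<not> int p dvd v1 * b" using b v1(2) p by (simp add: prime_dvd_mult_iff)
  ultimately show "\<exists>r\<in>ratio_set n c. \<exists>a b. b \<noteq> 0 \<and> \<not> int p dvd b \<and> r - q = of_int (int p ^ k * a) / of_int b"
    using mem nz by (meson mult_eq_0_iff)
qed

subsection \<open>Irreducible plane sections of a non-singular form\<close>

lemma finite_monic_divisors:
  fixes f :: "complex poly"
  assumes "f \<noteq> 0"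
  shows "finite {g. g dvd f \<and> lead_coeff g = 1}"
proof -
  let ?R = "{x. poly f x = 0}"
  have "{g. g dvd f \<and> lead_coeff g = 1} \<subseteq> (\<lambda>as. \<Prod>a\<leftarrow>as. [:- a, 1:]) ` {as. set as \<subseteq> ?R \<and> length as \<le> degree f}"
  proof
    fix g assume g: "g \<in> {g. g dvd f \<and> lead_coeff g = 1}"
    obtain as where as: "Polynomial.smult (coeff g (degree g)) (\<Prod>a\<leftarrow>as. [:- a, 1:]) = g" "length as = degree g"
      using fundamental_theorem_algebra_factorized[of g] by blast
    then have eq: "g = (\<Prod>a\<leftarrow>as. [:- a, 1:])" using g by simp
    have "set as \<subseteq> ?R"
    proof
      fix a assume "a \<in> set as"
      then have "poly g a = 0" unfolding eq by (induction as) auto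
      then show "a \<in> ?R" using g by (auto simp: dvd_def)
    qed
    moreover have "length as \<le> degree f" using as(2) g assms dvd_imp_degree_le[of g f] by auto
    ultimately show "g \<in> (\<lambda>as. \<Prod>a\<leftarrow>as. [:- a, 1:]) ` {as. set as \<subseteq> ?R \<and> length as \<le> degree f}"
      using eq by blast
  qed
  moreover have "finite {as. set as \<subseteq> ?R \<and> length as \<le> degree f}"
    by (rule finite_lists_length_le) (rule poly_roots_finite[OF assms])
  ultimately show ?thesis using finite_surj by blast
qed

text \<open>The fibre at 0 has \<open>degree q\<close> distinct roots, all of them roots of the
  radical; so the radical has full degree and is q itself.\<close>

lemma generically_separable:
  fixes q :: "complex poly poly"
  assumes q: "lead_coeff q = 1" and sf: "rsquarefree (evx 0 q)"
  obtains \<Omega> z z' where "\<Omega> \<noteq> 0" "[:\<Omega>:] = pderiv q * z + q * z'"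
  using q
proof (cases rule: monic_norm[of q "pderiv q"])
  case (zero_divisor v)
  obtain R N \<Omega> z z' where R: "lead_coeff R = 1" "R dvd q" "q dvd R ^ N"
    and \<Omega>: "\<Omega> \<noteq> 0" "[:\<Omega>:] = pderiv R * z + R * z'"
    by (rule separable_radical[OF q])
  have "evx 0 q dvd evx 0 R ^ N" using evx_hom(10)[OF R(3)] by (simp add: evx_hom)
  then have "{y. poly (evx 0 q) y = 0} \<subseteq> {y. poly (evx 0 R) y = 0}"
    by (auto simp: dvd_def) (metis mult_eq_0_iff poly_mult poly_power power_eq_0_iff)
  then have "card {y. poly (evx 0 q) y = 0} \<le> card {y. poly (evx 0 R) y = 0}"
    by (intro card_mono poly_roots_finite evx_nz[OF R(1)])
  also have "\<dots> \<le> degree R" using card_poly_roots_bound[OF evx_nz[OF R(1)]] evx_monic(1)[OF R(1)] by simp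
  finally have "degree q \<le> degree R"
    using sf rsquarefree_card_degree[OF evx_nz[OF q]] evx_monic(1)[OF q] by simp
  obtain h where h: "q = R * h" using R(2) by (auto simp: dvd_def)
  have nz: "R \<noteq> 0" "h \<noteq> 0" using q h by auto
  then have "degree h = 0" using \<open>degree q \<le> degree R\<close> unfolding h by (simp add: degree_mult_eq)
  then obtain c where "h = [:c:]" by (meson degree_eq_zeroE)
  moreover have "lead_coeff q = lead_coeff R * lead_coeff h" unfolding h by (rule lead_coeff_mult)
  ultimately have "h = 1" using q R(1) by (simp add: one_pCons)
  then show ?thesis using that \<Omega> h by simp
next
  case (norm \<Omega> z z')
  then show ?thesis using that by blast
qed

lemma finite_not_rsquarefree:
  fixes q :: "complex poly poly"
  assumes q: "lead_coeff q = 1" and sf: "rsquarefree (evx 0 q)"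
  shows "finite {s. \<not> rsquarefree (evx s q)}"
proof -
  obtain \<Omega> z z' where \<Omega>: "\<Omega> \<noteq> 0" "[:\<Omega>:] = pderiv q * z + q * z'"
    by (rule generically_separable[OF q sf])
  have "poly \<Omega> s = 0" if ns: "\<not> rsquarefree (evx s q)" for s
  proof -
    obtain a where "poly (evx s q) a = 0" "poly (pderiv (evx s q)) a = 0"
      using ns unfolding rsquarefree_roots by blast
    moreover have "evx s [:\<Omega>:] = pderiv (evx s q) * evx s z + evx s q * evx s z'"
      unfolding \<Omega>(2) by (simp add: evx_hom evx_pderiv)
    moreover have "poly (evx s [:\<Omega>:]) a = poly \<Omega> s" by (simp add: evx_def Polynomial.map_poly_pCons)
    ultimately show ?thesis by simp
  qed
  then have "{s. \<not> rsquarefree (evx s q)} \<subseteq> {s. poly \<Omega> s = 0}" by (rule Collect_mono[rule_format])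
  then show ?thesis by (rule finite_subset) (rule poly_roots_finite[OF \<Omega>(1)])
qed

lemma finite_linear_zeros:
  fixes a b :: int
  assumes "a \<noteq> 0"
  shows "finite {s. a + s * b = 0}"
proof (cases "b = 0")
  case False
  have "{s. a + s * b = 0} \<subseteq> {- (a div b)}"
  proof
    fix s assume "s \<in> {s. a + s * b = 0}"
    then have "a = b * (- s)" by (simp add: mult.commute)
    then have "a div b = - s" using False by (metis nonzero_mult_div_cancel_left)
    then show "s \<in> {- (a div b)}" by simp
  qed
  then show ?thesis using finite_subset by blast
qed (use assms in simp)

definition dot :: "nat \<Rightarrow> (nat \<Rightarrow> int) \<Rightarrow> (nat \<Rightarrow> 'a::comm_ring_1) \<Rightarrow> 'a" where
  "dot n l w = (\<Sum>i\<le>n. of_int (l i) * w i)"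

lemma dot_add: "dot n l (\<lambda>i. v i + s * u i) = dot n l v + s * dot n l u"
  by (simp add: dot_def algebra_simps sum.distrib sum_distrib_left)

lemma dot_of_int: "dot n l (\<lambda>i. of_int (w i)) = of_int (dot n l w)"
  by (simp add: dot_def)

lemma dot_self: "\<exists>i\<le>n. l i \<noteq> 0 \<Longrightarrow> dot n l l \<noteq> 0"
proof -
  assume "\<exists>i\<le>n. l i \<noteq> 0"
  then obtain i where i: "i \<le> n" "l i \<noteq> 0" by blast
  then have "0 < l i * l i" by (auto simp: zero_less_mult_iff neq_iff)
  then have "0 < (\<Sum>i\<le>n. l i * l i)" using i by (intro sum_pos2[of _ i]) auto
  then show ?thesis by (simp add: dot_def)
qed

text \<open>The cross product of the first three coordinates, extended by zeros; the case
  distinction treats proportional vectors, for which it vanishes.\<close>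

lemma orthogonal_vector:
  fixes e a :: "nat \<Rightarrow> int"
  assumes "2 \<le> n"
  obtains l where "\<exists>i\<le>n. l i \<noteq> 0" "dot n l e = 0" "dot n l a = 0"
proof -
  have sum3: "dot n (\<lambda>i. if i = 0 then x else if i = 1 then y else if i = 2 then z else 0) w
      = x * w 0 + y * w 1 + z * w 2" for x y z and w :: "nat \<Rightarrow> int"
  proof -
    have "dot n (\<lambda>i. if i = 0 then x else if i = 1 then y else if i = 2 then z else 0) w =
        (\<Sum>i\<in>{0, 1, 2}. (if i = 0 then x else if i = 1 then y else if i = 2 then z else 0) * w i)"
      unfolding dot_def of_int_eq_id id_apply using assms by (intro sum.mono_neutral_right) auto
    then show ?thesis by simp
  qed
  have "\<exists>x y z. (x \<noteq> 0 \<or> y \<noteq> 0 \<or> z \<noteq> 0) \<and> x * e 0 + y * e 1 + z * e 2 = 0 \<and> x * a 0 + y * a 1 + z * a 2 = 0"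
  proof (cases "e 1 * a 2 - e 2 * a 1 = 0 \<and> e 2 * a 0 - e 0 * a 2 = 0 \<and> e 0 * a 1 - e 1 * a 0 = 0")
    case False
    then show ?thesis
      by (intro exI[of _ "e 1 * a 2 - e 2 * a 1"] exI[of _ "e 2 * a 0 - e 0 * a 2"] exI[of _ "e 0 * a 1 - e 1 * a 0"])
        (auto simp: algebra_simps)
  next
    case True
    show ?thesis
    proof (cases "e 0 = 0 \<and> e 1 = 0 \<and> e 2 = 0")
      case e0: True
      show ?thesis
      proof (cases "a 0 = 0")
        case True
        then show ?thesis using e0 by (intro exI[of _ 1] exI[of _ 0] exI[of _ 0]) simp
      next
        case False
        then show ?thesis using e0 by (intro exI[of _ "a 1"] exI[of _ "- a 0"] exI[of _ 0]) (simp add: algebra_simps)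
      qed
    next
      case e0: False
      show ?thesis
      proof (cases "e 0 = 0 \<and> e 1 = 0")
        case t: True
        then have "e 2 \<noteq> 0" using e0 by simp
        then have "a 0 = 0" using True t by simp
        then show ?thesis using t by (intro exI[of _ 1] exI[of _ 0] exI[of _ 0]) simp
      next
        case False
        then show ?thesis using True by (intro exI[of _ "e 1"] exI[of _ "- e 0"] exI[of _ 0]) (auto simp: algebra_simps)
      qed
    qed
  qed
  then obtain x y z where xyz: "x \<noteq> 0 \<or> y \<noteq> 0 \<or> z \<noteq> 0" "x * e 0 + y * e 1 + z * e 2 = 0" "x * a 0 + y * a 1 + z * a 2 = 0"
    by blast
  let ?l = "\<lambda>i :: nat. if i = 0 then x else if i = 1 then y else if i = 2 then z else 0"
  have "\<exists>i\<le>n. ?l i \<noteq> 0"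
    using xyz(1)
  proof (elim disjE)
    assume "x \<noteq> 0"
    then show ?thesis by (intro exI[of _ 0]) simp
  next
    assume "y \<noteq> 0"
    then show ?thesis using assms by (intro exI[of _ 1]) simp
  next
    assume "z \<noteq> 0"
    then show ?thesis using assms by (intro exI[of _ 2]) simp
  qed
  moreover have "dot n ?l e = 0" "dot n ?l a = 0" unfolding sum3 using xyz(2,3) by simp_all
  ultimately show ?thesis by (rule that)
qed

lemma dvd_form_eval_diff:
  fixes A B :: "nat \<Rightarrow> 'a::comm_ring_1"
  shows "k dvd form_eval c n (\<lambda>i. A i + k * B i) - form_eval c n A"
proof -
  have pow: "k dvd (A i + k * B i) ^ m - A i ^ m" for i m
  proof -
    have "(A i + k * B i) - A i dvd (A i + k * B i) ^ m - A i ^ m"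
      unfolding power_diff_sumr2 by (rule dvd_triv_left)
    then have "k * B i dvd (A i + k * B i) ^ m - A i ^ m" by simp
    then show ?thesis by (rule dvd_mult_left)
  qed
  have "k dvd (\<Prod>i\<in>S. (A i + k * B i) ^ \<alpha> i) - (\<Prod>i\<in>S. A i ^ \<alpha> i)" for \<alpha> and S :: "nat set"
  proof (induction S rule: infinite_finite_induct)
    case (insert a S)
    have eq: "(\<Prod>i\<in>insert a S. (A i + k * B i) ^ \<alpha> i) - (\<Prod>i\<in>insert a S. A i ^ \<alpha> i) =
        ((A a + k * B a) ^ \<alpha> a - A a ^ \<alpha> a) * (\<Prod>i\<in>S. (A i + k * B i) ^ \<alpha> i) +
        A a ^ \<alpha> a * ((\<Prod>i\<in>S. (A i + k * B i) ^ \<alpha> i) - (\<Prod>i\<in>S. A i ^ \<alpha> i))"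
      using insert by (simp add: algebra_simps)
    show ?case unfolding eq by (intro dvd_add dvd_mult2[OF pow] dvd_mult[OF insert.IH])
  qed simp_all
  then show ?thesis unfolding form_eval_def sum_subtractf[symmetric] right_diff_distrib[symmetric]
    by (intro dvd_sum dvd_mult)
qed

section \<open>Restrictions of the form to lines, planes and pencils of planes with a common
  direction\<close>

locale nonsingular_form =
  fixes n d :: nat and c :: "(nat \<Rightarrow> nat) \<Rightarrow> int" and e :: "nat \<Rightarrow> int"
  assumes d_pos: "0 < d" and n_ge: "2 \<le> n"
    and form: "is_form n d c" and nonsing: "non_singular n c"
    and e_nz: "form_eval c n e \<noteq> 0"
begin

abbreviation "\<kappa> \<equiv> form_eval c n e"

text \<open>Scaling the base point by \<kappa> = F(e) lets the division by \<kappa> produce a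
  polynomial that is both monic and integral.\<close>

definition lin :: "(nat \<Rightarrow> int) \<Rightarrow> complex poly" where
  "lin w = [:1 / of_int \<kappa>:] * form_eval c n (\<lambda>i. [:of_int (\<kappa> * w i), of_int (e i):])"

definition plane :: "(nat \<Rightarrow> int) \<Rightarrow> (nat \<Rightarrow> int) \<Rightarrow> complex poly poly" where
  "plane a v = [:[:1 / of_int \<kappa>:]:] *
     form_eval c n (\<lambda>i. [:[:of_int (\<kappa> * a i), of_int (\<kappa> * v i):], [:of_int (e i):]:])"

text \<open>The plane section in direction v + s u with indeterminate s; all members share the line
  x = 0.\<close>

definition pencil :: "(nat \<Rightarrow> int) \<Rightarrow> (nat \<Rightarrow> int) \<Rightarrow> (nat \<Rightarrow> int) \<Rightarrow> complex poly poly poly" where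
  "pencil a v u = [:[:[:1 / of_int \<kappa>:]:]:] * form_eval c n
     (\<lambda>i. [:[:[:of_int (\<kappa> * a i):], [:of_int (\<kappa> * v i), of_int (\<kappa> * u i):]:], [:[:of_int (e i):]:]:])"

definition coord :: "nat \<Rightarrow> nat \<Rightarrow> int" where "coord j i = (if i = j then 1 else 0)"

lemma kappa_nz: "of_int \<kappa> \<noteq> (0 :: complex)"
  using e_nz by simp

lemma plane_monic: "lead_coeff (plane a v) = 1" "degree (plane a v) = d"
proof -
  let ?P = "form_eval c n (\<lambda>i. [:[:of_int (\<kappa> * a i), of_int (\<kappa> * v i):], [:of_int (e i):]:]) :: complex poly poly"
  have "idom_hom (\<lambda>k. [:of_int k:] :: complex poly)" by unfold_locales (auto simp: one_pCons)
  then have "form_eval c n (\<lambda>i. [:of_int (e i):] :: complex poly) = [:of_int \<kappa>:]"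
    using form_eval_hom[of "\<lambda>k. [:of_int k:] :: complex poly" c n e] by simp
  then have "degree ?P \<le> d" "coeff ?P d = [:of_int \<kappa>:]"
    using form_eval_linear[OF form, of "\<lambda>i. [:of_int (\<kappa> * a i), of_int (\<kappa> * v i):]" "\<lambda>i. [:of_int (e i):] :: complex poly"]
    by simp_all
  then have "degree (plane a v) \<le> d" "coeff (plane a v) d = 1"
    unfolding plane_def using e_nz degree_smult_le[of "[:1 / of_int \<kappa>:]" ?P] by (simp_all add: one_pCons)
  then show "degree (plane a v) = d" by (metis le_antisym le_degree zero_neq_one)
  then show "lead_coeff (plane a v) = 1" using \<open>coeff (plane a v) d = 1\<close> by simp
qed

lemma pencil_monic: "lead_coeff (pencil a v u) = 1" "degree (pencil a v u) = d"
proof -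
  let ?P = "form_eval c n (\<lambda>i. [:[:[:of_int (\<kappa> * a i):], [:of_int (\<kappa> * v i), of_int (\<kappa> * u i):]:],
      [:[:of_int (e i):]:]:]) :: complex poly poly poly"
  have "idom_hom (\<lambda>k. [:[:of_int k:]:] :: complex poly poly)" by unfold_locales (auto simp: one_pCons)
  then have "form_eval c n (\<lambda>i. [:[:of_int (e i):]:] :: complex poly poly) = [:[:of_int \<kappa>:]:]"
    using form_eval_hom[of "\<lambda>k. [:[:of_int k:]:] :: complex poly poly" c n e] by simp
  then have "degree ?P \<le> d" "coeff ?P d = [:[:of_int \<kappa>:]:]"
    using form_eval_linear[OF form, of "\<lambda>i. [:[:of_int (\<kappa> * a i):], [:of_int (\<kappa> * v i), of_int (\<kappa> * u i):]:]"
        "\<lambda>i. [:[:of_int (e i):]:] :: complex poly poly"]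
    by simp_all
  then have "degree (pencil a v u) \<le> d" "coeff (pencil a v u) d = 1"
    unfolding pencil_def using e_nz degree_smult_le[of "[:[:1 / of_int \<kappa>:]:]" ?P] by (simp_all add: one_pCons)
  then show "degree (pencil a v u) = d" by (metis le_antisym le_degree zero_neq_one)
  then show "lead_coeff (pencil a v u) = 1" using \<open>coeff (pencil a v u) d = 1\<close> by simp
qed

lemma totdeg_plane: "totdeg_le d (plane a v)"
proof -
  have "totdeg_le (0 + d) (plane a v)" unfolding plane_def
    by (intro totdeg_le_mult totdeg_le_form_eval[OF form])
      (auto simp: totdeg_le_def coeff_pCons split: nat.splits)
  then show ?thesis by simp
qed

lemma evx_plane: "evx (of_int s) (plane a v) = lin (\<lambda>i. a i + s * v i)"
proof -
  have "evx (of_int s) (form_eval c n (\<lambda>i. [:[:of_int (\<kappa> * a i), of_int (\<kappa> * v i):], [:of_int (e i):]:])) =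
      (form_eval c n (\<lambda>i. [:of_int (\<kappa> * (a i + s * v i)), of_int (e i):]) :: complex poly)"
    unfolding form_eval_hom[OF idom_hom_evx]
    by (rule form_eval_cong) (simp add: evx_def Polynomial.map_poly_pCons algebra_simps)
  then show ?thesis unfolding plane_def lin_def evx_hom by (simp add: evx_def Polynomial.map_poly_pCons)
qed

lemma evx_plane_0: "evx 0 (plane a v) = lin a"
  using evx_plane[of 0 a v] by simp

lemma lin_monic: "lead_coeff (lin a) = 1" "degree (lin a) = d"
  using evx_monic[OF plane_monic(1)[of a a], of 0] plane_monic(2)[of a a] unfolding evx_plane_0 by simp_all

lemma spec_pencil: "spec (of_int s) (pencil a v u) = plane a (\<lambda>i. v i + s * u i)"
proof -
  have "spec (of_int s) (form_eval c n (\<lambda>i. [:[:[:of_int (\<kappa> * a i):], [:of_int (\<kappa> * v i), of_int (\<kappa> * u i):]:], [:[:of_int (e i):]:]:])) =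
      form_eval c n (\<lambda>i. [:[:of_int (\<kappa> * a i), of_int (\<kappa> * (v i + s * u i)):], [:of_int (e i):]:])"
    unfolding form_eval_hom[OF idom_hom_spec]
    by (rule form_eval_cong) (simp add: Polynomial.map_poly_pCons algebra_simps)
  then show ?thesis unfolding plane_def pencil_def spec_hom by (simp add: Polynomial.map_poly_pCons)
qed

lemma evx_pencil: "evx 0 (pencil a v u) = lift_const (lin a)"
proof -
  have lc: "idom_hom (lift_const :: complex poly \<Rightarrow> _)"
    unfolding lift_const_def by (intro idom_hom_map_poly) (unfold_locales, auto simp: one_pCons)
  have "evx 0 (form_eval c n (\<lambda>i. [:[:[:of_int (\<kappa> * a i):], [:of_int (\<kappa> * v i), of_int (\<kappa> * u i):]:], [:[:of_int (e i):]:]:])) =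
      form_eval c n (\<lambda>i. lift_const [:of_int (\<kappa> * a i), of_int (e i) :: complex:])"
    unfolding form_eval_hom[OF idom_hom_evx]
    by (rule form_eval_cong) (simp add: evx_def lift_const_def Polynomial.map_poly_pCons)
  then show ?thesis unfolding pencil_def lin_def evx_hom idom_homD(6)[OF lc] form_eval_hom[OF lc]
    by (simp add: evx_def lift_const_def Polynomial.map_poly_pCons)
qed

text \<open>This is the section by the line at infinity of the plane. It depends on v only, and if
  it is squarefree, two factors of the section cannot meet at infinity.\<close>

lemma top_plane: "evx 1 (coeff (tot (plane a v)) d) = lin v"
proof -
  let ?x = "\<lambda>i. [:[:of_int (\<kappa> * a i), of_int (\<kappa> * v i):], [:of_int (e i):]:] :: complex poly poly"
  have tx: "tot (?x i) = [:[:[:of_int (\<kappa> * a i):]:], [:[:0, of_int (\<kappa> * v i):], [:of_int (e i):]:]:]" for i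
    by (intro poly_eqI) (auto simp: coeff_tot coeff_pCons split: nat.splits)
  have "tot (plane a v) = tot [:[:1 / of_int \<kappa>:]:] *
      form_eval c n (\<lambda>i. [:[:[:of_int (\<kappa> * a i):]:], [:[:0, of_int (\<kappa> * v i):], [:of_int (e i):]:]:])"
    unfolding plane_def tot_hom form_eval_hom[OF idom_hom_tot] tx ..
  also have "tot [:[:1 / of_int \<kappa>:]:] = [:[:[:1 / of_int \<kappa>:]:]:]"
    by (intro poly_eqI) (auto simp: coeff_tot coeff_pCons split: nat.splits)
  finally have "coeff (tot (plane a v)) d = [:[:1 / of_int \<kappa>:]:] *
      form_eval c n (\<lambda>i. [:[:0, of_int (\<kappa> * v i):], [:of_int (e i):]:])"
    using form_eval_linear(2)[OF form, of "\<lambda>i. [:[:of_int (\<kappa> * a i):]:]" "\<lambda>i. [:[:0, of_int (\<kappa> * v i):], [:of_int (e i):]:] :: complex poly poly"]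
    by simp
  moreover have "evx 1 (form_eval c n (\<lambda>i. [:[:0, of_int (\<kappa> * v i):], [:of_int (e i):]:])) =
      (form_eval c n (\<lambda>i. [:of_int (\<kappa> * v i), of_int (e i):]) :: complex poly)"
    unfolding form_eval_hom[OF idom_hom_evx]
    by (rule form_eval_cong) (simp add: evx_def Polynomial.map_poly_pCons)
  ultimately show ?thesis unfolding lin_def by (simp only: evx_hom) (simp add: evx_def Polynomial.map_poly_pCons)
qed

text \<open>Modulo \<kappa> the form takes the value F(e Y) = \<kappa> Y^d, which is 0, so the
  division by \<kappa> stays over the integers.\<close>

lemma integral_plane:
  obtains f where "lead_coeff f = 1" "degree f = d" "bimap of_int f = plane a v"
    "[:[:\<kappa>:]:] * f = form_eval c n (\<lambda>i. [:[:\<kappa> * a i, \<kappa> * v i:], [:e i:]:])"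
proof -
  let ?F = "form_eval c n (\<lambda>i. [:[:\<kappa> * a i, \<kappa> * v i:], [:e i:]:]) :: int poly poly"
  let ?k = "[:[:\<kappa>:]:] :: int poly poly"
  have split: "?F = form_eval c n (\<lambda>i. [:0, [:e i:]:] + ?k * [:[:a i, v i:]:])"
    by (rule form_eval_cong) simp
  have "?k dvd ?F - form_eval c n (\<lambda>i. [:0, [:e i:]:])" unfolding split by (rule dvd_form_eval_diff)
  moreover have "form_eval c n (\<lambda>i. [:0, [:e i:]:]) = ?k * monom 1 d"
  proof -
    have h: "idom_hom (\<lambda>k. [:[:k:]:] :: int poly poly)" by unfold_locales (auto simp: one_pCons)
    have "form_eval c n (\<lambda>i. [:0, [:e i:]:]) = form_eval c n (\<lambda>i. [:0, 1:] * [:[:e i:]:])"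
      by (rule form_eval_cong) simp
    also have "\<dots> = [:0, 1:] ^ d * form_eval c n (\<lambda>i. [:[:e i:]:])"
      unfolding form_eval_def sum_distrib_left
    proof (rule sum.cong[OF refl])
      fix \<alpha> assume "\<alpha> \<in> {\<alpha>. c \<alpha> \<noteq> 0}"
      then have "(\<Sum>i\<le>n. \<alpha> i) = d" using form by (simp add: is_form_def)
      then have "(\<Prod>i\<le>n. ([:0, 1:] * [:[:e i:]:]) ^ \<alpha> i) = [:0, 1:] ^ d * (\<Prod>i\<le>n. [:[:e i:]:] ^ \<alpha> i)"
        by (simp only: power_mult_distrib prod.distrib power_sum[symmetric])
      then show "of_int (c \<alpha>) * (\<Prod>i\<le>n. ([:0, 1:] * [:[:e i:]:]) ^ \<alpha> i) =
          [:0, 1:] ^ d * (of_int (c \<alpha>) * (\<Prod>i\<le>n. [:[:e i:]:] ^ \<alpha> i))" by (simp only: mult.left_commute)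
    qed
    also have "form_eval c n (\<lambda>i. [:[:e i:]:]) = ?k" using form_eval_hom[OF h, of c n e] by simp
    also have "[:0, 1:] ^ d = (monom 1 d :: int poly poly)" by (simp add: monom_altdef)
    finally show ?thesis by (simp only: mult.commute)
  qed
  then have "?k dvd form_eval c n (\<lambda>i. [:0, [:e i:]:])" by (rule dvdI)
  ultimately have "?k dvd (?F - form_eval c n (\<lambda>i. [:0, [:e i:]:])) + form_eval c n (\<lambda>i. [:0, [:e i:]:])"
    by (rule dvd_add)
  then have "?k dvd ?F" by (simp only: diff_add_cancel)
  then obtain f where f: "?F = ?k * f" by (auto simp: dvd_def)
  note bh = idom_hom_map_poly[OF idom_hom_map_poly[OF idom_hom_of_int[where 'a = complex]]]
  have "bimap of_int ?F = form_eval c n (\<lambda>i. [:[:of_int (\<kappa> * a i), of_int (\<kappa> * v i):], [:of_int (e i):]:] :: complex poly poly)"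
    unfolding form_eval_hom[OF bh] by (rule form_eval_cong) (simp add: Polynomial.map_poly_pCons)
  then have pl: "plane a v = [:[:1 / of_int \<kappa>:]:] * bimap of_int ?F" unfolding plane_def by simp
  have "bimap of_int ?F = [:[:of_int \<kappa>:]:] * (bimap of_int f :: complex poly poly)"
    unfolding f idom_homD(6)[OF bh] by (simp add: Polynomial.map_poly_pCons)
  then have im: "bimap of_int f = plane a v" unfolding pl using e_nz by (simp add: one_pCons[symmetric])
  have cf: "coeff (plane a v) k = map_poly of_int (coeff f k)" for k unfolding im[symmetric] by (simp add: coeff_map_poly)
  have z: "map_poly (of_int :: int \<Rightarrow> complex) q = 0 \<longleftrightarrow> q = 0" for q by (auto simp: poly_eq_iff coeff_map_poly)
  have "degree (bimap of_int f :: complex poly poly) = degree f" by (rule degree_map_poly) (simp add: z)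
  then have df: "degree f = d" unfolding im by (simp add: plane_monic(2))
  have "map_poly (of_int :: int \<Rightarrow> complex) (coeff f d - 1) = 0"
    using plane_monic[of a v] cf[of d] idom_homD(2,4)[OF idom_hom_map_poly[OF idom_hom_of_int[where 'a = complex]]] by simp
  then have "coeff f d = 1" unfolding z by simp
  then show ?thesis using that[of f] df im f by simp
qed

lemma singular_contradiction:
  fixes z :: "nat \<Rightarrow> complex"
  assumes "\<And>i. i \<le> n \<Longrightarrow> algebraic (z i)" "dot n l z \<noteq> 0" "\<And>j. j \<le> n \<Longrightarrow> form_deriv_eval c n j z = 0"
  shows False
proof -
  have "\<exists>i\<le>n. z i \<noteq> 0"
  proof (rule ccontr)
    assume "\<not> (\<exists>i\<le>n. z i \<noteq> 0)"
    then have "dot n l z = 0" unfolding dot_def by (intro sum.neutral) simp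
    then show False using assms(2) by simp
  qed
  then show False using nonsing assms unfolding non_singular_def by blast
qed

text \<open>Among the a with l . a nonzero take one whose line meets F = 0 in the most points.
  Moving a in a coordinate direction cannot raise this number, up to finitely many steps s, so
  \<open>persistent_multiple_root\<close> makes all partial derivatives vanish at a multiple root.
  As l . e = 0, that point has l . z = \<kappa> (l . a), which is nonzero.\<close>

lemma base_line:
  obtains a where "rsquarefree (lin a)"
proof -
  obtain l where l: "\<exists>i\<le>n. l i \<noteq> 0" "dot n l e = 0" using orthogonal_vector[OF n_ge, of e e] by blast
  define r where "r w = card {y. poly (lin w) y = 0}" for w
  have "lin w \<noteq> 0" for w using lin_monic(1)[of w] by auto
  then have rd: "r w \<le> d" for w unfolding r_def using card_poly_roots_bound[of "lin w"] lin_monic(2)[of w] by simp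
  have "\<exists>a. dot n l a \<noteq> 0 \<and> (\<forall>b. dot n l b \<noteq> 0 \<longrightarrow> r b \<le> r a)"
    using ex_has_greatest_nat[of "\<lambda>a. dot n l a \<noteq> 0" l r "Suc d"] dot_self[OF l(1)] rd
    by (simp add: less_Suc_eq_le)
  then obtain a where a: "dot n l a \<noteq> 0" "\<And>b. dot n l b \<noteq> 0 \<Longrightarrow> r b \<le> r a" by blast
  have "rsquarefree (lin a)"
  proof (rule ccontr)
    assume "\<not> rsquarefree (lin a)"
    then obtain y where y: "poly (lin a) y = 0" "poly (pderiv (lin a)) y = 0" unfolding rsquarefree_roots by blast
    define z where "z i = of_int (\<kappa> * a i) + of_int (e i) * y" for i
    have "algebraic y"
    proof -
      obtain f where f: "bimap of_int f = plane a a" "degree f = d" "lead_coeff f = 1"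
        using integral_plane[of a a] by metis
      have "lin a = map_poly of_int (evx 0 f)"
        unfolding evx_plane_0[of a a, symmetric] f(1)[symmetric]
        by (rule poly_eqI) (simp add: coeff_map_poly poly_0_coeff_0)
      then have "coeff (lin a) i \<in> \<int>" for i by (simp add: coeff_map_poly)
      then show ?thesis using y(1) \<open>lin a \<noteq> 0\<close> by (intro algebraicI) auto
    qed
    show False
    proof (rule singular_contradiction)
      fix i
      have "eval2 of_int y 0 [:0, 1 :: int poly:] = 0" by (simp add: eval2_def)
      then show "algebraic (z i)"
        using algebraic_affine[OF \<open>algebraic y\<close>, of "[:0, 1:]" 0 "\<kappa> * a i" "e i" 0] by (simp add: z_def)
    next
      have "dot n l z = of_int \<kappa> * dot n l (\<lambda>i. of_int (a i)) + y * dot n l (\<lambda>i. of_int (e i))"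
        unfolding z_def by (simp add: dot_def algebra_simps sum.distrib sum_distrib_left)
      then show "dot n l z \<noteq> 0" using a(1) l(2) e_nz by (simp add: dot_of_int)
    next
      fix j assume j: "j \<le> n"
      let ?q = "plane a (coord j)"
      have "infinite (UNIV - {s :: int. dot n l a + s * dot n l (coord j) = 0})"
        using finite_linear_zeros[OF a(1)] by (intro Diff_infinite_finite) (auto simp: infinite_UNIV_int)
      then have inf: "infinite ((of_int :: int \<Rightarrow> complex) ` (UNIV - {s :: int. dot n l a + s * dot n l (coord j) = 0}))"
        by (subst finite_image_iff) (auto simp: inj_on_def)
      have "(of_int :: int \<Rightarrow> complex) ` (UNIV - {s :: int. dot n l a + s * dot n l (coord j) = 0}) \<subseteq>
          {s. card {y. poly (evx s ?q) y = 0} \<le> card {y. poly (evx 0 ?q) y = 0}}"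
        using a(2) unfolding r_def by (auto simp: evx_plane evx_plane_0 dot_add)
      then have "infinite {s. card {y. poly (evx s ?q) y = 0} \<le> card {y. poly (evx 0 ?q) y = 0}}"
        using inf finite_subset by blast
      then have "eval2 (\<lambda>c. c) 0 y (xderiv ?q) = 0"
        using persistent_multiple_root[OF plane_monic(1)] y unfolding evx_plane_0 by blast
      note ev = idom_homD[OF idom_hom_eval2[OF idom_hom_id, of 0 y]]
      let ?x = "\<lambda>i. [:[:of_int (\<kappa> * a i), of_int (\<kappa> * coord j i):], [:of_int (e i):]:] :: complex poly poly"
      have xk: "xderiv [:[:1 / of_int \<kappa>:]:] = (0 :: complex poly poly)"
        by (simp add: xderiv_def Polynomial.map_poly_pCons pderiv_pCons)
      have xx: "xderiv (?x i) = [:[:of_int (\<kappa> * coord j i):]:]" for i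
        by (simp add: xderiv_def Polynomial.map_poly_pCons pderiv_pCons)
      have ex: "eval2 (\<lambda>c. c) 0 y (?x i) = z i" for i
        by (simp add: eval2_def Polynomial.map_poly_pCons z_def mult.commute map_poly_idI')
      have "xderiv ?q = [:[:1 / of_int \<kappa>:]:] * (\<Sum>i\<le>n. form_deriv_eval c n i ?x * [:[:of_int (\<kappa> * coord j i):]:])"
        unfolding plane_def xderiv.leibniz xk xderiv.form_eval xx by simp
      then have "eval2 (\<lambda>c. c) 0 y (xderiv ?q) =
          (1 / of_int \<kappa>) * (\<Sum>i\<le>n. form_deriv_eval c n i z * of_int (\<kappa> * coord j i))"
        by (simp only: ev form_deriv_eval_hom[OF idom_hom_eval2[OF idom_hom_id]] ex)
          (simp add: eval2_def Polynomial.map_poly_pCons map_poly_idI')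
      also have "(\<Sum>i\<le>n. form_deriv_eval c n i z * of_int (\<kappa> * coord j i)) =
          (\<Sum>i\<le>n. if i = j then form_deriv_eval c n j z * of_int \<kappa> else 0)"
        by (intro sum.cong) (auto simp: coord_def)
      also have "\<dots> = form_deriv_eval c n j z * of_int \<kappa>" using j by simp
      finally show "form_deriv_eval c n j z = 0" using \<open>eval2 (\<lambda>c. c) 0 y (xderiv ?q) = 0\<close> kappa_nz by simp
    qed
  qed
  then show ?thesis using that by blast
qed

text \<open>Factors are recorded by their restriction to the line x = 0, common to all planes
  considered, so they lie in one finite set and can be compared between planes.\<close>

definition factors0 :: "(nat \<Rightarrow> int) \<Rightarrow> (nat \<Rightarrow> int) \<Rightarrow> complex poly set" where
  "factors0 a v = {g. \<exists>G H. plane a v = G * H \<and> lead_coeff G = 1 \<and> lead_coeff H = 1 \<and>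
     0 < degree G \<and> 0 < degree H \<and> evx 0 G = g}"

lemma factors0_subset: "factors0 a v \<subseteq> {g. g dvd lin a \<and> lead_coeff g = 1}"
proof
  fix g assume "g \<in> factors0 a v"
  then obtain G H where G: "plane a v = G * H" "lead_coeff G = 1" "evx 0 G = g"
    unfolding factors0_def by blast
  have "lin a = g * evx 0 H" unfolding evx_plane_0[of a v, symmetric] G(1) evx_hom G(3) ..
  then show "g \<in> {g. g dvd lin a \<and> lead_coeff g = 1}" using evx_monic(2)[OF G(2), of 0] G(3) by simp
qed

lemma finite_divisors_lin: "finite {g. g dvd lin a \<and> lead_coeff g = 1}"
  using lin_monic(1)[of a] by (intro finite_monic_divisors) auto

lemma finite_factors0: "finite (factors0 a v)"
  by (rule finite_subset[OF factors0_subset finite_divisors_lin])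

lemma xdegree_factor:
  assumes "plane a v = G * H" "lead_coeff G = 1" "lead_coeff H = 1"
  shows "degree (coeff G k) \<le> d" "degree (coeff H k) \<le> d"
proof -
  have nz: "G \<noteq> 0" "H \<noteq> 0" using assms by auto
  have deg: "degree (G * H) = d" using plane_monic(2) assms(1) by metis
  have "totdeg_le (degree (G * H)) (G * H)" using totdeg_plane[of a v] unfolding assms(1) deg .
  note t = totdeg_le_factor[OF this assms(2,3)]
  have le: "degree (coeff P k) \<le> d" if "degree (tot P) = degree P" "degree P \<le> d" for P
  proof -
    have "totdeg_le d P" unfolding totdeg_le_iff_tot using that by simp
    then show ?thesis by (intro degree_le) (auto simp: totdeg_le_def)
  qed
  have "degree G + degree H = d" using deg nz by (simp add: degree_mult_eq)
  then show "degree (coeff G k) \<le> d" "degree (coeff H k) \<le> d" using le t by simp_all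
qed

lemma coprime_cofactor:
  assumes sf: "rsquarefree (lin a)" and gh: "lin a = g * h"
  obtains u v where "u * g + v * h = 1"
proof -
  have "coprime g h"
  proof (rule complex_coprime_iff)
    fix x
    show "\<not> (poly g x = 0 \<and> poly h x = 0)"
      using sf unfolding rsquarefree_roots gh by (auto simp: pderiv_mult)
  qed
  then have "fst (bezout_coefficients g h) * g + snd (bezout_coefficients g h) * h = 1"
    by (simp add: bezout_coefficients_fst_snd)
  then show ?thesis using that by blast
qed

text \<open>Factors of a section have degree at most d in x whatever s is; this is the uniform bound
  that \<open>factor_along_line\<close> asks for.\<close>

lemma pencil_factor:
  assumes sf: "rsquarefree (lin a)" and inf: "infinite {s. g \<in> factors0 a (\<lambda>i. v i + s * u i)}"
  obtains G H where "pencil a v u = G * H" "lead_coeff G = 1" "evx 0 G = lift_const g"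
proof -
  obtain s0 where "g \<in> factors0 a (\<lambda>i. v i + s0 * u i)" using inf not_finite_existsD by blast
  then have g: "g dvd lin a" "lead_coeff g = 1" using factors0_subset by blast+
  then obtain h where h: "lin a = g * h" by (auto simp: dvd_def)
  have g0: "g \<noteq> 0" using g(2) by auto
  have "lead_coeff (lin a) = lead_coeff g * lead_coeff h" unfolding h by (rule lead_coeff_mult)
  then have lh: "lead_coeff h = 1" using g(2) lin_monic(1) by simp
  obtain r t where rt: "r * g + t * h = 1" by (rule coprime_cofactor[OF sf h])
  have infS: "infinite ((of_int :: int \<Rightarrow> complex) ` {s. g \<in> factors0 a (\<lambda>i. v i + s * u i)})"
    using inf by (subst finite_image_iff) (auto simp: inj_on_def)
  show ?thesis
  proof (rule factor_along_line[OF pencil_monic(1) _ g(2) lh rt infS])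
    show "evx 0 (pencil a v u) = lift_const (g * h)" unfolding evx_pencil h ..
  next
    fix s assume "s \<in> (of_int :: int \<Rightarrow> complex) ` {s. g \<in> factors0 a (\<lambda>i. v i + s * u i)}"
    then obtain i where i: "s = of_int i" "g \<in> factors0 a (\<lambda>j. v j + i * u j)" by blast
    then obtain G H where G: "plane a (\<lambda>j. v j + i * u j) = G * H" "lead_coeff G = 1" "lead_coeff H = 1" "evx 0 G = g"
      unfolding factors0_def by blast
    have "g * evx 0 H = g * h"
      unfolding h[symmetric] evx_plane_0[of a "\<lambda>j. v j + i * u j", symmetric] G(1) evx_hom G(4) ..
    then have "evx 0 H = h" using g0 by simp
    then show "\<exists>G H. spec s (pencil a v u) = G * H \<and> lead_coeff G = 1 \<and> lead_coeff H = 1 \<and> evx 0 G = g \<and>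
        evx 0 H = h \<and> (\<forall>k. degree (coeff G k) \<le> d \<and> degree (coeff H k) \<le> d)"
      unfolding i(1) spec_pencil using G xdegree_factor[OF G(1-3)] by blast
  qed (rule that)
qed

lemma spec_pencil_0: "spec 0 (pencil a v u) = plane a v"
  using spec_pencil[of 0 a v u] by simp

lemma pencil_factor_spec:
  assumes "pencil a v u = G * H" "lead_coeff G = 1" "evx 0 G = lift_const g"
  shows "plane a v = spec 0 G * spec 0 H" "lead_coeff (spec 0 G) = 1" "lead_coeff (spec 0 H) = 1"
    "evx 0 (spec 0 G) = g"
proof -
  show "plane a v = spec 0 G * spec 0 H" unfolding spec_pencil_0[of a v u, symmetric] assms(1) spec_hom ..
  show "lead_coeff (spec 0 G) = 1" by (rule spec_monic(2)[OF assms(2)])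
  have "lead_coeff (pencil a v u) = lead_coeff G * lead_coeff H" unfolding assms(1) by (rule lead_coeff_mult)
  then have "lead_coeff H = 1" using assms(2) pencil_monic(1) by simp
  then show "lead_coeff (spec 0 H) = 1" by (rule spec_monic(2))
  show "evx 0 (spec 0 G) = g" unfolding evx_spec assms(3) by (rule poly_eqI) (simp add: coeff_map_poly)
qed

text \<open>On a squarefree line g is coprime to its cofactor, and Hensel uniqueness modulo x^(d +
  1) determines factors of degree at most d in x.\<close>

lemma factor_unique:
  assumes sf: "rsquarefree (lin a)"
    and G: "plane a v = G * H" "lead_coeff G = 1" "lead_coeff H = 1" "evx 0 G = g"
    and G': "plane a v = G' * H'" "lead_coeff G' = 1" "lead_coeff H' = 1" "evx 0 G' = g"
  shows "G' = G" "H' = H"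
proof -
  have gh: "lin a = g * evx 0 H" "lin a = g * evx 0 H'"
    using evx_plane_0[of a v] G(1,4) G'(1,4) by (metis evx_hom(6))+
  have g0: "g \<noteq> 0" using evx_nz[OF G(2), of 0] G(4) by simp
  then have hh: "evx 0 H' = evx 0 H" using gh by (metis mult_left_cancel)
  have dG: "degree G' = degree G" "degree H' = degree H"
    using evx_monic(1)[OF G(2), of 0] evx_monic(1)[OF G'(2), of 0] evx_monic(1)[OF G(3), of 0]
      evx_monic(1)[OF G'(3), of 0] G(4) G'(4) hh by simp_all
  obtain r t where rt: "r * g + t * evx 0 H = 1" by (rule coprime_cofactor[OF sf gh(1)])
  have "varX ^ Suc d dvd G' * H' - G * H" using G(1) G'(1) by simp
  then have "varX ^ Suc d dvd G' - G"
    by (intro hensel_unique[OF G'(2,3) G(2,3) dG G'(4) hh G(4) refl rt])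
  moreover have "degree (coeff (G' - G) k) < Suc d" for k
    using xdegree_factor[OF G(1-3), of k] xdegree_factor[OF G'(1-3), of k]
    by (simp add: degree_diff_le less_Suc_eq_le)
  ultimately have "G' - G = 0" by (rule varX_power_dvd_small)
  then show "G' = G" by simp
  moreover have "G \<noteq> 0" using G(2) by auto
  ultimately show "H' = H" using G(1) G'(1) by (metis mult_left_cancel)
qed

text \<open>A common zero of two factors is a singular point of the section. The norm of
  \<open>pderiv f\<close> over the integers vanishes at its abscissa x, which is therefore
  algebraic. It is nonzero because the line x = 0 has no multiple root.\<close>

lemma algebraic_common_zero:
  assumes sf: "rsquarefree (lin a)" and G: "plane a v = G * H"
    and xy: "poly (evx x G) y = 0" "poly (evx x H) y = 0"
  shows "algebraic (of_int i + of_int j * x + of_int k * y)" "x \<noteq> 0"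
proof -
  have y2: "poly (evx x (plane a v)) y = 0" "poly (pderiv (evx x (plane a v))) y = 0"
    unfolding G evx_hom using xy by (simp_all add: pderiv_mult)
  show "x \<noteq> 0"
  proof
    assume "x = 0"
    then have "poly (lin a) y = 0" "poly (pderiv (lin a)) y = 0" using y2 by (simp_all add: evx_plane_0)
    then show False using sf unfolding rsquarefree_roots by blast
  qed
  obtain f where f: "lead_coeff f = 1" "degree f = d" "bimap of_int f = plane a v"
    by (rule integral_plane)
  note ah = idom_hom_map_poly[OF idom_hom_of_int[where 'a = complex]]
  note b = idom_homD[OF idom_hom_map_poly[OF ah]]
  have pd: "pderiv (plane a v) = bimap of_int (pderiv f)"
    unfolding f(3)[symmetric] by (rule idom_homD(12)[OF ah, symmetric])
  have ev: "poly (evx x (bimap of_int q)) y = eval2 of_int x y q" for q :: "int poly poly"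
    unfolding poly_evx by (induction q) (simp_all add: Polynomial.map_poly_pCons eval2_pCons map_poly_idI')
  have "algebraic x"
    using f(1)
  proof (cases rule: monic_norm[of f "pderiv f"])
    case (zero_divisor r)
    \<comment> \<open>Separability over the complex numbers, inherited from the line x = 0, excludes
      a zero divisor over the integers.\<close>
    obtain \<Omega> z z' where \<Omega>: "\<Omega> \<noteq> 0" "[:\<Omega>:] = pderiv (plane a v) * z + plane a v * z'"
      using generically_separable[OF plane_monic(1)[of a v]] sf unfolding evx_plane_0 by blast
    define r' where "r' = (bimap of_int r :: complex poly poly)"
    have "bimap of_int f dvd (bimap of_int (r * pderiv f) :: complex poly poly)"
      using zero_divisor(3) by (rule b)
    then have "plane a v dvd r' * pderiv (plane a v)" unfolding b(6) f(3) pd r'_def .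
    then have "plane a v dvd r' * pderiv (plane a v) * z + plane a v * (r' * z')" by simp
    also have "r' * pderiv (plane a v) * z + plane a v * (r' * z') = [:\<Omega>:] * r'"
      unfolding \<Omega>(2) by (simp only: distrib_right distrib_left ac_simps)
    finally have "plane a v dvd r'" using monic_dvd_const_mult[OF plane_monic(1) \<Omega>(1)] by blast
    moreover have "plane a v \<noteq> 0" using plane_monic(1)[of a v] by auto
    ultimately have "r' = 0"
      by (rule monic_dvd_small) (use zero_divisor(2) f(2) in \<open>simp add: plane_monic r'_def coeff_map_poly\<close>)
    then have "r = 0" unfolding r'_def by (auto simp: poly_eq_iff coeff_map_poly)
    then show ?thesis using zero_divisor(1) by simp
  next
    case (norm \<Omega> z z')
    note hh = idom_homD[OF idom_hom_eval2[OF idom_hom_of_int, of x y]]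
    have f0: "eval2 of_int x y f = 0" using y2(1) unfolding f(3)[symmetric] ev .
    have f1: "eval2 of_int x y (pderiv f) = 0" using y2(2) unfolding evx_pderiv pd ev .
    have "eval2 of_int x y [:\<Omega>:] = 0" unfolding norm(2) by (simp only: hh(3,6) f0 f1) simp
    then have "poly (map_poly of_int \<Omega>) x = 0" by (simp add: eval2_const[OF idom_hom_of_int])
    moreover have "map_poly of_int \<Omega> \<noteq> (0 :: complex poly)" using norm(1) by (auto simp: poly_eq_iff coeff_map_poly)
    ultimately show ?thesis by (intro algebraicI) (simp_all add: coeff_map_poly)
  qed
  moreover have "eval2 of_int x y f = 0" using y2(1) unfolding f(3)[symmetric] ev .
  ultimately show "algebraic (of_int i + of_int j * x + of_int k * y)" by (rule algebraic_affine[OF _ f(1)])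
qed

text \<open>Differentiate the factorisation in s at s = 0. At a common zero of both factors the
  product rule gives 0, and the chain rule gives x times the j-th partial derivative of F.\<close>

lemma pencil_derivative:
  assumes GH: "pencil a v (coord j) = G * H" and x: "x \<noteq> 0" and j: "j \<le> n"
    and xy: "poly (evx x (spec 0 G)) y = 0" "poly (evx x (spec 0 H)) y = 0"
  shows "form_deriv_eval c n j (\<lambda>i. of_int (\<kappa> * a i) + of_int (\<kappa> * v i) * x + of_int (e i) * y) = 0"
proof -
  define \<epsilon> where "\<epsilon> h = eval2 (\<lambda>c. c) x y (spec 0 h)" for h
  define D where "D = map_poly (map_poly (pderiv :: complex poly \<Rightarrow> _))"
  interpret D: derivation D unfolding D_def by (intro derivation_map_poly pderiv.derivation_axioms)
  have h: "idom_hom \<epsilon>"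
  proof -
    interpret A: idom_hom "spec 0" by (rule idom_hom_spec)
    interpret B: idom_hom "eval2 (\<lambda>c. c) x y" by (rule idom_hom_eval2[OF idom_hom_id])
    show ?thesis unfolding \<epsilon>_def by unfold_locales (simp_all add: hom_distribs)
  qed
  note hD = idom_homD[OF h]
  have "\<epsilon> G = 0" "\<epsilon> H = 0" using xy unfolding \<epsilon>_def poly_evx by simp_all
  then have z: "\<epsilon> (D (pencil a v (coord j))) = 0" unfolding GH D.leibniz hD by simp
  let ?x = "\<lambda>i. [:[:[:of_int (\<kappa> * a i):], [:of_int (\<kappa> * v i), of_int (\<kappa> * coord j i):]:], [:[:of_int (e i):]:]:] :: complex poly poly poly"
  have Dk: "D [:[:[:1 / of_int \<kappa>:]:]:] = 0" unfolding D_def by (simp add: Polynomial.map_poly_pCons pderiv_pCons)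
  have Dx: "D (?x i) = [:[:0, [:of_int (\<kappa> * coord j i):]:]:]" for i
    unfolding D_def by (simp add: Polynomial.map_poly_pCons pderiv_pCons)
  have ex: "\<epsilon> (?x i) = of_int (\<kappa> * a i) + of_int (\<kappa> * v i) * x + of_int (e i) * y" for i
    unfolding \<epsilon>_def eval2_def by (simp add: Polynomial.map_poly_pCons map_poly_idI' mult.commute)
  have "D (pencil a v (coord j)) = [:[:[:1 / of_int \<kappa>:]:]:] *
      (\<Sum>i\<le>n. form_deriv_eval c n i ?x * [:[:0, [:of_int (\<kappa> * coord j i):]:]:])"
    unfolding pencil_def D.leibniz Dk D.form_eval Dx by simp
  then have "\<epsilon> (D (pencil a v (coord j))) = (1 / of_int \<kappa>) *
      (\<Sum>i\<le>n. form_deriv_eval c n i (\<lambda>i. \<epsilon> (?x i)) * (of_int (\<kappa> * coord j i) * x))"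
    by (simp only: hD form_deriv_eval_hom[OF h])
      (simp add: \<epsilon>_def eval2_def Polynomial.map_poly_pCons map_poly_idI' mult.commute)
  also have "(\<Sum>i\<le>n. form_deriv_eval c n i (\<lambda>i. \<epsilon> (?x i)) * (of_int (\<kappa> * coord j i) * x)) =
      (\<Sum>i\<le>n. if i = j then form_deriv_eval c n j (\<lambda>i. \<epsilon> (?x i)) * (of_int \<kappa> * x) else 0)"
    by (intro sum.cong) (auto simp: coord_def)
  also have "\<dots> = form_deriv_eval c n j (\<lambda>i. \<epsilon> (?x i)) * (of_int \<kappa> * x)" using j by simp
  finally have "form_deriv_eval c n j (\<lambda>i. \<epsilon> (?x i)) = 0" using z kappa_nz x by simp
  then show ?thesis unfolding ex .
qed

lemma irreducible_plane:
  obtains a v where "rsquarefree (lin a)" "irreducible (plane a v)"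
proof -
  obtain a where a: "rsquarefree (lin a)" by (rule base_line)
  obtain l where l: "\<exists>i\<le>n. l i \<noteq> 0" "dot n l e = 0" "dot n l a = 0" by (rule orthogonal_vector[OF n_ge])
  \<comment> \<open>The first condition keeps factors from meeting at infinity, as
    \<open>bezout_common_zero\<close> requires; the second makes the singular point nonzero, since l
    . z = \<kappa> x (l . v).\<close>
  define nice where "nice v \<longleftrightarrow> rsquarefree (lin v) \<and> dot n l v \<noteq> 0" for v
  have sf_cofinite: "finite {s :: int. \<not> rsquarefree (lin (\<lambda>i. v i + s * u i))}" if "rsquarefree (lin v)" for v u
  proof -
    have "finite {s. \<not> rsquarefree (evx s (plane v u))}"
      using that by (intro finite_not_rsquarefree plane_monic(1)) (simp add: evx_plane_0)
    then have "finite ((of_int :: int \<Rightarrow> complex) -` {s. \<not> rsquarefree (evx s (plane v u))})"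
      by (rule finite_vimageI) (simp add: inj_def)
    then show ?thesis by (simp add: vimage_def evx_plane)
  qed
  have nice_cofinite: "finite {s :: int. \<not> nice (\<lambda>i. v i + s * u i)}" if "nice v" for v u
  proof -
    have "{s :: int. \<not> nice (\<lambda>i. v i + s * u i)} \<subseteq>
        {s. \<not> rsquarefree (lin (\<lambda>i. v i + s * u i))} \<union> {s. dot n l v + s * dot n l u = 0}"
      unfolding nice_def dot_add by blast
    moreover have "finite ({s :: int. \<not> rsquarefree (lin (\<lambda>i. v i + s * u i))} \<union> {s. dot n l v + s * dot n l u = 0})"
      using that unfolding nice_def by (intro finite_UnI sf_cofinite finite_linear_zeros) auto
    ultimately show ?thesis by (rule finite_subset)
  qed
  have "\<exists>v. nice v"
  proof -
    have "infinite (UNIV - ({s :: int. \<not> rsquarefree (lin (\<lambda>i. a i + s * l i))} \<union> {0}))"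
      by (intro Diff_infinite_finite finite_UnI sf_cofinite[OF a]) (simp_all add: infinite_UNIV_int)
    then have "UNIV - ({s :: int. \<not> rsquarefree (lin (\<lambda>i. a i + s * l i))} \<union> {0}) \<noteq> {}"
      by (metis finite.emptyI)
    then obtain s :: int where s: "rsquarefree (lin (\<lambda>i. a i + s * l i))" "s \<noteq> 0" by blast
    then have "nice (\<lambda>i. a i + s * l i)" unfolding nice_def dot_add using l(3) dot_self[OF l(1)] by simp
    then show ?thesis by blast
  qed
  then obtain v where v: "nice v" "\<And>w. nice w \<Longrightarrow> card (factors0 a v) \<le> card (factors0 a w)"
    using ex_has_least_nat[of nice _ "\<lambda>v. card (factors0 a v)"] by blast
  have "factors0 a v = {}"
  proof (rule ccontr)
    assume "factors0 a v \<noteq> {}"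
    then obtain g where g: "g \<in> factors0 a v" by blast
    then obtain G H where G: "plane a v = G * H" "lead_coeff G = 1" "lead_coeff H = 1" "0 < degree G" "0 < degree H" "evx 0 G = g"
      unfolding factors0_def by blast
    obtain x y where xy: "poly (evx x G) y = 0" "poly (evx x H) y = 0"
    proof (rule bezout_common_zero[OF G(2,4,3,5)])
      show "totdeg_le (degree (G * H)) (G * H)" unfolding G(1)[symmetric] plane_monic(2) by (rule totdeg_plane)
      show "rsquarefree (evx 1 (coeff (tot (G * H)) (degree (G * H))))"
        using v(1) unfolding G(1)[symmetric] plane_monic(2) top_plane nice_def by blast
    qed blast
    have x0: "x \<noteq> 0" by (rule algebraic_common_zero(2)[OF a G(1) xy])
    define z where "z i = of_int (\<kappa> * a i) + of_int (\<kappa> * v i) * x + of_int (e i) * y" for i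
    show False
    proof (rule singular_contradiction)
      fix i show "algebraic (z i)" unfolding z_def by (rule algebraic_common_zero(1)[OF a G(1) xy])
    next
      have "dot n l z = of_int \<kappa> * dot n l (\<lambda>i. of_int (a i)) + of_int \<kappa> * x * dot n l (\<lambda>i. of_int (v i)) + y * dot n l (\<lambda>i. of_int (e i))"
        unfolding z_def by (simp add: dot_def algebra_simps sum.distrib sum_distrib_left)
      then show "dot n l z \<noteq> 0" using v(1) l e_nz x0 unfolding nice_def by (simp add: dot_of_int)
    next
      fix j assume j: "j \<le> n"
      let ?w = "\<lambda>s :: int. \<lambda>i. v i + s * coord j i"
      \<comment> \<open>A divisor that occurs for infinitely many s extends over the pencil and so
        occurs at s = 0. Divisors outside \<open>factors0 a v\<close> thus occur for finitely many s
        only.\<close>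
      have spec: "g' \<in> factors0 a v" if inf: "infinite {s. g' \<in> factors0 a (?w s)}" for g'
      proof -
        obtain G' H' where G': "pencil a v (coord j) = G' * H'" "lead_coeff G' = 1" "evx 0 G' = lift_const g'"
          by (rule pencil_factor[OF a inf])
        note sp = pencil_factor_spec[OF G']
        obtain s where "g' \<in> factors0 a (?w s)" using inf not_finite_existsD by blast
        then obtain P Q where P: "plane a (?w s) = P * Q" "lead_coeff P = 1" "lead_coeff Q = 1" "0 < degree P" "0 < degree Q" "evx 0 P = g'"
          unfolding factors0_def by blast
        have dP: "degree P + degree Q = d"
          using plane_monic(2)[of a "?w s"] P(2,3) unfolding P(1) by (subst (asm) degree_mult_eq) auto
        have "degree (spec 0 G') = degree P"
          using evx_monic(1)[OF sp(2), of 0] evx_monic(1)[OF P(2), of 0] sp(4) P(6) by simp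
        moreover have "degree (spec 0 G') + degree (spec 0 H') = d"
          using plane_monic(2)[of a v] sp(2,3) unfolding sp(1) by (subst (asm) degree_mult_eq) auto
        ultimately have "0 < degree (spec 0 G')" "0 < degree (spec 0 H')" using P(4,5) dP by simp_all
        then show ?thesis unfolding factors0_def using sp by blast
      qed
      \<comment> \<open>Outside a finite set of s no divisor is new, and by the minimal choice of v
        none is lost, so g persists.\<close>
      define B where "B = (\<Union>g'\<in>{g'. g' dvd lin a \<and> lead_coeff g' = 1} - factors0 a v. {s. g' \<in> factors0 a (?w s)})"
      have finB: "finite (B \<union> {s. \<not> nice (?w s)})"
        unfolding B_def using spec
        by (intro finite_UnI nice_cofinite[OF v(1)] finite_UN_I finite_Diff finite_divisors_lin) blast
      have "g \<in> factors0 a (?w s)" if "s \<notin> B \<union> {s. \<not> nice (?w s)}" for s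
      proof -
        have "factors0 a (?w s) \<subseteq> factors0 a v"
          using that factors0_subset[of a "?w s"] unfolding B_def by blast
        moreover have "card (factors0 a v) \<le> card (factors0 a (?w s))" using that by (intro v(2)) simp
        ultimately have "factors0 a (?w s) = factors0 a v" by (intro card_seteq finite_factors0)
        then show ?thesis using g by simp
      qed
      then have "- (B \<union> {s. \<not> nice (?w s)}) \<subseteq> {s. g \<in> factors0 a (?w s)}" by blast
      moreover have "infinite (- (B \<union> {s. \<not> nice (?w s)}))"
        using finB by (simp add: Compl_eq_Diff_UNIV Diff_infinite_finite infinite_UNIV_int del: Compl_Un)
      ultimately have inf: "infinite {s. g \<in> factors0 a (?w s)}" using finite_subset by blast
      obtain G' H' where G': "pencil a v (coord j) = G' * H'" "lead_coeff G' = 1" "evx 0 G' = lift_const g"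
        by (rule pencil_factor[OF a inf])
      note sp = pencil_factor_spec[OF G']
      \<comment> \<open>One common zero of G and H has to serve for all directions j, so the
        specialised factors must be G and H themselves.\<close>
      have "spec 0 G' = G" "spec 0 H' = H" using factor_unique[OF a G(1-3,6) sp] by simp_all
      then show "form_deriv_eval c n j z = 0"
        unfolding z_def using xy by (intro pencil_derivative[OF G'(1) x0 j]) simp_all
    qed
  qed
  have "irreducible (plane a v)"
  proof (rule irreducibleI)
    show "plane a v \<noteq> 0" using plane_monic(1)[of a v] by auto
    show "\<not> plane a v dvd 1"
      using plane_monic(2)[of a v] d_pos dvd_imp_degree_le[of "plane a v" 1] by auto
    fix P Q assume PQ: "plane a v = P * Q"
    show "P dvd 1 \<or> Q dvd 1"
    proof (rule ccontr)
      assume nu: "\<not> (P dvd 1 \<or> Q dvd 1)"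
      have deg: "degree P \<noteq> 0" "degree Q \<noteq> 0"
        using nu monic_dvd_unit[OF _ plane_monic(1)[of a v], of P] monic_dvd_unit[OF _ plane_monic(1)[of a v], of Q]
        unfolding PQ by auto
      define r t where "r = lead_coeff P" and "t = lead_coeff Q"
      have rt: "r * t = 1" using plane_monic(1)[of a v] unfolding PQ lead_coeff_mult r_def t_def .
      have rt0: "r \<noteq> 0" "t \<noteq> 0" using rt by auto
      have one: "[:t:] * [:r:] = (1 :: complex poly poly)" using rt by (simp add: one_pCons mult.commute)
      have "plane a v = ([:t:] * [:r:]) * (P * Q)" unfolding one PQ by simp
      then have "plane a v = ([:t:] * P) * ([:r:] * Q)" by (simp only: ac_simps)
      moreover have "lead_coeff ([:t:] * P) = lead_coeff [:t:] * r" "lead_coeff ([:r:] * Q) = lead_coeff [:r:] * t"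
        unfolding r_def t_def by (rule lead_coeff_mult)+
      then have "lead_coeff ([:t:] * P) = 1" "lead_coeff ([:r:] * Q) = 1" using rt by (simp_all add: mult.commute)
      moreover have "0 < degree ([:t:] * P)" "0 < degree ([:r:] * Q)" using deg rt0 by simp_all
      ultimately have "evx 0 ([:t:] * P) \<in> factors0 a v" unfolding factors0_def by blast
      then show False using \<open>factors0 a v = {}\<close> by simp
    qed
  qed
  then show ?thesis using that a by blast
qed

text \<open>A point with f_Y nonzero modulo p is a simple zero of the polynomial \<kappa> f(x, Y) in
  Y for a fixed integer x, and the values of this polynomial are values of F. The bound on p keeps p
  from dividing \<kappa>.\<close>

lemma dense_for_large_primes: "\<exists>M. \<forall>p. prime p \<and> M < p \<longrightarrow> padic_dense p (ratio_set n c)"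
proof -
  obtain a v where a: "rsquarefree (lin a)" and irr: "irreducible (plane a v)" by (rule irreducible_plane)
  obtain f where f: "lead_coeff f = 1" "degree f = d" "bimap of_int f = plane a v"
    "[:[:\<kappa>:]:] * f = form_eval c n (\<lambda>i. [:[:\<kappa> * a i, \<kappa> * v i:], [:e i:]:])"
    by (rule integral_plane)
  note ah = idom_hom_map_poly[OF idom_hom_of_int[where 'a = complex]]
  have ev: "eval2 of_int 0 \<theta> q = poly (evx 0 (bimap of_int q)) \<theta>" for q :: "int poly poly" and \<theta> :: complex
    unfolding poly_evx by (induction q) (simp_all add: Polynomial.map_poly_pCons eval2_pCons map_poly_idI')
  have pd: "bimap of_int (pderiv f) = pderiv (plane a v)"
    unfolding f(3)[symmetric] by (rule idom_homD(12)[OF ah])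
  have "degree (lin a) \<noteq> 0" using lin_monic(2)[of a] d_pos by simp
  \<comment> \<open>Any root on the squarefree line x = 0 can be the centre of the power series
    branch used for the Wronskian.\<close>
  then obtain \<theta> where \<theta>: "poly (lin a) \<theta> = 0" using fundamental_theorem_of_algebra constant_degree by metis
  then have \<theta>': "poly (pderiv (lin a)) \<theta> \<noteq> 0" using a unfolding rsquarefree_roots by blast
  have t: "totdeg_le (degree f) f"
    using totdeg_plane[of a v] unfolding f(2) f(3)[symmetric] totdeg_le_def by (simp add: coeff_map_poly)
  have e0: "eval2 of_int 0 \<theta> f = 0" unfolding ev f(3) evx_plane_0 by (rule \<theta>)
  have e1: "eval2 of_int 0 \<theta> (pderiv f) \<noteq> 0"
    unfolding ev pd evx_pderiv[symmetric] evx_plane_0 by (rule \<theta>')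
  obtain M where M: "\<And>p. prime p \<Longrightarrow> M < p \<Longrightarrow> has_smooth_point f p"
    using curve_smooth_point[OF f(1) _ t _ e0 e1] f(2) d_pos irr unfolding f(3) by blast
  have "padic_dense p (ratio_set n c)" if p: "prime p" "M + nat \<bar>\<kappa>\<bar> < p" for p
  proof -
    obtain x y where xy: "int p dvd eval2 (\<lambda>c. c) x y f" "\<not> int p dvd eval2 (\<lambda>c. c) x y (pderiv f)"
      using M[of p] p unfolding has_smooth_point_def by auto
    define h where "h = [:\<kappa>:] * evx x f"
    have h: "h = form_eval c n (\<lambda>i. [:\<kappa> * a i + x * (\<kappa> * v i), e i:])"
    proof -
      have "h = evx x ([:[:\<kappa>:]:] * f)" unfolding h_def evx_hom by (simp add: evx_def Polynomial.map_poly_pCons)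
      then show ?thesis unfolding f(4) form_eval_hom[OF idom_hom_evx]
        by (simp add: evx_def Polynomial.map_poly_pCons)
    qed
    show ?thesis
    proof (rule padic_dense_if_simple_zero[OF p(1)])
      show "int p dvd poly h y" using xy(1) by (simp add: h_def poly_evx)
      have "\<not> int p dvd \<kappa>"
      proof
        assume "int p dvd \<kappa>"
        then have "\<bar>int p\<bar> \<le> \<bar>\<kappa>\<bar>" using e_nz dvd_imp_le_int by blast
        then show False using p(2) by linarith
      qed
      moreover have "poly (pderiv h) y = \<kappa> * eval2 (\<lambda>c. c) x y (pderiv f)"
        by (simp add: h_def pderiv_smult evx_pderiv poly_evx)
      ultimately show "\<not> int p dvd poly (pderiv h) y" using xy(2) p(1) by (simp add: prime_dvd_mult_iff)
      show "poly h t = form_eval c n (\<lambda>i. (\<kappa> * a i + x * (\<kappa> * v i)) + t * e i)" for t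
        unfolding h form_eval_hom[OF idom_hom_poly] by simp
    qed
  qed
  then show ?thesis by blast
qed

end

text \<open>A form that vanishes at all integer points is zero along every coordinate direction
  through (1, 0, ..., 0), so this point would be singular.\<close>

lemma nonzero_value:
  assumes "non_singular n c"
  obtains e :: "nat \<Rightarrow> int" where "form_eval c n e \<noteq> 0"
proof (rule ccontr)
  assume "\<not> thesis"
  then have zero: "form_eval c n w = 0" for w :: "nat \<Rightarrow> int" using that by blast
  define x :: "nat \<Rightarrow> int" where "x i = (if i = 0 then 1 else 0)" for i
  have "form_deriv_eval c n j (\<lambda>i. of_int (x i) :: complex) = 0" if j: "j \<le> n" for j
  proof -
    let ?g = "\<lambda>i. [:of_int (x i), if i = j then 1 else 0:] :: complex poly"
    define P where "P = form_eval c n ?g"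
    have "poly P (of_int s) = 0" for s
    proof -
      have "poly P (of_int s) = form_eval c n (\<lambda>i. of_int (x i + s * (if i = j then 1 else 0)))"
        unfolding P_def form_eval_hom[OF idom_hom_poly] by (rule form_eval_cong) simp
      also have "\<dots> = of_int (form_eval c n (\<lambda>i. x i + s * (if i = j then 1 else 0)))"
        by (rule form_eval_hom[OF idom_hom_of_int, symmetric])
      finally show ?thesis unfolding zero by simp
    qed
    then have "range (of_int :: int \<Rightarrow> complex) \<subseteq> {s. poly P s = 0}" by auto
    moreover have "infinite (range (of_int :: int \<Rightarrow> complex))"
      by (subst finite_image_iff) (auto simp: inj_on_def infinite_UNIV_int)
    ultimately have "P = 0" using poly_roots_finite finite_subset by blast
    then have "pderiv P = 0" by simp
    then have "(\<Sum>i\<le>n. form_deriv_eval c n i ?g * pderiv (?g i)) = 0" unfolding P_def pderiv.form_eval .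
    then have "poly (\<Sum>i\<le>n. form_deriv_eval c n i ?g * pderiv (?g i)) 0 = 0" by simp
    then have "(\<Sum>i\<le>n. form_deriv_eval c n i (\<lambda>i. poly (?g i) 0) * poly (pderiv (?g i)) 0) = 0"
      by (simp only: poly_sum poly_mult form_deriv_eval_hom[OF idom_hom_poly])
    moreover have "(\<Sum>i\<le>n. form_deriv_eval c n i (\<lambda>i. poly (?g i) 0) * poly (pderiv (?g i)) 0) =
        (\<Sum>i\<le>n. if i = j then form_deriv_eval c n j (\<lambda>i. of_int (x i)) else 0)"
      by (intro sum.cong) (auto simp: pderiv_pCons)
    ultimately show ?thesis using j by simp
  qed
  moreover have "algebraic (of_int (x i) :: complex)" for i by (rule rat_imp_algebraic) simp
  moreover have "\<exists>i\<le>n. (of_int (x i) :: complex) \<noteq> 0" by (intro exI[of _ 0]) (simp add: x_def)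
  ultimately have "\<exists>x :: nat \<Rightarrow> complex. (\<forall>i\<le>n. algebraic (x i)) \<and> (\<exists>i\<le>n. x i \<noteq> 0) \<and>
      (\<forall>j\<le>n. form_deriv_eval c n j x = 0)"
    by (intro exI[of _ "\<lambda>i. of_int (x i)"] conjI allI impI) simp_all
  then show False using assms unfolding non_singular_def by (rule notE[rotated])
qed

text \<open>With the identity as change of variables; it converts order at least 3 into n >=
  2.\<close>

lemma form_order_le: "form_order n c \<le> n + 1"
proof -
  let ?I = "\<lambda>i j. if i = j then 1 else 0 :: rat"
  have one: "(\<Sum>j\<le>n. ?I i j * ?I j k) = ?I i k" if "i \<le> n" for i k
  proof -
    have "(\<Sum>j\<le>n. ?I i j * ?I j k) = (\<Sum>j\<le>n. if j = i then ?I i k else 0)" by (intro sum.cong) auto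
    then show ?thesis using that by simp
  qed
  have "Defs.invertible_mat n ?I" unfolding Defs.invertible_mat_def by (rule exI[of _ ?I]) (use one in auto)
  moreover have "involves_only n (\<lambda>x. form_eval c n (mat_apply n ?I x)) {..n}"
    unfolding involves_only_def
  proof (intro allI impI)
    fix x y :: "nat \<Rightarrow> rat" assume "\<forall>i\<in>{..n}. x i = y i"
    then have "mat_apply n ?I x = mat_apply n ?I y" unfolding mat_apply_def by (intro ext sum.cong) auto
    then show "form_eval c n (mat_apply n ?I x) = form_eval c n (mat_apply n ?I y)" by simp
  qed
  ultimately show ?thesis unfolding form_order_def
    by (intro Least_le exI[of _ ?I] exI[of _ "{..n}"]) simp
qed

theorem theorem1p2:
  fixes d n :: nat and c :: "(nat \<Rightarrow> nat) \<Rightarrow> int"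
  assumes "d > 0"
    and "is_form n d c"
    and "non_singular n c"
    and "form_order n c \<ge> 3"
  shows "\<exists>M::nat. \<forall>p::nat. prime p \<and> p > M \<longrightarrow> padic_dense p (ratio_set n c)"
proof -
  obtain e where "form_eval c n e \<noteq> (0 :: int)" by (rule nonzero_value[OF assms(3)])
  then interpret nonsingular_form n d c e
    using assms form_order_le[of n c] by unfold_locales auto
  show ?thesis by (rule dense_for_large_primes)
qed

end
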